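(* Let $\delta$ be an ordinal of cardinality at most $\mathfrak c$ (the cardinality of the continuum), and let $(G_\alpha)_{\alpha\le\delta}$ be a chain of groups $$G_0\le G_1\le\cdots\le G_\alpha\le G_{\alpha+1}\le\cdots\le G_\delta$$ (each a subgroup of the subsequent ones) such that $G_\lambda=\bigcup_{\alpha<\lambda}G_\alpha$ for each limit ordinal $\lambda\le\delta$. Suppose that for each successor ordinal $\alpha+1\le\delta$ one of the following holds: (i) $G_{\alpha+1}=G_\alpha *_{C_\alpha}F_\alpha$, where $F_\alpha$ is a nontrivial subgroup of $G_\alpha$, and either $C_\alpha=\{1\}$ or $C_\alpha=C_{G_\alpha}(u)=C_{F_\alpha}(u)$ for some nontrivial $u\in F_\alpha$; (ii) $G_{\alpha+1}$ is an extension of a centralizer of $G_\alpha$. Then $G_\delta$ is a $BP$-group embeddable to $G[[r]]$ if and only if $G_0$ is a $BP$-group embeddable to $G[[r]]$.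
   Context: $G[[r]]$ is the group of formal power series of the form $r+\sum_{i=1}^\infty c_i r^{i+1}$, $c_i\in\mathbb C$, under composition of series. A group $A$ is embeddable to a group $B$ if there is an injective homomorphism $A\to B$. $C_G(u)$ denotes the centralizer of an element $u$ in a group $G$. Commutator: $[a,b]=aba^{-1}b^{-1}$. $BP$-group (big powers condition): a tuple $u=(u_1,\dots,u_k)$, $k\in\mathbb N$, of nontrivial elements of a group $G$ is commutation-free if $[u_i,u_{i+1}]\ne 1$ for all $1\le i\le k-1$. It is independent if there is an integer $n=n(u)\in\mathbb N$ such that $u_1^{\alpha_1}\cdots u_k^{\alpha_k}\ne 1$ for any integers $\alpha_1,\dots,\alpha_k\ge n$. $G$ is a $BP$-group if every commutation-free tuple in $G$ is independent. An extension of a centralizer of a group $G$ is the group $\langle G,t\mid [c,t]=1,\ c\in C_G(u)\rangle$ for some nontrivial $u\in G$; it contains $G$ in the natural way. In (i), $G_\alpha*_{C_\alpha}F_\alpha$ is the free product of $G_\alpha$ and a (separate) copy of the group $F_\alpha$, amalgamated along $C_\alpha$ via the inclusions $C_\alpha\le G_\alpha$ and $C_\alpha\le F_\alpha$ (the ordinary free product if $C_\alpha=\{1\}$); $G_\alpha$ is included in $G_{\alpha+1}$ as the first factor. *)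

theory Defs
  imports
    "HOL-Algebra.Group"
    "HOL-Computational_Algebra.Formal_Power_Series"
    Complex_Main
begin

unbundle cardinal_syntax

definition series_group :: "complex fps monoid" where
  "series_group =
    \<lparr>carrier = {f. fps_nth f 0 = 0 \<and> fps_nth f 1 = 1}, monoid.mult = fps_compose, one = fps_X\<rparr>"

lemma group_series_group: "group series_group"
proof (rule groupI)
  fix f assume "f \<in> carrier series_group"
  then have f: "fps_nth f 0 = 0" "fps_nth f 1 = 1" by (auto simp: series_group_def)
  have "fps_inv f oo f = fps_X" using fps_inv[of f] f by simp
  moreover have "fps_nth (fps_inv f) 0 = 0" "fps_nth (fps_inv f) 1 = 1"
    using f by (simp_all add: fps_inv_def)
  ultimately show "\<exists>g\<in>carrier series_group. g \<otimes>\<^bsub>series_group\<^esub> f = \<one>\<^bsub>series_group\<^esub>"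
    by (auto simp: series_group_def)
next
  fix f g h
  assume "f \<in> carrier series_group" "g \<in> carrier series_group" "h \<in> carrier series_group"
  then show "f \<otimes>\<^bsub>series_group\<^esub> g \<otimes>\<^bsub>series_group\<^esub> h =
      f \<otimes>\<^bsub>series_group\<^esub> (g \<otimes>\<^bsub>series_group\<^esub> h)"
    by (auto simp: series_group_def fps_compose_assoc)
next
  fix f g assume "f \<in> carrier series_group" "g \<in> carrier series_group"
  then show "f \<otimes>\<^bsub>series_group\<^esub> g \<in> carrier series_group"
    by (simp add: series_group_def fps_compose_nth)
next
  show "\<one>\<^bsub>series_group\<^esub> \<in> carrier series_group"
    by (simp add: series_group_def)
next
  fix f assume "f \<in> carrier series_group"
  then show "\<one>\<^bsub>series_group\<^esub> \<otimes>\<^bsub>series_group\<^esub> f = f"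
    by (simp add: series_group_def)
qed

definition embeddable :: "('a, 'm) monoid_scheme \<Rightarrow> ('b, 'n) monoid_scheme \<Rightarrow> bool" where
  "embeddable A B \<longleftrightarrow> mon A B \<noteq> {}"

definition centralizer :: "('a, 'm) monoid_scheme \<Rightarrow> 'a \<Rightarrow> 'a set" where
  "centralizer G u = {c \<in> carrier G. c \<otimes>\<^bsub>G\<^esub> u = u \<otimes>\<^bsub>G\<^esub> c}"

definition commutator :: "('a, 'm) monoid_scheme \<Rightarrow> 'a \<Rightarrow> 'a \<Rightarrow> 'a" where
  "commutator G a b = a \<otimes>\<^bsub>G\<^esub> b \<otimes>\<^bsub>G\<^esub> inv\<^bsub>G\<^esub> a \<otimes>\<^bsub>G\<^esub> inv\<^bsub>G\<^esub> b"

text \<open>Tuples are lists. They have length at least 1: the empty product is trivial, so the empty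
  tuple would be commutation-free but never independent.\<close>

definition commutation_free :: "('a, 'm) monoid_scheme \<Rightarrow> 'a list \<Rightarrow> bool" where
  "commutation_free G us \<longleftrightarrow>
     us \<noteq> [] \<and> set us \<subseteq> carrier G - {\<one>\<^bsub>G\<^esub>} \<and>
     (\<forall>i. Suc i < length us \<longrightarrow> commutator G (us ! i) (us ! Suc i) \<noteq> \<one>\<^bsub>G\<^esub>)"

definition power_product :: "('a, 'm) monoid_scheme \<Rightarrow> 'a list \<Rightarrow> int list \<Rightarrow> 'a" where
  "power_product G us as = foldr (\<otimes>\<^bsub>G\<^esub>) (map2 (\<lambda>u a. u [^]\<^bsub>G\<^esub> a) us as) \<one>\<^bsub>G\<^esub>"

definition independent_tuple :: "('a, 'm) monoid_scheme \<Rightarrow> 'a list \<Rightarrow> bool" where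
  "independent_tuple G us \<longleftrightarrow>
     (\<exists>n::nat. \<forall>as::int list. length as = length us \<and> (\<forall>a\<in>set as. int n \<le> a) \<longrightarrow>
        power_product G us as \<noteq> \<one>\<^bsub>G\<^esub>)"

definition BP_group :: "('a, 'm) monoid_scheme \<Rightarrow> bool" where
  "BP_group G \<longleftrightarrow>
     group G \<and> (\<forall>us. commutation_free G us \<longrightarrow> independent_tuple G us)"

text \<open>A letter \<open>(x, True)\<close> stands for the generator \<open>x\<close> and \<open>(x, False)\<close> for its formal inverse.\<close>

type_synonym 'x word = "('x \<times> bool) list"

definition words :: "'x set \<Rightarrow> 'x word set" where
  "words X = lists (X \<times> UNIV)"

inductive_set presented_rel :: "'x set \<Rightarrow> 'x word set \<Rightarrow> 'x word rel"
  for X :: "'x set" and R :: "'x word set" where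
  refl: "w \<in> words X \<Longrightarrow> (w, w) \<in> presented_rel X R"
| sym: "(v, w) \<in> presented_rel X R \<Longrightarrow> (w, v) \<in> presented_rel X R"
| trans: "(u, v) \<in> presented_rel X R \<Longrightarrow> (v, w) \<in> presented_rel X R \<Longrightarrow> (u, w) \<in> presented_rel X R"
| cancel: "u @ [(x, b), (x, \<not> b)] @ v \<in> words X \<Longrightarrow>
    (u @ [(x, b), (x, \<not> b)] @ v, u @ v) \<in> presented_rel X R"
| relator: "w \<in> R \<Longrightarrow> u @ w @ v \<in> words X \<Longrightarrow> (u @ w @ v, u @ v) \<in> presented_rel X R"

definition word_class :: "'x set \<Rightarrow> 'x word set \<Rightarrow> 'x word \<Rightarrow> 'x word set" where
  "word_class X R w = presented_rel X R `` {w}"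

definition presented_group :: "'x set \<Rightarrow> 'x word set \<Rightarrow> 'x word set monoid" where
  "presented_group X R =
    \<lparr>carrier = words X // presented_rel X R,
     monoid.mult = (\<lambda>A B. \<Union>u\<in>A. \<Union>v\<in>B. word_class X R (u @ v)),
     one = word_class X R []\<rparr>"

lemma words_append [simp]: "u @ v \<in> words X \<longleftrightarrow> u \<in> words X \<and> v \<in> words X"
  by (auto simp: words_def)

lemma words_Cons [simp]: "y # w \<in> words X \<longleftrightarrow> fst y \<in> X \<and> w \<in> words X"
  by (cases y) (auto simp: words_def)

lemma words_Nil [simp]: "[] \<in> words X"
  by (auto simp: words_def)

lemma presented_rel_words:
  "(v, w) \<in> presented_rel X R \<Longrightarrow> v \<in> words X \<and> w \<in> words X"
  by (induction rule: presented_rel.induct) auto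

lemma equiv_presented_rel: "equiv (words X) (presented_rel X R)"
proof (rule equivI)
  show "presented_rel X R \<subseteq> words X \<times> words X"
    using presented_rel_words by fastforce
  show "refl_on (words X) (presented_rel X R)"
    by (simp add: refl_on_def presented_rel.refl)
  show "sym (presented_rel X R)" by (rule symI) (rule presented_rel.sym)
  show "trans (presented_rel X R)" by (rule transI) (rule presented_rel.trans)
qed

lemma presented_rel_context:
  assumes "(v, w) \<in> presented_rel X R" "a \<in> words X" "b \<in> words X"
  shows "(a @ v @ b, a @ w @ b) \<in> presented_rel X R"
  using assms
proof (induction rule: presented_rel.induct)
  case (cancel u x c v)
  then show ?case using presented_rel.cancel[of "a @ u" x c "v @ b" X R] by simp
next
  case (relator w u v)
  then show ?case using presented_rel.relator[of w R "a @ u" "v @ b" X] by simp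
next
  case (refl w)
  then show ?case by (simp add: presented_rel.refl)
next
  case (sym v w)
  then show ?case using presented_rel.sym[of "a @ v @ b" "a @ w @ b" X R] by simp
next
  case (trans u v w)
  then show ?case using presented_rel.trans[of "a @ u @ b" "a @ v @ b" X R "a @ w @ b"] by simp
qed

lemma presented_rel_append:
  assumes "(u, u') \<in> presented_rel X R" "(v, v') \<in> presented_rel X R"
  shows "(u @ v, u' @ v') \<in> presented_rel X R"
  using presented_rel_context[OF assms(1), of "[]" v]
    presented_rel_context[OF assms(2), of u' "[]"] assms[THEN presented_rel_words]
    presented_rel.trans[of "u @ v" "u' @ v" X R "u' @ v'"] by simp

lemma presented_mult:
  assumes "u \<in> words X" "v \<in> words X"
  shows "word_class X R u \<otimes>\<^bsub>presented_group X R\<^esub> word_class X R v = word_class X R (u @ v)"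
proof -
  have eq: "word_class X R (u' @ v') = word_class X R (u @ v)"
    if "u' \<in> word_class X R u" "v' \<in> word_class X R v" for u' v'
  proof -
    have "(u @ v, u' @ v') \<in> presented_rel X R"
      using presented_rel_append that by (simp add: word_class_def)
    then show ?thesis
      unfolding word_class_def using equiv_class_eq[OF equiv_presented_rel] by metis
  qed
  have "u \<in> word_class X R u" "v \<in> word_class X R v"
    using assms by (simp_all add: word_class_def presented_rel.refl)
  then have "(\<Union>u'\<in>word_class X R u. \<Union>v'\<in>word_class X R v. word_class X R (u' @ v'))
      = word_class X R (u @ v)"
    using eq by blast
  then show ?thesis by (simp add: presented_group_def)
qed

lemma presented_carrier: "carrier (presented_group X R) = word_class X R ` words X"
  by (auto simp: presented_group_def word_class_def quotient_def)

lemma presented_left_inverse: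
  assumes "w \<in> words X"
  shows "(map (\<lambda>(x, b). (x, \<not> b)) (rev w) @ w, []) \<in> presented_rel X R"
  using assms
proof (induction w)
  case (Cons y w)
  obtain x b where y: "y = (x, b)" by fastforce
  let ?i = "map (\<lambda>(x, b). (x, \<not> b)) (rev w)"
  have "?i \<in> words X" using Cons.prems by (auto simp: words_def in_lists_conv_set)
  then have "?i @ [(x, \<not> b), (x, \<not> \<not> b)] @ w \<in> words X"
    using Cons.prems y by simp
  note presented_rel.cancel[OF this, of R]
  moreover have "(?i @ w, []) \<in> presented_rel X R"
    using Cons by simp
  ultimately show ?case
    using y presented_rel.trans[of "?i @ [(x, \<not> b), (x, \<not> \<not> b)] @ w" "?i @ w" X R "[]"] by simp
qed (simp add: presented_rel.refl)

lemma group_presented_group: "group (presented_group X R)"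
proof (rule groupI)
  fix A assume "A \<in> carrier (presented_group X R)"
  then obtain w where w: "w \<in> words X" "A = word_class X R w"
    by (auto simp: presented_carrier)
  let ?i = "map (\<lambda>(x, b). (x, \<not> b)) (rev w)"
  have i: "?i \<in> words X" using w by (auto simp: words_def in_lists_conv_set)
  have "word_class X R (?i @ w) = word_class X R []"
    unfolding word_class_def
    using equiv_class_eq[OF equiv_presented_rel presented_left_inverse[OF w(1)]] .
  then have "word_class X R ?i \<otimes>\<^bsub>presented_group X R\<^esub> A = \<one>\<^bsub>presented_group X R\<^esub>"
    unfolding w(2) presented_mult[OF i w(1)] by (simp add: presented_group_def)
  moreover have "word_class X R ?i \<in> carrier (presented_group X R)"
    using i by (auto simp: presented_carrier)
  ultimately show "\<exists>B\<in>carrier (presented_group X R).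
      B \<otimes>\<^bsub>presented_group X R\<^esub> A = \<one>\<^bsub>presented_group X R\<^esub>" by blast
next
  have one: "\<one>\<^bsub>presented_group X R\<^esub> = word_class X R []" by (simp add: presented_group_def)
  show "\<one>\<^bsub>presented_group X R\<^esub> \<in> carrier (presented_group X R)"
    by (auto simp: one presented_carrier)
  fix A assume "A \<in> carrier (presented_group X R)"
  then show "\<one>\<^bsub>presented_group X R\<^esub> \<otimes>\<^bsub>presented_group X R\<^esub> A = A"
    unfolding one by (auto simp: presented_carrier presented_mult)
next
  fix A B assume "A \<in> carrier (presented_group X R)" "B \<in> carrier (presented_group X R)"
  then obtain u v where "u \<in> words X" "A = word_class X R u" "v \<in> words X" "B = word_class X R v"
    unfolding presented_carrier by blast
  then show "A \<otimes>\<^bsub>presented_group X R\<^esub> B \<in> carrier (presented_group X R)"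
    unfolding presented_carrier by (simp add: presented_mult)
next
  fix A B C
  assume "A \<in> carrier (presented_group X R)" "B \<in> carrier (presented_group X R)"
    "C \<in> carrier (presented_group X R)"
  then obtain u v w where "u \<in> words X" "A = word_class X R u" "v \<in> words X"
    "B = word_class X R v" "w \<in> words X" "C = word_class X R w"
    unfolding presented_carrier by blast
  then show "A \<otimes>\<^bsub>presented_group X R\<^esub> B \<otimes>\<^bsub>presented_group X R\<^esub> C =
      A \<otimes>\<^bsub>presented_group X R\<^esub> (B \<otimes>\<^bsub>presented_group X R\<^esub> C)"
    by (simp add: presented_mult)
qed

text \<open>The relators \<open>x y (xy)\<^sup>-\<^sup>1\<close> over all \<open>x\<close>, \<open>y\<close> in \<open>G\<close> present \<open>G\<close> on its own elements.\<close>

definition mult_table :: "('a, 'm) monoid_scheme \<Rightarrow> ('a \<Rightarrow> 'x) \<Rightarrow> 'x word set" where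
  "mult_table G f =
    {[(f x, True), (f y, True), (f (x \<otimes>\<^bsub>G\<^esub> y), False)] | x y. x \<in> carrier G \<and> y \<in> carrier G}"

text \<open>For \<open>C\<close> contained in both carriers; the two factors are kept disjoint by \<open>Inl\<close> and \<open>Inr\<close>.\<close>

definition amalgam_rels ::
  "('a, 'm) monoid_scheme \<Rightarrow> ('a, 'n) monoid_scheme \<Rightarrow> 'a set \<Rightarrow> ('a + 'a) word set" where
  "amalgam_rels A B C =
     mult_table A Inl \<union> mult_table B Inr \<union> {[(Inl c, True), (Inr c, False)] | c. c \<in> C}"

definition amalgam ::
  "('a, 'm) monoid_scheme \<Rightarrow> ('a, 'n) monoid_scheme \<Rightarrow> 'a set \<Rightarrow> ('a + 'a) word set monoid" where
  "amalgam A B C = presented_group (carrier A <+> carrier B) (amalgam_rels A B C)"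

definition amalgam_left ::
  "('a, 'm) monoid_scheme \<Rightarrow> ('a, 'n) monoid_scheme \<Rightarrow> 'a set \<Rightarrow> 'a \<Rightarrow> ('a + 'a) word set" where
  "amalgam_left A B C g = word_class (carrier A <+> carrier B) (amalgam_rels A B C) [(Inl g, True)]"

text \<open>The presentation \<open>\<langle>G, t | [c,t] = 1, c \<in> C\<^sub>G(u)\<rangle>\<close> of the extension of the centralizer of \<open>u\<close>:
  \<open>None\<close> is the stable letter \<open>t\<close> and \<open>Some g\<close> is the element \<open>g\<close> of \<open>G\<close>.\<close>

definition centralizer_ext_rels :: "('a, 'm) monoid_scheme \<Rightarrow> 'a \<Rightarrow> 'a option word set" where
  "centralizer_ext_rels G u =
     mult_table G Some \<union>
     {[(Some c, True), (None, True), (Some c, False), (None, False)] | c. c \<in> centralizer G u}"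

definition centralizer_ext :: "('a, 'm) monoid_scheme \<Rightarrow> 'a \<Rightarrow> 'a option word set monoid" where
  "centralizer_ext G u =
     presented_group (insert None (Some ` carrier G)) (centralizer_ext_rels G u)"

definition centralizer_ext_base ::
  "('a, 'm) monoid_scheme \<Rightarrow> 'a \<Rightarrow> 'a \<Rightarrow> 'a option word set" where
  "centralizer_ext_base G u g =
     word_class (insert None (Some ` carrier G)) (centralizer_ext_rels G u) [(Some g, True)]"

text \<open>The two kinds of successor step. The equality of \<open>H\<close> with the constructed group is
  an isomorphism that restricts to the given inclusion of \<open>G\<close> in \<open>H\<close>.\<close>

definition amalgam_step :: "'a monoid \<Rightarrow> 'a monoid \<Rightarrow> bool" where
  "amalgam_step G H \<longleftrightarrow>
     (\<exists>F C. subgroup F G \<and> F \<noteq> {\<one>\<^bsub>G\<^esub>} \<and>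
        (C = {\<one>\<^bsub>G\<^esub>} \<or>
         (\<exists>u\<in>F. u \<noteq> \<one>\<^bsub>G\<^esub> \<and> C = centralizer G u \<and> C = centralizer (G\<lparr>carrier := F\<rparr>) u)) \<and>
        (\<exists>h\<in>iso (amalgam G (G\<lparr>carrier := F\<rparr>) C) H.
           \<forall>g\<in>carrier G. h (amalgam_left G (G\<lparr>carrier := F\<rparr>) C g) = g))"

definition centralizer_step :: "'a monoid \<Rightarrow> 'a monoid \<Rightarrow> bool" where
  "centralizer_step G H \<longleftrightarrow>
     (\<exists>u\<in>carrier G. u \<noteq> \<one>\<^bsub>G\<^esub> \<and>
        (\<exists>h\<in>iso (centralizer_ext G u) H.
           \<forall>g\<in>carrier G. h (centralizer_ext_base G u g) = g))"

definition is_successor :: "'i rel \<Rightarrow> 'i \<Rightarrow> 'i \<Rightarrow> bool" where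
  "is_successor r a b \<longleftrightarrow> a \<in> underS r b \<and> underS r b \<subseteq> under r a"

definition is_limit :: "'i rel \<Rightarrow> 'i \<Rightarrow> bool" where
  "is_limit r l \<longleftrightarrow> l \<in> Field r \<and> underS r l \<noteq> {} \<and> (\<forall>a. \<not> is_successor r a l)"

definition group_chain :: "'i rel \<Rightarrow> ('i \<Rightarrow> 'a monoid) \<Rightarrow> bool" where
  "group_chain r G \<longleftrightarrow>
     (\<forall>a\<in>Field r. group (G a)) \<and>
     (\<forall>a b. (a, b) \<in> r \<longrightarrow>
        subgroup (carrier (G a)) (G b) \<and>
        (\<forall>x\<in>carrier (G a). \<forall>y\<in>carrier (G a). x \<otimes>\<^bsub>G a\<^esub> y = x \<otimes>\<^bsub>G b\<^esub> y))"

end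

theory Submission
  imports Defs "HOL-Library.Poly_Mapping" "HOL-Computational_Algebra.Fundamental_Theorem_Algebra"
    "HOL-Algebra.Generated_Groups" "HOL-Analysis.Continuum_Not_Denumerable"
begin

text \<open>
  The groups \<open>G\<^sub>\<alpha>\<close> are embedded by transfinite recursion into series over a ring of polynomials over
  \<open>\<complex>\<close> whose variables are indexed by at most continuum many elements; such a ring embeds into \<open>\<complex>\<close>,
  which gives the embedding of \<open>G\<^sub>\<delta>\<close> into \<open>G[[r]]\<close>.

  Over a centralizer \<open>C(u)\<close>, the coefficients of \<open>u\<^sup>n\<close> are polynomials in \<open>n\<close>, so the power \<open>u\<^sup>X\<close> with
  \<open>X\<close> a new variable makes sense and commutes with \<open>C(u)\<close>. It is the image of the stable letter, or
  it conjugates the second factor of the amalgam. Specialising \<open>X\<close> to a large integer maps a given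
  word back into \<open>G\<^sub>\<alpha>\<close>, where the big powers condition keeps it nontrivial: hence the extended map is
  injective, and the extension is discriminated by \<open>G\<^sub>\<alpha>\<close> and so is a \<open>BP\<close>-group itself.

  For \<open>C = 1\<close>, the second factor is conjugated by a series with independent coefficients; this is
  injective because groups of series satisfy no mixed identity. If \<open>G\<^sub>\<alpha>\<close> is not abelian, specialising
  to the powers of a suitable element again proves the big powers condition. If \<open>G\<^sub>\<alpha>\<close> is abelian, the
  free product is mapped to \<open>SL\<^sub>2(\<real>)\<close> with the given elements hyperbolic, and a product of large powers
  of hyperbolic matrices is dominated by the product of the projections onto their expanding eigenlines.
\<close>

subsection \<open>Evaluating multivariate polynomials\<close>

text \<open>A limit stage needs a coherent family, so each embedding must extend the earlier ones;
  embeddings found separately for each G_\<alpha> could not be glued. Hence every stage owns a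
  countable block of variables, set aside before the recursion starts: one of them serves as an
  exponent, or all of them as the coefficients of a free conjugator.

  Two facts about series carry the group theory. If u = x + c x^(k+1) + ..., then a series commuting
  with u is determined by its coefficients up to degree k+1, and conjugation keeps c. So
  centralizers of nontrivial elements are abelian, and x centralizes u as soon as x u x^-1 commutes
  with u. This turns a reduced word in powers of u into a commutation-free tuple of conjugates of u
  and u^-1.

  Both kinds of step are brought to one format: each element of the larger group is some reduced
  word in G_\<alpha> and one letter s, and it is nontrivial because a suitable value of s makes the
  word nontrivial. The abelian free case stands apart: there every element of G_\<alpha> commutes
  with all coefficients, so taking s in G_\<alpha> identifies the two factors.\<close>

locale ring_hom1 =
  fixes h :: "'a::comm_ring_1 \<Rightarrow> 'b::comm_ring_1"
  assumes add: "h (x + y) = h x + h y"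
    and mult: "h (x * y) = h x * h y"
    and one: "h 1 = 1"
begin

lemma zero: "h 0 = 0"
  using add[of 0 0] by simp

lemma uminus: "h (- x) = - h x"
  using add[of x "- x"] by (simp add: zero eq_neg_iff_add_eq_0 add.commute)

lemma diff: "h (x - y) = h x - h y"
  using add[of x "- y"] by (simp add: uminus)

lemma sum: "h (sum f A) = (\<Sum>x\<in>A. h (f x))"
  by (induction A rule: infinite_finite_induct) (simp_all add: zero add)

lemma prod: "h (prod f A) = (\<Prod>x\<in>A. h (f x))"
  by (induction A rule: infinite_finite_induct) (simp_all add: one mult)

lemma power: "h (x ^ n) = h x ^ n"
  by (induction n) (simp_all add: one mult)

lemma of_nat: "h (of_nat n) = of_nat n"
  by (induction n) (simp_all add: zero one add)

lemma map_poly_add: "map_poly h (p + q) = map_poly h p + map_poly h q"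
  by (intro poly_eqI) (simp add: coeff_map_poly zero add)

lemma map_poly_mult: "map_poly h (p * q) = map_poly h p * map_poly h q"
  by (intro poly_eqI) (simp add: coeff_map_poly zero coeff_mult sum mult)

end

type_synonym ('x, 'c) mpoly = "('x \<Rightarrow>\<^sub>0 nat) \<Rightarrow>\<^sub>0 'c"

definition mconst :: "'c \<Rightarrow> ('x, 'c::comm_ring_1) mpoly" where
  "mconst c = Poly_Mapping.single 0 c"

definition mvar :: "'x \<Rightarrow> ('x, 'c::comm_ring_1) mpoly" where
  "mvar x = Poly_Mapping.single (Poly_Mapping.single x 1) 1"

definition mono_eval :: "('x \<Rightarrow> 'q::comm_ring_1) \<Rightarrow> ('x \<Rightarrow>\<^sub>0 nat) \<Rightarrow> 'q" where
  "mono_eval v m = (\<Prod>x\<in>Poly_Mapping.keys m. v x ^ Poly_Mapping.lookup m x)"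

definition meval ::
  "('c::comm_ring_1 \<Rightarrow> 'q::comm_ring_1) \<Rightarrow> ('x \<Rightarrow> 'q) \<Rightarrow> ('x, 'c) mpoly \<Rightarrow> 'q" where
  "meval h v p = (\<Sum>m\<in>Poly_Mapping.keys p. h (Poly_Mapping.lookup p m) * mono_eval v m)"

lemma mono_eval_superset:
  assumes "finite A" "Poly_Mapping.keys m \<subseteq> A"
  shows "mono_eval v m = (\<Prod>x\<in>A. v x ^ Poly_Mapping.lookup m x)"
  unfolding mono_eval_def using assms
  by (intro prod.mono_neutral_left) (auto simp: in_keys_iff)

lemma mono_eval_add: "mono_eval v (m + n) = mono_eval v m * mono_eval v n"
proof -
  let ?A = "Poly_Mapping.keys m \<union> Poly_Mapping.keys n"
  have "mono_eval v (m + n) = (\<Prod>x\<in>?A. v x ^ Poly_Mapping.lookup (m + n) x)"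
    using keys_add[of m n] by (intro mono_eval_superset) auto
  also have "\<dots> = mono_eval v m * mono_eval v n"
    by (subst (1 2) mono_eval_superset[of ?A]) (auto simp: lookup_add power_add prod.distrib)
  finally show ?thesis .
qed

lemma mono_eval_zero [simp]: "mono_eval v 0 = 1"
  by (simp add: mono_eval_def)

lemma mono_eval_single [simp]: "mono_eval v (Poly_Mapping.single x n) = v x ^ n"
  by (cases "n = 0") (simp_all add: mono_eval_def)

lemma meval_superset:
  assumes "ring_hom1 h" "finite A" "Poly_Mapping.keys p \<subseteq> A"
  shows "meval h v p = (\<Sum>m\<in>A. h (Poly_Mapping.lookup p m) * mono_eval v m)"
  unfolding meval_def using assms
  by (intro sum.mono_neutral_left) (auto simp: in_keys_iff ring_hom1.zero)

lemma meval_add: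
  assumes "ring_hom1 h"
  shows "meval h v (p + q) = meval h v p + meval h v q"
proof -
  let ?A = "Poly_Mapping.keys p \<union> Poly_Mapping.keys q"
  have "meval h v (p + q) = (\<Sum>m\<in>?A. h (Poly_Mapping.lookup (p + q) m) * mono_eval v m)"
    using keys_add[of p q] by (intro meval_superset assms) auto
  also have "\<dots> = meval h v p + meval h v q"
    by (subst (1 2) meval_superset[of h ?A])
      (auto simp: assms lookup_add ring_hom1.add distrib_right sum.distrib)
  finally show ?thesis .
qed

lemma meval_single:
  assumes "ring_hom1 h"
  shows "meval h v (Poly_Mapping.single m c) = h c * mono_eval v m"
  by (cases "c = 0") (simp_all add: meval_def ring_hom1.zero[OF assms])

lemma meval_0 [simp]: "meval h v 0 = 0"
  by (simp add: meval_def)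

lemma poly_mapping_single_induct:
  assumes "P 0" "\<And>m c. P (Poly_Mapping.single m c)"
    and "\<And>p q. P p \<Longrightarrow> P q \<Longrightarrow> P (p + q)"
  shows "P (p :: 'x \<Rightarrow>\<^sub>0 'c::comm_monoid_add)"
proof -
  have "p = (\<Sum>m\<in>Poly_Mapping.keys p. Poly_Mapping.single m (Poly_Mapping.lookup p m))"
    by (rule poly_mapping_eqI)
      (auto simp: lookup_sum lookup_single when_def sum.delta in_keys_iff)
  moreover have "P (\<Sum>m\<in>A. Poly_Mapping.single m (Poly_Mapping.lookup p m))" if "finite A" for A
    using that by (induction A) (simp_all add: assms)
  ultimately show ?thesis by (metis finite_keys)
qed

lemma ring_hom1_meval:
  fixes h :: "'c::comm_ring_1 \<Rightarrow> 'q::comm_ring_1" and v :: "'x \<Rightarrow> 'q"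
  assumes h: "ring_hom1 h"
  shows "ring_hom1 (meval h v)"
proof
  show "meval h v (p + q) = meval h v p + meval h v q" for p q :: "('x, 'c) mpoly"
    by (rule meval_add[OF h])
  have single: "meval h v (Poly_Mapping.single m c * q) =
      meval h v (Poly_Mapping.single m c) * meval h v q" for m c and q :: "('x, 'c) mpoly"
    by (induction q rule: poly_mapping_single_induct)
      (simp_all add: distrib_left meval_add[OF h] meval_single[OF h] mult_single
        mono_eval_add ring_hom1.mult[OF h])
  show "meval h v (p * q) = meval h v p * meval h v q" for p q :: "('x, 'c) mpoly"
    by (induction p rule: poly_mapping_single_induct)
      (simp_all add: distrib_right meval_add[OF h] single)
  show "meval h v 1 = 1"
    using meval_single[OF h, of v 0 1] by (simp add: ring_hom1.one[OF h])
qed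

lemma meval_mconst [simp]: "ring_hom1 h \<Longrightarrow> meval h v (mconst c) = h c"
  by (simp add: mconst_def meval_single)

lemma meval_mvar [simp]: "ring_hom1 h \<Longrightarrow> meval h v (mvar x) = v x"
  by (simp add: mvar_def meval_single ring_hom1.one)

lemma ring_hom1_mconst: "ring_hom1 (mconst :: 'c::comm_ring_1 \<Rightarrow> ('x, 'c) mpoly)"
  by standard (simp_all add: mconst_def single_add mult_single)

text \<open>Given by generators, so that homomorphisms agreeing on constants and on the variables in
  J agree on the whole subring by rule induction.\<close>

inductive_set mpolys :: "'x set \<Rightarrow> ('x, 'c::comm_ring_1) mpoly set" for J where
  mconst: "mconst c \<in> mpolys J"
| mvar: "x \<in> J \<Longrightarrow> mvar x \<in> mpolys J"
| add: "p \<in> mpolys J \<Longrightarrow> q \<in> mpolys J \<Longrightarrow> p + q \<in> mpolys J"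
| mult: "p \<in> mpolys J \<Longrightarrow> q \<in> mpolys J \<Longrightarrow> p * q \<in> mpolys J"

lemma mpolys_simps [simp]: "0 \<in> mpolys J" "1 \<in> mpolys J"
  using mpolys.mconst[of 0 J] mpolys.mconst[of 1 J] by (simp_all add: mconst_def)

lemma mpolys_sum: "(\<And>x. x \<in> A \<Longrightarrow> f x \<in> mpolys J) \<Longrightarrow> sum f A \<in> mpolys J"
  by (induction A rule: infinite_finite_induct) (auto intro: mpolys.add)

lemma mpolys_prod: "(\<And>x. x \<in> A \<Longrightarrow> f x \<in> mpolys J) \<Longrightarrow> prod f A \<in> mpolys J"
  by (induction A rule: infinite_finite_induct) (auto intro: mpolys.mult)

lemma mpolys_uminus: "p \<in> mpolys J \<Longrightarrow> - p \<in> mpolys J"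
  using mpolys.mult[OF mpolys.mconst[of "-1" J], of p]
  by (simp add: ring_hom1.uminus[OF ring_hom1_mconst] ring_hom1.one[OF ring_hom1_mconst])

lemma mpolys_diff: "p \<in> mpolys J \<Longrightarrow> q \<in> mpolys J \<Longrightarrow> p - q \<in> mpolys J"
  using mpolys.add[OF _ mpolys_uminus, of p J q] by simp

lemma mpolys_power: "p \<in> mpolys J \<Longrightarrow> p ^ n \<in> mpolys J"
  by (induction n) (auto intro: mpolys.mult)

lemma mpolys_mono: "p \<in> mpolys J \<Longrightarrow> J \<subseteq> K \<Longrightarrow> p \<in> mpolys K"
  by (induction rule: mpolys.induct) (auto intro: mpolys.intros)

lemma mpolys_keys:
  fixes p :: "('x, 'c::comm_ring_1) mpoly"
  assumes J: "\<And>m. m \<in> Poly_Mapping.keys p \<Longrightarrow> Poly_Mapping.keys m \<subseteq> J"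
  shows "p \<in> mpolys J"
proof -
  have var: "Poly_Mapping.single (Poly_Mapping.single x n) (1::'c) = mvar x ^ n" for x :: 'x and n
  proof (induction n)
    case (Suc n)
    have "Poly_Mapping.single x (Suc n) = Poly_Mapping.single x 1 + Poly_Mapping.single x n"
      by (simp flip: single_add)
    then have "Poly_Mapping.single (Poly_Mapping.single x (Suc n)) (1::'c)
        = mvar x * Poly_Mapping.single (Poly_Mapping.single x n) 1"
      by (simp only: mvar_def mult_single mult_1)
    then show ?case by (simp only: Suc power_Suc)
  qed simp
  have split: "Poly_Mapping.single (a + b) (1::'c) =
      Poly_Mapping.single a 1 * Poly_Mapping.single b 1" for a b :: "'x \<Rightarrow>\<^sub>0 nat"
    by (simp add: mult_single)
  have mono: "Poly_Mapping.single m (1::'c) = (\<Prod>x\<in>Poly_Mapping.keys m. mvar x ^ Poly_Mapping.lookup m x)" for m :: "'x \<Rightarrow>\<^sub>0 nat"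
  proof -
    have "Poly_Mapping.single (\<Sum>x\<in>A. Poly_Mapping.single x (Poly_Mapping.lookup m x)) (1::'c)
        = (\<Prod>x\<in>A. mvar x ^ Poly_Mapping.lookup m x)" if "finite A" for A
      using that
      by (induction A) (simp_all add: split var)
    moreover have "(\<Sum>x\<in>Poly_Mapping.keys m. Poly_Mapping.single x (Poly_Mapping.lookup m x)) = m"
      by (rule poly_mapping_eqI)
        (auto simp: lookup_sum lookup_single when_def sum.delta in_keys_iff)
    ultimately show ?thesis by (metis finite_keys)
  qed
  have "p = (\<Sum>m\<in>Poly_Mapping.keys p. Poly_Mapping.single m (Poly_Mapping.lookup p m))"
    by (rule poly_mapping_eqI)
      (auto simp: lookup_sum lookup_single when_def sum.delta in_keys_iff)
  also have "\<dots> = (\<Sum>m\<in>Poly_Mapping.keys p. mconst (Poly_Mapping.lookup p m) * (\<Prod>x\<in>Poly_Mapping.keys m. mvar x ^ Poly_Mapping.lookup m x))"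
    by (simp add: mono[symmetric] mconst_def mult_single)
  also have "\<dots> \<in> mpolys J"
    using J by (blast intro: mpolys_sum mpolys.mult mpolys.mconst mpolys_prod mpolys_power mpolys.mvar)
  finally show ?thesis .
qed

lemma mpolys_UNIV: "p \<in> mpolys UNIV"
  by (rule mpolys_keys) simp

lemma mpolys_finite_support: "\<exists>F. finite F \<and> p \<in> mpolys F"
  by (rule exI[of _ "\<Union>m\<in>Poly_Mapping.keys p. Poly_Mapping.keys m"]) (auto intro: mpolys_keys)

lemma meval_unique_on:
  assumes "ring_hom1 f" "ring_hom1 g" "p \<in> mpolys J"
    and "\<And>c. f (mconst c) = g (mconst c)" "\<And>x. x \<in> J \<Longrightarrow> f (mvar x) = g (mvar x)"
  shows "f p = g p"
  using assms(3)
  by (induction rule: mpolys.induct) (simp_all add: assms ring_hom1.add ring_hom1.mult)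

lemma mpoly_hom_eqI:
  assumes "ring_hom1 f" "ring_hom1 g"
    and "\<And>c. f (mconst c) = g (mconst c)" "\<And>x. f (mvar x) = g (mvar x)"
  shows "f p = g p"
  using meval_unique_on[OF assms(1,2) mpolys_UNIV assms(3,4)] .

section \<open>Substituting for one variable\<close>

definition msubst :: "'x \<Rightarrow> ('x, 'c) mpoly \<Rightarrow> ('x, 'c::comm_ring_1) mpoly \<Rightarrow> ('x, 'c) mpoly" where
  "msubst j e = meval mconst (mvar(j := e))"

lemma ring_hom1_msubst: "ring_hom1 (msubst j e)"
  unfolding msubst_def by (intro ring_hom1_meval ring_hom1_mconst)

lemma ring_hom1_ident: "ring_hom1 (\<lambda>x. x)"
  by standard simp_all

lemma meval_id: "meval mconst mvar p = p"
  by (rule mpoly_hom_eqI[of "meval mconst mvar" "\<lambda>p. p"])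
    (simp_all add: ring_hom1_meval ring_hom1_mconst ring_hom1_ident)

lemma msubst_mpolys:
  assumes "p \<in> mpolys J" "j \<notin> J"
  shows "msubst j e p = p"
  using assms(2)
  by (intro meval_unique_on[OF ring_hom1_msubst ring_hom1_ident assms(1)])
    (auto simp: msubst_def ring_hom1_mconst)

text \<open>The coefficients of q lie in the polynomial ring itself and do not depend on e, so
  finiteness of roots can be applied to e.\<close>

lemma msubst_poly: "\<exists>q. \<forall>e. msubst j e p = poly q e"
proof -
  have "p \<in> mpolys UNIV" by (rule mpolys_UNIV)
  then show ?thesis
  proof (induction rule: mpolys.induct)
    case (mconst c)
    then show ?case
      by (intro exI[of _ "[:mconst c:]"]) (simp add: msubst_def ring_hom1_mconst)
  next
    case (mvar x)
    then show ?case
      by (intro exI[of _ "if x = j then [:0, 1:] else [:mvar x:]"])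
        (simp add: msubst_def ring_hom1_mconst)
  next
    case (add p q)
    then obtain a b where "\<forall>e. msubst j e p = poly a e" "\<forall>e. msubst j e q = poly b e" by blast
    then show ?case
      by (intro exI[of _ "a + b"]) (simp add: ring_hom1.add[OF ring_hom1_msubst])
  next
    case (mult p q)
    then obtain a b where "\<forall>e. msubst j e p = poly a e" "\<forall>e. msubst j e q = poly b e" by blast
    then show ?case
      by (intro exI[of _ "a * b"]) (simp add: ring_hom1.mult[OF ring_hom1_msubst])
  qed
qed

lemma msubst_self: "msubst j (mvar j) p = p"
  by (simp add: msubst_def meval_id)

text \<open>The natural numbers in question are infinitely many roots of one univariate polynomial
  over an integral domain. The linear order on the variables is what makes the polynomial ring a
  domain.\<close>

lemma infinite_msubst_zero:
  fixes p :: "('x::linorder, 'c::{idom,ring_char_0}) mpoly"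
  assumes "infinite {n::nat. msubst j (of_nat n) p = 0}"
  shows "p = 0"
proof -
  obtain q where q: "\<And>e. msubst j e p = poly q e" using msubst_poly[of j p] by blast
  have "of_nat ` {n::nat. msubst j (of_nat n) p = 0} \<subseteq> {x. poly q x = 0}"
    by (auto simp: q)
  moreover have "inj (of_nat :: nat \<Rightarrow> ('x, 'c) mpoly)" by (rule inj_of_nat)
  ultimately have "infinite {x. poly q x = 0}"
    using assms by (meson finite_imageD finite_subset inj_on_subset subset_UNIV)
  \<comment> \<open>Substituting the variable for itself returns p.\<close>
  then have "q = 0" using poly_roots_finite by blast
  then show ?thesis using q[of "mvar j"] by (simp add: msubst_self)
qed

unbundle fps_syntax

subsection \<open>Series tangent to the identity\<close>

lemma fps_mult_nth_lowest:
  fixes f g :: "'a::comm_ring_1 fps"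
  assumes "\<And>j. j < p \<Longrightarrow> f $ j = 0" "\<And>j. j < q \<Longrightarrow> g $ j = 0"
  shows "(f * g) $ (p + q) = f $ p * g $ q"
    and "n < p + q \<Longrightarrow> (f * g) $ n = 0"
proof -
  have z: "f $ i * g $ (n - i) = 0" if "i \<le> n" "i \<noteq> p" "n \<le> p + q" for n i
  proof (cases "i < p")
    case False
    then have "n - i < q" using that by auto
    then show ?thesis by (simp add: assms)
  qed (simp add: assms)
  have "(f * g) $ (p + q) = (\<Sum>i\<in>{0..p + q}. if i = p then f $ p * g $ q else 0)"
    unfolding fps_mult_nth using z by (intro sum.cong) auto
  then show "(f * g) $ (p + q) = f $ p * g $ q" by simp
  show "(f * g) $ n = 0" if "n < p + q"
    unfolding fps_mult_nth
  proof (rule sum.neutral, safe)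
    fix i assume i: "i \<in> {0..n}"
    show "f $ i * g $ (n - i) = 0"
      using z[of i n] i that assms(2)[of "n - p"] by (cases "i = p") auto
  qed
qed

text \<open>\<open>series_group\<close> over an arbitrary domain: until the last stage the
  coefficients are polynomials, and in the proof of \<open>no_mixed_identity\<close> they are
  themselves series.\<close>

definition series_mon :: "'a::idom fps monoid" where
  "series_mon = \<lparr>carrier = {f. f $ 0 = 0 \<and> f $ 1 = 1}, monoid.mult = (oo), one = fps_X\<rparr>"

lemma series_group_eq: "series_group = series_mon"
  by (simp add: series_group_def series_mon_def)

abbreviation tid :: "'a::idom fps \<Rightarrow> bool" where
  "tid f \<equiv> f \<in> carrier series_mon"

lemma tid_iff: "tid f \<longleftrightarrow> f $ 0 = 0 \<and> f $ Suc 0 = 1"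
  by (simp add: series_mon_def)

lemma series_mon_simps [simp]:
  "f \<otimes>\<^bsub>series_mon\<^esub> g = f oo g" "\<one>\<^bsub>series_mon\<^esub> = fps_X"
  by (simp_all add: series_mon_def)

lemma tid_power_nth: "tid f \<Longrightarrow> (f ^ n) $ n = 1" "tid f \<Longrightarrow> k < n \<Longrightarrow> (f ^ n) $ k = 0"
  by (simp_all add: tid_iff startsby_zero_power_nth_same startsby_zero_power_prefix)

text \<open>Solves (g oo f) $ n = fps_X $ n for g $ n, whose coefficient (f ^ n) $ n is 1. No
  division occurs, so left inverses exist over polynomial rings too.\<close>

fun comp_inv_nth :: "'a::idom fps \<Rightarrow> nat \<Rightarrow> 'a" where
  "comp_inv_nth f n = fps_X $ n - (\<Sum>i<n. comp_inv_nth f i * (f ^ i) $ n)"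

declare comp_inv_nth.simps [simp del]

definition comp_inv :: "'a::idom fps \<Rightarrow> 'a fps" where
  "comp_inv f = Abs_fps (comp_inv_nth f)"

lemma tid_comp_inv: "tid f \<Longrightarrow> tid (comp_inv f)"
  by (simp add: tid_iff comp_inv_def comp_inv_nth.simps[of f 0] comp_inv_nth.simps[of f "Suc 0"])

lemma comp_inv_left: 
  assumes "tid f"
  shows "comp_inv f oo f = fps_X"
proof (rule fps_ext)
  fix n :: nat
  have "{0..n} = insert n {..<n}" by auto
  then have "(comp_inv f oo f) $ n =
      comp_inv_nth f n * (f ^ n) $ n + (\<Sum>i<n. comp_inv_nth f i * (f ^ i) $ n)"
    by (simp add: fps_compose_nth comp_inv_def)
  also have "\<dots> = fps_X $ n"
    using tid_power_nth(1)[OF assms, of n] by (subst comp_inv_nth.simps) simp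
  finally show "(comp_inv f oo f) $ n = fps_X $ n" .
qed

lemma tid_compose: "tid f \<Longrightarrow> tid g \<Longrightarrow> tid (f oo g)"
  by (simp add: tid_iff fps_compose_nth)

lemma group_series_mon: "group (series_mon :: 'a::idom fps monoid)"
proof (rule groupI)
  fix f :: "'a fps" assume "tid f"
  then show "\<exists>g\<in>carrier series_mon. g \<otimes>\<^bsub>series_mon\<^esub> f = \<one>\<^bsub>series_mon\<^esub>"
    using comp_inv_left tid_comp_inv by (metis series_mon_simps)
next
  fix f g h :: "'a fps" assume "tid f" "tid g" "tid h"
  then show "f \<otimes>\<^bsub>series_mon\<^esub> g \<otimes>\<^bsub>series_mon\<^esub> h = f \<otimes>\<^bsub>series_mon\<^esub> (g \<otimes>\<^bsub>series_mon\<^esub> h)"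
    by (simp add: fps_compose_assoc tid_iff)
qed (simp_all add: tid_compose, simp_all add: tid_iff)

interpretation series: group "series_mon :: 'a::idom fps monoid"
  by (rule group_series_mon)

lemma inv_series_mon: "tid f \<Longrightarrow> inv\<^bsub>series_mon\<^esub> f = comp_inv f"
  using series.inv_equality[of "comp_inv f" f] comp_inv_left tid_comp_inv by force

section \<open>Ring homomorphisms applied to coefficients\<close>

definition fps_map :: "('a::comm_ring_1 \<Rightarrow> 'b::comm_ring_1) \<Rightarrow> 'a fps \<Rightarrow> 'b fps" where
  "fps_map h f = Abs_fps (\<lambda>n. h (f $ n))"

lemma fps_map_nth [simp]: "fps_map h f $ n = h (f $ n)"
  by (simp add: fps_map_def)

context ring_hom1
begin

unbundle fps_syntax

lemma fps_map_mult: "fps_map h (f * g) = fps_map h f * fps_map h g"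
  by (rule fps_ext) (simp add: fps_mult_nth sum mult)

lemma fps_map_power: "fps_map h (f ^ n) = fps_map h f ^ n"
  by (induction n) (auto intro!: fps_ext simp: fps_map_mult zero one)

lemma fps_map_X [simp]: "fps_map h fps_X = fps_X"
  by (rule fps_ext) (simp add: zero one fps_X_def)

lemma fps_map_compose: "fps_map h (f oo g) = fps_map h f oo fps_map h g"
  by (rule fps_ext) (simp add: fps_compose_nth sum mult flip: fps_map_power)

end

lemma ring_hom1_fps_map_hom:
  fixes h :: "'a::idom \<Rightarrow> 'b::idom"
  shows "ring_hom1 h \<Longrightarrow> fps_map h \<in> hom series_mon series_mon"
  by (auto simp: hom_def tid_iff ring_hom1.fps_map_compose ring_hom1.zero ring_hom1.one)

definition series_in :: "'x::linorder set \<Rightarrow> ('x, 'c::idom) mpoly fps set" where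
  "series_in J = {f. tid f \<and> (\<forall>n. f $ n \<in> mpolys J)}"

lemma series_in_tid: "f \<in> series_in J \<Longrightarrow> tid f"
  by (simp add: series_in_def)

lemma series_in_mono: "J \<subseteq> K \<Longrightarrow> series_in J \<subseteq> series_in K"
  by (auto simp: series_in_def intro: mpolys_mono)

lemma mpolys_fps_power: "(\<And>n. f $ n \<in> mpolys J) \<Longrightarrow> (f ^ i) $ n \<in> mpolys J"
proof (induction i arbitrary: n)
  case (Suc i)
  then show ?case by (auto simp: fps_mult_nth intro!: mpolys_sum mpolys.mult)
qed simp

lemma subgroup_series_in: "subgroup (series_in J) (series_mon :: ('x::linorder, 'c::idom) mpoly fps monoid)"
proof
  show "series_in J \<subseteq> carrier series_mon" by (auto simp: series_in_def)
  show "\<one>\<^bsub>series_mon\<^esub> \<in> series_in J"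
    by (simp add: series_in_def fps_X_def tid_iff)
  fix f g :: "('x, 'c) mpoly fps" assume f: "f \<in> series_in J"
  have "comp_inv_nth f n \<in> mpolys J" for n
  proof (induction n rule: less_induct)
    case (less n)
    show ?case
      using f less by (subst comp_inv_nth.simps, intro mpolys_diff mpolys_sum mpolys.mult mpolys_fps_power)
        (auto simp: series_in_def fps_X_def)
  qed
  then show "inv\<^bsub>series_mon\<^esub> f \<in> series_in J"
    using f tid_comp_inv[of f] by (auto simp: inv_series_mon series_in_def comp_inv_def)
  assume "g \<in> series_in J"
  then show "f \<otimes>\<^bsub>series_mon\<^esub> g \<in> series_in J"
    using f tid_compose[of f g]
    by (auto simp: series_in_def fps_compose_nth intro!: mpolys_sum mpolys.mult mpolys_fps_power)
qed

section \<open>Centralizers in the group of series\<close>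

lemma fps_power_low:
  fixes w :: "'a::comm_ring_1 fps"
  assumes "w $ 0 = 1" "\<And>l. 0 < l \<Longrightarrow> l < k \<Longrightarrow> w $ l = 0" "0 < j" "j \<le> k"
  shows "(w ^ i) $ j = of_nat i * w $ j"
proof (induction i)
  case 0
  then show ?case using assms(3) by simp
next
  case (Suc i)
  have "(w * w ^ i) $ j = (\<Sum>l\<in>{0..j}. if l = 0 then (w ^ i) $ j else if l = j then w $ j else 0)"
    unfolding fps_mult_nth using assms by (intro sum.cong) (auto simp: fps_power_zeroth)
  also have "{0..j} = insert 0 (insert j {0<..<j})" using assms(3) by auto
  finally show ?case using assms(3) Suc by (simp add: algebra_simps)
qed

text \<open>Write u = x w with w = 1 + u_{k+1} x^k + ...; up to degree k the powers of w are linear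
  in the exponent.\<close>

lemma tid_power_low:
  assumes u: "tid u" "\<And>l. 1 < l \<Longrightarrow> l \<le> k \<Longrightarrow> u $ l = 0" "0 < j" "j \<le> k"
  shows "(u ^ i) $ (i + j) = of_nat i * u $ Suc j"
proof -
  define w where "w = fps_shift 1 u"
  have "u = fps_X * w"
    using u(1) by (intro fps_ext) (auto simp: w_def tid_iff)
  then have "(u ^ i) $ (i + j) = (w ^ i) $ j"
    by (simp add: power_mult_distrib fps_X_power_mult_nth)
  also have "\<dots> = of_nat i * w $ j"
    by (rule fps_power_low[of w k]) (use u in \<open>auto simp: w_def tid_iff\<close>)
  finally show ?thesis by (simp add: w_def)
qed

text \<open>Let m be the first degree where f and g differ, by e_m say. In e oo u = (u oo f) - (u oo
  g) the coefficients at degree m + k are e_{m+k} + m u_{k+1} e_m on the left and e_{m+k} + (k+1)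
  u_{k+1} e_m on the right. This forces m = k + 1, where f and g agree.\<close>

lemma commuting_series_eq:
  fixes u f g :: "'a::{idom,ring_char_0} fps"
  assumes u: "tid u" "\<And>l. 1 < l \<Longrightarrow> l \<le> k \<Longrightarrow> u $ l = 0" "u $ Suc k \<noteq> 0" "0 < k"
    and f: "tid f" "f oo u = u oo f" and g: "tid g" "g oo u = u oo g"
    and agree: "\<And>l. l \<le> Suc k \<Longrightarrow> f $ l = g $ l"
  shows "f = g"
proof (rule ccontr)
  assume "f \<noteq> g"
  define e where "e = f - g"
  define m where "m = (LEAST l. e $ l \<noteq> 0)"
  have "\<exists>l. e $ l \<noteq> 0" using \<open>f \<noteq> g\<close> by (auto simp: e_def fps_eq_iff)
  then have m: "e $ m \<noteq> 0" unfolding m_def by (rule LeastI_ex)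
  have low: "e $ l = 0" if "l < m" for l
    using that not_less_Least unfolding m_def by blast
  have "m > Suc k" using m agree by (auto simp: e_def not_less[symmetric])
  \<comment> \<open>The lowest degree in which the leading term of e interacts with that of u -
    x.\<close>
  define N where "N = m + k"
  have pw: "(f ^ i - g ^ i) $ n = (if n = m + i - 1 then of_nat i * e $ m else 0)"
    if "0 < i" "n \<le> m + i - 1" for i n
  proof -
    obtain i' where i: "i = Suc i'" using \<open>0 < i\<close> by (cases i) auto
    define S where "S = (\<Sum>p<i. f ^ p * g ^ (i' - p))"
    \<comment> \<open>S is a sum of i products, each of order i - 1 and with lowest coefficient
      1.\<close>
    have eq: "f ^ i - g ^ i = e * S"
      using power_diff_sumr2[of f i g] by (simp add: e_def S_def i algebra_simps)
    have trm: "(f ^ p * g ^ (i' - p)) $ i' = 1" "j < i' \<Longrightarrow> (f ^ p * g ^ (i' - p)) $ j = 0" if "p < i" for p j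
    proof -
      have *: "p + (i' - p) = i'" using that i by auto
      show "(f ^ p * g ^ (i' - p)) $ i' = 1"
        using fps_mult_nth_lowest(1)[of p "f ^ p" "i' - p" "g ^ (i' - p)"] tid_power_nth[OF f(1)] tid_power_nth[OF g(1)] *
        by simp
      show "j < i' \<Longrightarrow> (f ^ p * g ^ (i' - p)) $ j = 0"
        using fps_mult_nth_lowest(2)[of p "f ^ p" "i' - p" "g ^ (i' - p)" j] tid_power_nth[OF f(1)] tid_power_nth[OF g(1)] *
        by simp
    qed
    have S: "S $ i' = of_nat i" "j < i' \<Longrightarrow> S $ j = 0" for j
      by (simp_all add: S_def fps_sum_nth trm)
    show ?thesis
      unfolding eq using fps_mult_nth_lowest[of m e i' S] low S that(2) i
      by (auto simp: le_less mult.commute)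
  qed
  have "e oo u = (u oo f) - (u oo g)"
    by (simp add: e_def fps_compose_sub_distrib f(2) g(2))
  moreover have "(e oo u) $ N = e $ N + of_nat m * u $ Suc k * e $ m"
  proof -
    have z: "e $ i * (u ^ i) $ N = (if i = N then e $ N else 0) + (if i = m then of_nat m * u $ Suc k * e $ m else 0)"
      if "i \<le> N" for i
    proof -
      have "i < m \<or> i = m \<or> m < i \<and> i < N \<or> i = N" using that by arith
      then consider "i < m" | "i = m" | "m < i" "i < N" | "i = N" by blast
      then show ?thesis
      proof cases
        case 2
        then show ?thesis
          using tid_power_low[OF u(1,2), where j = k and i = m] u(4) by (simp add: N_def)
      next
        case 3
        then show ?thesis
          using tid_power_low[OF u(1,2), where j = "N - i" and i = i] u(2)[of "Suc (N - i)"] by (simp add: N_def)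
      next
        case 4
        then show ?thesis using tid_power_nth(1)[OF u(1), of N] u(4) by (simp add: N_def)
      qed (simp add: low N_def)
    qed
    have "m \<le> N" by (simp add: N_def)
    then show ?thesis
      unfolding fps_compose_nth using z by (simp add: sum.distrib)
  qed
  moreover have "((u oo f) - (u oo g)) $ N = e $ N + of_nat (Suc k) * u $ Suc k * e $ m"
  proof -
    have z: "u $ i * (f ^ i - g ^ i) $ N = (if i = 1 then e $ N else 0) + (if i = Suc k then of_nat (Suc k) * u $ Suc k * e $ m else 0)"
      for i
    proof -
      have "i = 0 \<or> i = 1 \<or> 1 < i \<and> i \<le> k \<or> Suc k \<le> i \<and> 0 < i \<and> N \<le> m + i - 1"
        unfolding N_def by arith
      then consider "i = 0" | "i = 1" | "1 < i" "i \<le> k" | "Suc k \<le> i" "0 < i" "N \<le> m + i - 1"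
        by blast
      then show ?thesis
      proof cases
        case 4
        then show ?thesis using pw[of i N] u(4) by (auto simp: N_def)
      qed (use u in \<open>auto simp: tid_iff e_def\<close>)
    qed
    have "((u oo f) - (u oo g)) $ N = (\<Sum>i\<in>{0..N}. u $ i * (f ^ i - g ^ i) $ N)"
      by (simp add: fps_compose_nth right_diff_distrib sum_subtractf)
    also have "\<dots> = e $ N + of_nat (Suc k) * u $ Suc k * e $ m"
      unfolding z using \<open>m > Suc k\<close> u(4) by (simp add: sum.distrib N_def)
    finally show ?thesis .
  qed
  ultimately have "of_nat m * u $ Suc k * e $ m = of_nat (Suc k) * u $ Suc k * e $ m" by simp
  then have "of_nat m = (of_nat (Suc k) :: 'a)" using u(3) m by auto
  then have "m = Suc k" using of_nat_eq_iff by blast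
  then show False using \<open>m > Suc k\<close> by simp
qed

lemma series_order:
  assumes "tid u" "u \<noteq> fps_X"
  obtains k where "0 < k" "u $ Suc k \<noteq> 0" "\<And>l. 1 < l \<Longrightarrow> l \<le> k \<Longrightarrow> u $ l = 0"
proof -
  define k where "k = (LEAST k. 0 < k \<and> u $ Suc k \<noteq> 0)"
  have "\<exists>n. u $ n \<noteq> fps_X $ n" using assms(2) by (auto simp: fps_eq_iff)
  then obtain n where n: "u $ n \<noteq> fps_X $ n" by blast
  then have "0 < n - 1 \<and> u $ Suc (n - 1) \<noteq> 0"
    using assms(1) by (cases "n = 0 \<or> n = 1") (auto simp: tid_iff fps_X_def)
  then have k: "0 < k \<and> u $ Suc k \<noteq> 0" unfolding k_def by (rule LeastI)
  moreover have "u $ l = 0" if "1 < l" "l \<le> k" for l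
  proof (rule ccontr)
    assume "u $ l \<noteq> 0"
    then have "k \<le> l - 1" unfolding k_def using that by (intro Least_le) auto
    then show False using that by simp
  qed
  ultimately show ?thesis using that by blast
qed

text \<open>If f started at an earlier degree than u, the roles could be exchanged: u and
  \<open>fps_X\<close> both commute with f and agree as far as \<open>commuting_series_eq\<close>
  asks, so u would be trivial.\<close>

lemma commuting_series_low:
  fixes u f :: "'a::{idom,ring_char_0} fps"
  assumes u: "tid u" "u $ Suc k \<noteq> 0" "0 < k" and f: "tid f" "f oo u = u oo f"
    and low: "\<And>l. 1 < l \<Longrightarrow> l \<le> k \<Longrightarrow> u $ l = 0"
  shows "1 < l \<Longrightarrow> l \<le> k \<Longrightarrow> f $ l = 0"
proof (rule ccontr)
  assume l: "1 < l" "l \<le> k" "f $ l \<noteq> 0"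
  then have "f \<noteq> fps_X" by (auto simp: fps_X_def)
  then obtain m where m: "0 < m" "f $ Suc m \<noteq> 0" "\<And>l. 1 < l \<Longrightarrow> l \<le> m \<Longrightarrow> f $ l = 0"
    using series_order f(1) by blast
  then have "m < k" using l by (meson leI less_le_trans not_less_eq_eq le_trans)
  have "u = fps_X"
  proof (rule commuting_series_eq[OF f(1) m(3,2,1) u(1)])
    show "tid (fps_X :: 'a fps)" by (simp add: tid_iff)
    fix l assume "l \<le> Suc m"
    then show "u $ l = fps_X $ l"
      using low[of l] u(1) \<open>m < k\<close> by (cases "l = 0 \<or> l = 1") (auto simp: tid_iff fps_X_def)
  qed (use f u in \<open>auto simp: tid_iff\<close>)
  then show False using u(2,3) by (simp add: fps_X_def)
qed

lemma compose_nth_low: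
  fixes f g :: "'a::idom fps"
  assumes "tid f" "tid g" "0 < k" "\<And>l. 1 < l \<Longrightarrow> l \<le> k \<Longrightarrow> f $ l = 0"
  shows "l \<le> Suc k \<Longrightarrow> 1 < l \<Longrightarrow> (f oo g) $ l = f $ l + g $ l"
proof -
  assume l: "l \<le> Suc k" "1 < l"
  have "f $ i * (g ^ i) $ l = (if i = 1 then g $ l else 0) + (if i = l then f $ l else 0)"
    if "i \<le> l" for i
  proof -
    have "i = 0 \<or> i = 1 \<or> 1 < i \<and> i \<le> k \<and> i < l \<or> i = l" using that l by arith
    then show ?thesis using assms l tid_power_nth(1)[of g l] by (auto simp: tid_iff)
  qed
  then show "(f oo g) $ l = f $ l + g $ l"
    using l by (simp add: fps_compose_nth sum.distrib)
qed

text \<open>Both products commute with u, and up to degree k + 1 their coefficients are the sums of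
  those of f and g, hence equal.\<close>

lemma series_commute_trans:
  fixes u f g :: "'a::{idom,ring_char_0} fps"
  assumes u: "tid u" "u \<noteq> fps_X" and f: "tid f" "f oo u = u oo f" and g: "tid g" "g oo u = u oo g"
  shows "f oo g = g oo f"
proof -
  obtain k where k: "0 < k" "u $ Suc k \<noteq> 0" "\<And>l. 1 < l \<Longrightarrow> l \<le> k \<Longrightarrow> u $ l = 0"
    using series_order u by blast
  have low: "1 < l \<Longrightarrow> l \<le> k \<Longrightarrow> f $ l = 0" "1 < l \<Longrightarrow> l \<le> k \<Longrightarrow> g $ l = 0" for l
    using commuting_series_low[OF u(1) k(2,1) _ _ k(3)] f g by blast+
  have z: "u $ 0 = 0" "f $ 0 = 0" "g $ 0 = 0" using u f g by (simp_all add: tid_iff)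
  have comm: "(a oo b) oo u = u oo (a oo b)" if "a oo u = u oo a" "b oo u = u oo b" "a $ 0 = 0" "b $ 0 = 0" for a b
    using that by (metis fps_compose_assoc z(1))
  show ?thesis
  proof (rule commuting_series_eq[OF u(1) k(3,2,1)])
    fix l assume "l \<le> Suc k"
    then show "(f oo g) $ l = (g oo f) $ l"
      using compose_nth_low[OF f(1) g(1) k(1) low(1), of l] compose_nth_low[OF g(1) f(1) k(1) low(2), of l]
        tid_compose[OF f(1) g(1)] tid_compose[OF g(1) f(1)]
      by (cases "l = 0 \<or> l = 1") (auto simp: tid_iff)
  qed (use f g z comm tid_compose in \<open>auto simp: fps_compose_assoc\<close>)
qed

text \<open>Conjugation does not change the first nontrivial coefficient, so v and u, which both
  commute with u, agree up to degree k + 1.\<close>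

lemma series_malnormal:
  fixes u x v :: "'a::{idom,ring_char_0} fps"
  assumes u: "tid u" "u \<noteq> fps_X" and x: "tid x" and v: "tid v" "v oo x = x oo u" "v oo u = u oo v"
  shows "v = u"
proof -
  obtain k where k: "0 < k" "u $ Suc k \<noteq> 0" "\<And>l. 1 < l \<Longrightarrow> l \<le> k \<Longrightarrow> u $ l = 0"
    using series_order u by blast
  have low: "1 < l \<Longrightarrow> l \<le> k \<Longrightarrow> v $ l = 0" for l
    using commuting_series_low[OF u(1) k(2,1) v(1,3) k(3)] by blast
  have mid: "(x oo u) $ Suc k = x $ Suc k + u $ Suc k"
  proof -
    have "x $ i * (u ^ i) $ Suc k = (if i = 1 then u $ Suc k else 0) + (if i = Suc k then x $ Suc k else 0)"
      if "i \<le> Suc k" for i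
    proof (cases "1 < i \<and> i \<le> k")
      case True
      then have "Suc (Suc k - i) \<le> k" "1 < Suc (Suc k - i)" by arith+
      then show ?thesis
        using True tid_power_low[OF u(1) k(3), where k = k and i = i and j = "Suc k - i"] k(3)[of "Suc (Suc k - i)"] by simp
    next
      case False
      then have "i = 0 \<or> i = 1 \<or> i = Suc k" using that by arith
      then show ?thesis using tid_power_nth(1)[OF u(1), of "Suc k"] k(1) x by (auto simp: tid_iff)
    qed
    then show ?thesis using k(1) by (simp add: fps_compose_nth sum.distrib del: sum.cl_ivl_Suc)
  qed
  show ?thesis
  proof (rule commuting_series_eq[OF u(1) k(3,2,1) v(1,3) u(1) HOL.refl])
    fix l assume l: "l \<le> Suc k"
    have "v $ Suc k = u $ Suc k"
      using compose_nth_low[OF v(1) x k(1) low, of "Suc k"] mid v(2) k(1) by simp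
    then show "v $ l = u $ l"
      using l low[of l] k(3)[of l] u(1) v(1) by (cases "l \<le> 1"; cases "l = Suc k") (auto simp: tid_iff le_Suc_eq)
  qed
qed

subsection \<open>Powers of a series with a variable exponent\<close>

text \<open>Newton's series: \<open>series_diff u i\<close> is the \<open>i\<close>-th difference of \<open>n \<mapsto> u\<^sup>n\<close> at \<open>0\<close>.\<close>

primrec series_diff :: "'a::idom fps \<Rightarrow> nat \<Rightarrow> 'a fps" where
  "series_diff u 0 = fps_X"
| "series_diff u (Suc i) = (series_diff u i oo u) - series_diff u i"

text \<open>Composition with u preserves the lowest coefficient, so every difference gains one
  order. This keeps the sum in \<open>spow\<close> finite in each degree.\<close>

lemma series_diff_low: "tid u \<Longrightarrow> l \<le> i \<Longrightarrow> series_diff u i $ l = 0"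
proof (induction i arbitrary: l)
  case (Suc i)
  have "series_diff u i $ j * (u ^ j) $ l = (if j = l then series_diff u i $ l else 0)" if "j \<le> l" for j
    using Suc that tid_power_nth(1)[OF Suc.prems(1), of l] by (cases "j = l") auto
  then show ?case by (simp add: fps_compose_nth)
qed (simp add: fps_X_def)

text \<open>Composition with u is the shift operator, that is 1 plus the difference operator; the
  induction is Pascal's rule.\<close>

lemma series_pow_binomial:
  assumes "tid u"
  shows "u [^]\<^bsub>series_mon\<^esub> (n::nat) = (\<Sum>i\<le>n. of_nat (n choose i) * series_diff u i)"
proof (induction n)
  case (Suc n)
  have u0: "u $ 0 = 0" using assms by (simp add: tid_iff)
  let ?d = "series_diff u"
  have c: "(of_nat k * f) oo u = of_nat k * (f oo u)" for k and f :: "'a fps"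
    by (simp add: fps_compose_mult_distrib u0 fps_of_nat[symmetric])
  have "u [^]\<^bsub>series_mon\<^esub> Suc n = (\<Sum>i\<le>n. of_nat (n choose i) * ?d i) oo u"
    by (simp add: Suc.IH)
  also have "\<dots> = (\<Sum>i\<le>n. of_nat (n choose i) * (?d i + ?d (Suc i)))"
    by (simp add: fps_compose_sum_distrib c)
  also have "\<dots> = (\<Sum>i\<le>Suc n. of_nat (n choose i) * ?d i) + (\<Sum>i\<le>n. of_nat (n choose i) * ?d (Suc i))"
    by (simp add: distrib_left sum.distrib binomial_eq_0 del: series_diff.simps)
  also have "\<dots> = ?d 0 + (\<Sum>i\<le>n. of_nat (n choose Suc i) * ?d (Suc i)) + (\<Sum>i\<le>n. of_nat (n choose i) * ?d (Suc i))"
    by (subst sum.atMost_Suc_shift) (simp del: series_diff.simps)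
  also have "\<dots> = (\<Sum>i\<le>Suc n. of_nat (Suc n choose i) * ?d i)"
    by (subst sum.atMost_Suc_shift) (simp add: sum.distrib distrib_right add_ac del: series_diff.simps)
  finally show ?case .
qed simp

text \<open>The binomial coefficient with a polynomial on top. The division by i! takes place in the
  coefficient field, since the polynomial ring has none.\<close>

definition mbinom :: "('x, 'c::field_char_0) mpoly \<Rightarrow> nat \<Rightarrow> ('x, 'c) mpoly" where
  "mbinom e i = mconst (1 / fact i) * (\<Prod>l<i. e - of_nat l)"

lemma mbinom_of_nat: "mbinom (of_nat n) i = (of_nat (n choose i) :: ('x, 'c::field_char_0) mpoly)"
proof -
  interpret ring_hom1 "mconst :: 'c \<Rightarrow> ('x, 'c) mpoly" by (rule ring_hom1_mconst)
  have "mbinom (of_nat n) i = (mconst ((1 / fact i) * (\<Prod>l<i. of_nat n - of_nat l)) :: ('x, 'c) mpoly)"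
    by (simp only: mbinom_def mult prod diff of_nat)
  also have "(1 / fact i) * (\<Prod>l<i. of_nat n - of_nat l) = (of_nat (n choose i) :: 'c)"
    by (simp add: binomial_gbinomial gbinomial_prod_rev atLeast0LessThan)
  finally show ?thesis by (simp only: of_nat)
qed

text \<open>Newton's interpolation of n \<mapsto> u^n at a polynomial exponent. Differences of order
  above l do not reach the l-th coefficient.\<close>

definition spow :: "('x::linorder, 'c::field_char_0) mpoly fps \<Rightarrow> ('x, 'c) mpoly \<Rightarrow> ('x, 'c) mpoly fps" where
  "spow u e = Abs_fps (\<lambda>l. \<Sum>i\<le>l. mbinom e i * series_diff u i $ l)"

lemma spow_of_nat:
  assumes "tid u"
  shows "spow u (of_nat n) = u [^]\<^bsub>series_mon\<^esub> n"
proof (rule fps_ext)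
  fix l
  have "spow u (of_nat n) $ l = (\<Sum>i\<le>l. of_nat (n choose i) * series_diff u i $ l)"
    by (simp add: spow_def mbinom_of_nat)
  also have "\<dots> = (\<Sum>i\<le>l + n. of_nat (n choose i) * series_diff u i $ l)"
    using series_diff_low[OF assms] by (intro sum.mono_neutral_left) auto
  also have "\<dots> = (\<Sum>i\<le>n. of_nat (n choose i) * series_diff u i $ l)"
    by (intro sum.mono_neutral_right) auto
  also have "\<dots> = (u [^]\<^bsub>series_mon\<^esub> n) $ l"
    by (simp add: series_pow_binomial[OF assms] fps_sum_nth fps_of_nat[symmetric])
  finally show "spow u (of_nat n) $ l = (u [^]\<^bsub>series_mon\<^esub> n) $ l" .
qed

lemma tid_spow: "tid u \<Longrightarrow> tid (spow u e)"
  using series_diff_low[of u 1 1]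
  by (simp add: tid_iff spow_def mbinom_def ring_hom1.one[OF ring_hom1_mconst])

lemma fps_map_spow:
  assumes h: "ring_hom1 h" and c: "\<And>c. h (mconst c) = mconst c"
  shows "fps_map h (spow u e) = spow (fps_map h u) (h e)"
proof -
  interpret ring_hom1 h by (rule h)
  have d: "h (series_diff u i $ l) = series_diff (fps_map h u) i $ l" for i l
  proof (induction i arbitrary: l)
    case (Suc i)
    have "fps_map h (series_diff u i) = series_diff (fps_map h u) i"
      using Suc by (intro fps_ext) simp
    then show ?case using Suc by (simp add: diff flip: fps_map_compose) (metis fps_map_compose fps_map_nth)
  qed (simp add: fps_X_def zero one)
  have b: "h (mbinom e i) = mbinom (h e) i" for i
    by (simp add: mbinom_def mult c prod diff of_nat)
  show ?thesis
    by (rule fps_ext) (simp add: spow_def sum mult b d)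
qed

lemma spow_in:
  assumes "u \<in> series_in J" "e \<in> mpolys J"
  shows "spow u e \<in> series_in J"
proof -
  have "of_nat n \<in> mpolys J" for n
    using mpolys.mconst[of "of_nat n" J] by (simp add: ring_hom1.of_nat[OF ring_hom1_mconst])
  then have "mbinom e i \<in> mpolys J" for i
    unfolding mbinom_def using assms(2) by (intro mpolys.mult mpolys.mconst mpolys_prod mpolys_diff)
  moreover have "series_diff u i $ l \<in> mpolys J" for i l
  proof (induction i arbitrary: l)
    case (Suc i)
    then show ?case using assms(1)
      by (auto simp: fps_compose_nth series_in_def intro!: mpolys_diff mpolys_sum mpolys.mult mpolys_fps_power)
  qed (simp add: fps_X_def)
  ultimately show ?thesis
    using assms(1) tid_spow[of u e] by (auto simp: series_in_def spow_def intro!: mpolys_sum mpolys.mult)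
qed

text \<open>Each coefficient of f - g is a polynomial that vanishes at infinitely many natural
  values of one variable. This transfers identities between integer and generic exponents.\<close>

lemma fps_map_msubst_infinite:
  fixes f g :: "('x::linorder, 'c::{idom,ring_char_0}) mpoly fps"
  assumes "infinite {n::nat. fps_map (msubst j (of_nat n)) f = fps_map (msubst j (of_nat n)) g}"
  shows "f = g"
proof (rule fps_ext)
  fix l
  have "{n::nat. fps_map (msubst j (of_nat n)) f = fps_map (msubst j (of_nat n)) g}
      \<subseteq> {n. msubst j (of_nat n) (f $ l - g $ l) = 0}"
    by (auto simp: fps_eq_iff ring_hom1.diff[OF ring_hom1_msubst])
  then have "infinite {n::nat. msubst j (of_nat n) (f $ l - g $ l) = 0}"
    using assms infinite_super by blast
  then have "f $ l - g $ l = 0" by (rule infinite_msubst_zero)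
  then show "f $ l = g $ l" by simp
qed

lemma msubst_mconst [simp]: "msubst j e (mconst c) = mconst c"
  by (simp add: msubst_def ring_hom1_mconst)

lemma msubst_mvar [simp]: "msubst j e (mvar i) = (if i = j then e else mvar i)"
  by (simp add: msubst_def ring_hom1_mconst)

lemma fps_map_msubst_series_in: "f \<in> series_in J \<Longrightarrow> j \<notin> J \<Longrightarrow> fps_map (msubst j e) f = f"
  by (intro fps_ext) (auto simp: series_in_def intro: msubst_mpolys)

lemma fps_map_msubst_spow:
  assumes "u \<in> series_in J" "j \<notin> J"
  shows "fps_map (msubst j (of_nat n)) (spow u (mvar j)) = u [^]\<^bsub>series_mon\<^esub> n"
  using assms fps_map_spow[OF ring_hom1_msubst[of j "of_nat n"], of u "mvar j"]
  by (simp add: fps_map_msubst_series_in spow_of_nat series_in_tid)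

text \<open>c commutes with u^n for every natural n, and these are the specialisations of the
  generic power.\<close>

lemma spow_commute:
  assumes "u \<in> series_in J" "c \<in> series_in J" "j \<notin> J" "c oo u = u oo c"
  shows "c oo spow u (mvar j) = spow u (mvar j) oo c"
proof (rule fps_map_msubst_infinite[of j])
  have "c oo (u [^]\<^bsub>series_mon\<^esub> n) = (u [^]\<^bsub>series_mon\<^esub> n) oo c" for n :: nat
    using series.group_commutes_pow[of u c n] assms(1,2,4) by (simp add: series_in_tid)
  then have "{n::nat. fps_map (msubst j (of_nat n)) (c oo spow u (mvar j)) =
      fps_map (msubst j (of_nat n)) (spow u (mvar j) oo c)} = UNIV"
    using assms by (simp add: ring_hom1.fps_map_compose[OF ring_hom1_msubst]
        fps_map_msubst_spow fps_map_msubst_series_in)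
  then show "infinite {n::nat. fps_map (msubst j (of_nat n)) (c oo spow u (mvar j)) =
      fps_map (msubst j (of_nat n)) (spow u (mvar j) oo c)}" by simp
qed

subsection \<open>Words with a free variable over a group of series\<close>

text \<open>\<open>word_val L s g\<^sub>0 [(e\<^sub>1, g\<^sub>1), \<dots>, (e\<^sub>m, g\<^sub>m)]\<close> is \<open>g\<^sub>0 s\<^bsup>e\<^sub>1\<^esup> g\<^sub>1 \<dots> s\<^bsup>e\<^sub>m\<^esup> g\<^sub>m\<close>.\<close>

definition word_val :: "('b, 'm) monoid_scheme \<Rightarrow> 'b \<Rightarrow> 'b \<Rightarrow> (int \<times> 'b) list \<Rightarrow> 'b" where
  "word_val L s g es = g \<otimes>\<^bsub>L\<^esub> foldr (\<lambda>(e, g) x. s [^]\<^bsub>L\<^esub> e \<otimes>\<^bsub>L\<^esub> g \<otimes>\<^bsub>L\<^esub> x) es \<one>\<^bsub>L\<^esub>"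

text \<open>The shape of s f s^-1 g s f' s^-1 g' ..., the words that a conjugated second factor
  produces.\<close>

definition alternating :: "(int \<times> 'b) list \<Rightarrow> bool" where
  "alternating es \<longleftrightarrow> fst ` set es \<subseteq> {1, -1} \<and> successively (\<lambda>x y. fst y = - fst x) es"

text \<open>The sum stops at \<open>m\<close> because \<open>y\<^sup>n\<close> vanishes below order \<open>n\<close> when \<open>y $ 0 = 0\<close>; other \<open>y\<close> give junk.\<close>

definition series_eval :: "'a::idom fps fps \<Rightarrow> 'a fps \<Rightarrow> 'a fps" where
  "series_eval a y = Abs_fps (\<lambda>m. (\<Sum>n\<le>m. a $ n * y ^ n) $ m)"

section \<open>Substituting into a series whose coefficients are series\<close>

lemma mult_power_low:
  fixes y :: "'a::idom fps"
  assumes "y $ 0 = 0" "m < n"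
  shows "(a * y ^ n) $ m = 0"
  using fps_mult_nth_lowest(2)[of 0 a n "y ^ n" m] assms startsby_zero_power_prefix[of y] by simp

lemma series_eval_nth:
  assumes "y $ 0 = 0" "m \<le> N"
  shows "series_eval a y $ m = (\<Sum>n\<le>N. a $ n * y ^ n) $ m"
proof -
  have "(\<Sum>n\<le>m. (a $ n * y ^ n) $ m) = (\<Sum>n\<le>N. (a $ n * y ^ n) $ m)"
    using assms by (intro sum.mono_neutral_left) (auto simp: mult_power_low)
  then show ?thesis by (simp add: series_eval_def fps_sum_nth)
qed

lemma series_eval_nth_0: "series_eval a y $ 0 = (a $ 0) $ 0"
  by (simp add: series_eval_def)

lemma series_eval_add: "series_eval (a + b) y = series_eval a y + series_eval b y"
  by (rule fps_ext) (simp add: series_eval_def fps_sum_nth sum.distrib distrib_right)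

lemma fps_mult_nth_cong:
  "(\<And>j. j \<le> m \<Longrightarrow> f $ j = f' $ j) \<Longrightarrow> (\<And>j. j \<le> m \<Longrightarrow> g $ j = g' $ j) \<Longrightarrow> (f * g) $ m = (f' * g') $ m"
  unfolding fps_mult_nth by (intro sum.cong) auto

lemma series_eval_mult:
  assumes y: "y $ 0 = 0"
  shows "series_eval (a * b) y = series_eval a y * series_eval b y"
proof (rule fps_ext)
  fix m :: nat
  let ?A = "{..m} \<times> {..m}"
  have "(series_eval a y * series_eval b y) $ m = ((\<Sum>n\<le>m. a $ n * y ^ n) * (\<Sum>n\<le>m. b $ n * y ^ n)) $ m"
    by (rule fps_mult_nth_cong) (simp_all add: series_eval_nth[OF y])
  also have "\<dots> = (\<Sum>(i, j)\<in>?A. (a $ i * b $ j * y ^ (i + j)) $ m)"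
    by (simp add: sum_product sum.cartesian_product fps_sum_nth power_add mult_ac case_prod_unfold)
  \<comment> \<open>Terms with i + j > m have order above m because y has no constant term.\<close>
  also have "\<dots> = (\<Sum>(i, j)\<in>{(i, j). i + j \<le> m}. (a $ i * b $ j * y ^ (i + j)) $ m)"
    using mult_power_low[OF y, of m] by (intro sum.mono_neutral_right) (auto, meson not_less)
  also have "\<dots> = (\<Sum>n\<le>m. \<Sum>i\<le>n. (a $ i * b $ (n - i) * y ^ n) $ m)"
    by (subst sum.triangle_reindex_eq) simp
  also have "\<dots> = series_eval (a * b) y $ m"
    by (simp add: series_eval_def fps_sum_nth fps_mult_nth[of a b] sum_distrib_right atLeast0AtMost)
  finally show "series_eval (a * b) y $ m = (series_eval a y * series_eval b y) $ m" by simp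
qed

lemma series_eval_const [simp]: "series_eval (fps_const c) y = c"
proof (rule fps_ext)
  fix m :: nat
  have "(\<Sum>n\<le>m. fps_const c $ n * y ^ n) = (\<Sum>n\<le>m. if n = 0 then c else 0)"
    by (intro sum.cong) auto
  then show "series_eval (fps_const c) y $ m = c $ m" by (simp add: series_eval_def)
qed

lemma series_eval_one [simp]: "series_eval 1 y = 1"
  using series_eval_const[of 1 y] by simp

lemma series_eval_power: "y $ 0 = 0 \<Longrightarrow> series_eval (a ^ n) y = series_eval a y ^ n"
  by (induction n) (simp_all add: series_eval_mult)

lemma series_eval_prod: "y $ 0 = 0 \<Longrightarrow> series_eval (prod f A) y = (\<Prod>x\<in>A. series_eval (f x) y)"
  by (induction A rule: infinite_finite_induct) (simp_all add: series_eval_mult)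

lemma series_eval_X [simp]:
  assumes "y $ 0 = 0"
  shows "series_eval fps_X y = y"
proof (rule fps_ext)
  fix m :: nat
  have "series_eval fps_X y $ m = (\<Sum>n\<le>Suc m. fps_X $ n * y ^ n) $ m"
    by (rule series_eval_nth[OF assms]) simp
  also have "(\<Sum>n\<le>Suc m. fps_X $ n * y ^ n) = (\<Sum>n\<le>Suc m. if n = 1 then y else 0)"
    by (intro sum.cong) auto
  finally show "series_eval fps_X y $ m = y $ m" by (simp del: sum.atMost_Suc)
qed

lemma series_eval_compose:
  assumes y: "y $ 0 = 0" and b: "b $ 0 = 0"
  shows "series_eval (a oo b) y = series_eval a (series_eval b y)"
proof (rule fps_ext)
  fix m :: nat
  have z: "series_eval b y $ 0 = 0" using b by (simp add: series_eval_nth_0)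
  have "(\<Sum>n\<le>m. (a oo b) $ n * y ^ n) = (\<Sum>n\<le>m. \<Sum>i\<le>m. a $ i * (b ^ i) $ n * y ^ n)"
  proof (rule sum.cong)
    fix n assume "n \<in> {..m}"
    then have "(a oo b) $ n = (\<Sum>i\<le>m. a $ i * (b ^ i) $ n)"
      unfolding fps_compose_nth using startsby_zero_power_prefix[OF b]
      by (intro sum.mono_neutral_left) auto
    then show "(a oo b) $ n * y ^ n = (\<Sum>i\<le>m. a $ i * (b ^ i) $ n * y ^ n)"
      by (simp add: sum_distrib_right)
  qed simp
  also have "\<dots> = (\<Sum>i\<le>m. a $ i * (\<Sum>n\<le>m. (b ^ i) $ n * y ^ n))"
    by (subst sum.swap) (simp add: sum_distrib_left mult.assoc)
  also have "\<dots> $ m = (\<Sum>i\<le>m. a $ i * series_eval b y ^ i) $ m"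
    unfolding fps_sum_nth
  proof (rule sum.cong)
    fix i
    show "(a $ i * (\<Sum>n\<le>m. (b ^ i) $ n * y ^ n)) $ m = (a $ i * series_eval b y ^ i) $ m"
      by (rule fps_mult_nth_cong) (simp_all add: series_eval_nth[OF y] flip: series_eval_power[OF y])
  qed simp
  finally show "series_eval (a oo b) y $ m = series_eval a (series_eval b y) $ m"
    using z by (simp add: series_eval_def)
qed

text \<open>g turns into a series in the outer variable with constant coefficients, and so acts on y
  as g oo y.\<close>

abbreviation lift_series :: "'a::idom fps \<Rightarrow> 'a fps fps" where
  "lift_series \<equiv> fps_map fps_const"

lemma ring_hom1_fps_const: "ring_hom1 (fps_const :: 'a::comm_ring_1 \<Rightarrow> 'a fps)"
  by standard simp_all

lemma series_eval_lift: "series_eval (lift_series g) y = g oo y"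
  by (rule fps_ext) (simp add: series_eval_def fps_compose_nth fps_sum_nth atLeast0AtMost)

text \<open>The set that tangent series over power series permute by substitution. The series 0 is
  left out, being fixed by all of them.\<close>

definition points :: "'a::idom fps set" where
  "points = {y. y $ 0 = 0 \<and> y \<noteq> 0}"

lemma series_eval_inv:
  assumes "tid s" "y \<in> points"
  shows "series_eval (comp_inv s) (series_eval s y) = y"
    and "series_eval s (series_eval (comp_inv s) y) = y"
proof -
  have "s oo comp_inv s = fps_X"
    using series.r_inv[of s] assms(1) by (simp add: inv_series_mon)
  then show "series_eval (comp_inv s) (series_eval s y) = y" "series_eval s (series_eval (comp_inv s) y) = y"
    using assms comp_inv_left[of s] tid_comp_inv[of s]
    by (simp_all add: points_def tid_iff flip: series_eval_compose)
qed

lemma series_eval_points: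
  assumes "tid s" "y \<in> points"
  shows "series_eval s y \<in> points"
proof -
  have "series_eval (comp_inv s) 0 = 0"
    using tid_comp_inv[OF assms(1)]
    by (intro fps_ext) (auto simp: series_eval_def fps_sum_nth tid_iff power_0_left sum.delta intro!: sum.neutral)
  then have "series_eval s y \<noteq> 0"
    using series_eval_inv(1)[OF assms] assms(2) by (auto simp: points_def)
  then show ?thesis using assms(1) by (simp add: points_def series_eval_nth_0 tid_iff)
qed

lemma inj_on_series_eval: "tid s \<Longrightarrow> inj_on (series_eval s) points"
  by (metis inj_on_def series_eval_inv(1))

lemma tid_lift: "tid g \<Longrightarrow> tid (lift_series g)"
  by (simp add: tid_iff)

text \<open>A fixed point y would be a root of g - x, but composition with a nonzero y without
  constant term is injective. This is special to series with constant coefficients: they act freely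
  on \<open>points\<close>.\<close>

lemma fixed_point_free:
  assumes "tid g" "g \<noteq> fps_X" "y \<in> points"
  shows "g oo y \<noteq> y"
proof
  assume "g oo y = y"
  then have "(g - fps_X) oo y = 0"
    using assms(3) by (simp add: fps_compose_sub_distrib points_def)
  then have "g - fps_X = 0"
    using assms(3) by (simp add: fps_compose_eq_0_iff points_def)
  then show False using assms(2) by simp
qed

text \<open>Adding multiples of a series that vanishes on Z but not at p gives infinitely many
  values at p and changes no value on Z.\<close>

lemma series_move_point:
  fixes s :: "'a::{idom,ring_char_0} fps fps"
  assumes s: "tid s" and Z: "finite Z" "Z \<subseteq> points" and p: "p \<in> points" "p \<notin> Z" and B: "finite B"
  shows "\<exists>s'. tid s' \<and> (\<forall>z\<in>Z. series_eval s' z = series_eval s z) \<and> series_eval s' p \<notin> B"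
proof -
  \<comment> \<open>The square keeps s tangent to the identity; the product supplies the zeros at
    Z.\<close>
  define q :: "'a fps fps" where "q = fps_X ^ 2 * (\<Prod>z\<in>Z. fps_X - fps_const z)"
  define t :: "nat \<Rightarrow> 'a fps fps" where "t n = s + fps_const (of_nat n) * q" for n
  have q: "series_eval q y = y ^ 2 * (\<Prod>z\<in>Z. y - z)" if "y $ 0 = 0" for y
  proof -
    have d: "series_eval (fps_X - fps_const z) y = y - z" for z
      using series_eval_add[of "fps_X - fps_const z" "fps_const z" y] that by (simp add: eq_diff_eq)
    show ?thesis
      unfolding q_def
      by (simp add: series_eval_mult[OF that] series_eval_power[OF that] series_eval_prod[OF that] that d)
  qed
  have "tid (t n)" for n
  proof -
    have "q $ i = 0" if "i < 2" for i
      using fps_mult_nth_lowest(2)[of 2 "fps_X ^ 2" 0 "\<Prod>z\<in>Z. fps_X - fps_const z" i] that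
      by (simp add: q_def fps_X_power_iff)
    then show ?thesis using s by (simp add: t_def tid_iff)
  qed
  moreover have ev: "series_eval (t n) y = series_eval s y + of_nat n * series_eval q y" if "y $ 0 = 0" for n y
    by (simp add: t_def series_eval_add series_eval_mult[OF that])
  have "series_eval (t n) z = series_eval s z" if "z \<in> Z" for n z
    using that Z ev[of z] q[of z] by (auto simp: points_def)
  moreover have "\<exists>n. series_eval (t n) p \<notin> B"
  proof (rule ccontr)
    assume "\<not> ?thesis"
    then have "range (\<lambda>n. series_eval (t n) p) \<subseteq> B" by blast
    moreover have "inj (\<lambda>n. series_eval (t n) p)"
    proof (rule injI)
      fix m n assume "series_eval (t m) p = series_eval (t n) p"
      then have "(of_nat m :: 'a fps) = of_nat n"
        using ev[of p] q[of p] p Z(1) by (auto simp: points_def)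
      then show "m = n" using fps_of_nat[of m] fps_of_nat[of n] fps_nth_fps_const[of "of_nat m :: 'a" 0] fps_nth_fps_const[of "of_nat n :: 'a" 0] by simp
    qed
    ultimately show False using B by (meson finite_subset infinite_UNIV_char_0 finite_imageD)
  qed
  ultimately show ?thesis by blast
qed

text \<open>Move the value of the inverse at p while keeping its values on s(Z), then invert
  back.\<close>

lemma series_move_point_inv:
  fixes s :: "'a::{idom,ring_char_0} fps fps"
  assumes s: "tid s" and Z: "finite Z" "Z \<subseteq> points" and p: "p \<in> points" "p \<notin> series_eval s ` Z"
    and B: "finite B"
  shows "\<exists>s'. tid s' \<and> (\<forall>z\<in>Z. series_eval s' z = series_eval s z) \<and> series_eval (comp_inv s') p \<notin> B"
proof -
  obtain t where t: "tid t" "\<forall>z\<in>Z. series_eval t (series_eval s z) = series_eval (comp_inv s) (series_eval s z)"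
    "series_eval t p \<notin> B"
    using series_move_point[OF tid_comp_inv[OF s], of "series_eval s ` Z" p B]
      series_eval_points[OF s] Z p B by blast
  have "comp_inv (comp_inv t) = t"
    using series.inv_inv[OF t(1)] t(1) tid_comp_inv[OF t(1)] by (simp add: inv_series_mon)
  moreover have "series_eval (comp_inv t) z = series_eval s z" if "z \<in> Z" for z
    using t(2) series_eval_inv(1)[OF t(1), of "series_eval s z"] series_eval_inv(1)[OF s, of z]
      series_eval_points[OF s, of z] that Z(2) by auto
  ultimately show ?thesis using t tid_comp_inv by metis
qed

section \<open>Words acting on points\<close>

definition series_step :: "'a::idom fps fps \<Rightarrow> int \<times> 'a fps \<Rightarrow> 'a fps \<Rightarrow> 'a fps" where
  "series_step s = (\<lambda>(e, g) y. series_eval (s [^]\<^bsub>series_mon\<^esub> e) (g oo y))"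

lemma int_pow_simps: "tid s \<Longrightarrow> s [^]\<^bsub>series_mon\<^esub> (1::int) = s"
  "tid s \<Longrightarrow> s [^]\<^bsub>series_mon\<^esub> (-1::int) = comp_inv s"
  by (simp_all add: series.int_pow_neg inv_series_mon)

text \<open>The series is chosen while the word is walked through: Z holds the arguments at which s
  is already committed. The condition on the first letter says that the point to be moved next is
  uncommitted, as an argument if the exponent is 1 and as a value if it is -1. So s can be changed
  to send that point outside any finite set.\<close>

lemma walk_avoids:
  fixes s :: "'a::{idom,ring_char_0} fps fps"
  assumes "gs \<noteq> []" "fst ` set gs \<subseteq> {1, -1}" "successively (\<lambda>x y. fst y = - fst x) gs"
    and "\<And>x. x \<in> set gs \<Longrightarrow> tid (snd x)" "\<And>x. x \<in> set (tl gs) \<Longrightarrow> snd x \<noteq> fps_X"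
    and "tid s" "finite Z" "Z \<subseteq> points" "y \<in> points" "finite B"
    and "snd (hd gs) oo y \<notin> (if fst (hd gs) = 1 then Z else series_eval s ` Z)"
  shows "\<exists>s'. tid s' \<and> (\<forall>z\<in>Z. series_eval s' z = series_eval s z) \<and> fold (series_step s') gs y \<notin> B"
  using assms
proof (induction gs arbitrary: s Z y)
  case (Cons x gs)
  obtain e g where x: "x = (e, g)" by fastforce
  define p where "p = g oo y"
  have g: "tid g" using Cons.prems(4)[of x] x by simp
  have p: "p \<in> points"
    unfolding p_def using series_eval_points[OF tid_lift[OF g] Cons.prems(9)] by (simp add: series_eval_lift)
  have e: "e = 1 \<or> e = -1" using Cons.prems(2) x by auto
  have move: "\<exists>s'. tid s' \<and> (\<forall>z\<in>Z. series_eval s' z = series_eval s z) \<and>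
      series_eval (s' [^]\<^bsub>series_mon\<^esub> e) p \<notin> C" if "finite C" for C
    using e series_move_point[OF Cons.prems(6,7,8) p _ that]
      series_move_point_inv[OF Cons.prems(6,7,8) p _ that] Cons.prems(11)
    by (auto simp: x p_def int_pow_simps) (metis int_pow_simps)+
  show ?case
  proof (cases gs)
    case Nil
    then show ?thesis using move[OF Cons.prems(10)] by (simp add: x series_step_def p_def)
  next
    case (Cons x' gs')
    obtain e' g' where x': "x' = (e', g')" by fastforce
    have e': "e' = - e" using Cons.prems(3) x x' Cons by simp
    have g': "tid g'" "g' \<noteq> fps_X" using Cons.prems(4)[of x'] Cons.prems(5)[of x'] x' Cons by auto
    have inj: "inj_on ((oo) g') points"
      using inj_on_series_eval[OF tid_lift[OF g'(1)]] by (simp add: series_eval_lift[abs_def])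
    \<comment> \<open>The destinations from which the next letter would hit an old
      commitment.\<close>
    define C where "C = {q \<in> points. g' oo q \<in> Z \<union> series_eval s ` Z}"
    have "finite ((oo) g' ` C)"
      by (rule finite_subset[of _ "Z \<union> series_eval s ` Z"]) (use Cons.prems(7) in \<open>auto simp: C_def\<close>)
    then have "finite C"
      by (rule finite_imageD) (rule inj_on_subset[OF inj], auto simp: C_def)
    from move[OF this] obtain t where t: "tid t" "\<And>z. z \<in> Z \<Longrightarrow> series_eval t z = series_eval s z"
      and q: "series_eval (t [^]\<^bsub>series_mon\<^esub> e) p \<notin> C"
      by metis
    define q where "q = series_eval (t [^]\<^bsub>series_mon\<^esub> e) p"
    have qp: "q \<in> points"
      unfolding q_def using series_eval_points[OF _ p] series.int_pow_closed[OF t(1)] by blast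
    \<comment> \<open>The new commitment has q as a value after exponent 1 and as an argument after
      exponent -1. The next exponent is the opposite one, so the next point must differ from q,
      which freeness of the action gives.\<close>
    have g'q: "g' oo q \<noteq> q" by (rule fixed_point_free[OF g' qp])
    have qC: "q \<notin> C" using q by (simp add: q_def)
    have tz: "series_eval t ` Z = series_eval s ` Z" using t(2) by simp
    \<comment> \<open>Commitments are recorded by arguments: s p = q for exponent 1, s q = p for
      exponent -1.\<close>
    define Z' where "Z' = insert (if e = 1 then p else q) Z"
    have "\<exists>s'. tid s' \<and> (\<forall>z\<in>Z'. series_eval s' z = series_eval t z) \<and> fold (series_step s') gs q \<notin> B"
    proof (rule Cons.IH)
      show "snd (hd gs) oo q \<notin> (if fst (hd gs) = 1 then Z' else series_eval t ` Z')"
      proof (cases "e = 1")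
        case True
        then have "series_eval t p = q" using t(1) by (simp add: q_def int_pow_simps)
        then show ?thesis using qC g'q qp True Cons x' e' tz by (simp add: C_def Z'_def)
      next
        case False
        then show ?thesis using qC g'q qp e Cons x' e' by (simp add: C_def Z'_def)
      qed
    qed (use Cons.prems Cons t(1) qp p in \<open>auto simp: Z'_def dest: list.set_sel(2)\<close>)
    then obtain s' where s': "tid s'" "\<And>z. z \<in> Z' \<Longrightarrow> series_eval s' z = series_eval t z"
      "fold (series_step s') gs q \<notin> B" by blast
    have "series_eval (s' [^]\<^bsub>series_mon\<^esub> e) p = q"
    proof (cases "e = 1")
      case True
      then show ?thesis using s'(1) s'(2)[of p] t(1) by (simp add: Z'_def q_def int_pow_simps)
    next
      case False
      then have e1: "e = -1" using e by simp
      then have "series_eval t q = p"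
        unfolding q_def using t(1) p by (simp add: int_pow_simps series_eval_inv)
      then have "series_eval s' q = p" using s'(2)[of q] False by (simp add: Z'_def)
      then show ?thesis using series_eval_inv(1)[OF s'(1) qp] e1 s'(1) by (simp add: int_pow_simps)
    qed
    then have "fold (series_step s') (x # gs) y \<notin> B"
      using s'(3) by (simp add: series_step_def x p_def)
    then show ?thesis using s'(1,2) t(2) by (auto simp: Z'_def)
  qed
qed simp

lemma word_val_series_eval:
  fixes s :: "'a::idom fps fps"
  assumes "tid s" "\<And>x. x \<in> set es \<Longrightarrow> tid (snd x)" "tid g" "y \<in> points"
  shows "series_eval (word_val series_mon s (lift_series g) (map (apsnd lift_series) es)) y =
    g oo fold (series_step s) (rev es) y"
proof -
  let ?w = "\<lambda>es. foldr (\<lambda>(e, g) x. s [^]\<^bsub>series_mon\<^esub> e \<otimes>\<^bsub>series_mon\<^esub> g \<otimes>\<^bsub>series_mon\<^esub> x)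
      (map (apsnd lift_series) es) \<one>\<^bsub>series_mon\<^esub>"
  have y: "y $ 0 = 0" using assms(4) by (simp add: points_def)
  have pw: "tid (s [^]\<^bsub>series_mon\<^esub> e)" for e :: int using series.int_pow_closed[OF assms(1)] .
  have "tid (?w es) \<and> series_eval (?w es) y = foldr (series_step s) es y"
    using assms(2)
  proof (induction es)
    case Nil
    then show ?case using y by (simp add: tid_iff)
  next
    case (Cons x es)
    obtain e g where x: "x = (e, g)" by fastforce
    have g: "tid (lift_series g)" using Cons.prems[of x] x by (simp add: tid_lift)
    have IH: "tid (?w es)" "series_eval (?w es) y = foldr (series_step s) es y" using Cons by simp_all
    have w: "?w (x # es) = (s [^]\<^bsub>series_mon\<^esub> e oo lift_series g) oo ?w es" by (simp add: x)
    define a where "a = s [^]\<^bsub>series_mon\<^esub> e oo lift_series g"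
    define W where "W = ?w es"
    have a: "tid a" unfolding a_def using tid_compose pw g by blast
    have W: "tid W" "series_eval W y = foldr (series_step s) es y" using IH by (simp_all add: W_def)
    have "series_eval (a oo W) y = series_eval a (series_eval W y)"
      using W y by (simp add: series_eval_compose tid_iff)
    also have "\<dots> = series_eval (s [^]\<^bsub>series_mon\<^esub> e) (g oo series_eval W y)"
      using W(1) g y by (simp add: a_def series_eval_compose series_eval_nth_0 tid_iff series_eval_lift)
    finally show ?case
      unfolding w W_def[symmetric] a_def[symmetric] using tid_compose[OF a W(1)] W(2)
      by (simp add: x series_step_def)
  qed
  then show ?thesis
    using y by (simp add: word_val_def foldr_conv_fold series_eval_compose tid_iff series_eval_lift)
qed

text \<open>A word that moves one point is not the identity. The letter s has its coefficients in a
  ring of series over the coefficients of the g's, which is the room needed to choose its values one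
  after another.\<close>

theorem no_mixed_identity:
  fixes es :: "(int \<times> 'a::{idom,ring_char_0} fps) list"
  assumes "es \<noteq> []" "alternating es" "\<And>x. x \<in> set es \<Longrightarrow> tid (snd x)" "tid g"
    and "\<And>x. x \<in> set (butlast es) \<Longrightarrow> snd x \<noteq> fps_X"
  shows "\<exists>s. tid s \<and> word_val series_mon s (lift_series g) (map (apsnd lift_series) es) \<noteq> fps_X"
proof -
  define y :: "'a fps" where "y = fps_X"
  have y: "y \<in> points" by (simp add: y_def points_def)
  \<comment> \<open>The walk must miss the one endpoint that the remaining leading factor g would
    take back to y.\<close>
  have "\<exists>s'. tid s' \<and> (\<forall>z\<in>{}. series_eval s' z = series_eval fps_X z) \<and>
      fold (series_step s') (rev es) y \<notin> {comp_inv g oo y}"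
  proof (rule walk_avoids)
    show "successively (\<lambda>x y. fst y = - fst x) (rev es)"
      unfolding successively_rev
      by (rule successively_mono[of "\<lambda>x y. fst y = - fst x"])
        (use assms(2) in \<open>auto simp: alternating_def\<close>)
    show "snd x \<noteq> fps_X" if "x \<in> set (tl (rev es))" for x
      using that assms(5) by (metis butlast_rev rev_rev_ident set_rev)
  qed (use assms y in \<open>auto simp: alternating_def tid_iff\<close>)
  then obtain s where s: "tid s" "fold (series_step s) (rev es) y \<noteq> comp_inv g oo y" by blast
  have "word_val series_mon s (lift_series g) (map (apsnd lift_series) es) \<noteq> fps_X"
  proof
    assume "word_val series_mon s (lift_series g) (map (apsnd lift_series) es) = fps_X"
    then have "g oo fold (series_step s) (rev es) y = y"
      using word_val_series_eval[where es = es, OF s(1) _ assms(4) y] assms(3) y by (simp add: points_def)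
    moreover have "fold (series_step s) (rev es) y $ 0 = 0"
    proof -
      have "fold (series_step s) xs z $ 0 = 0" if "z $ 0 = 0" "set xs \<subseteq> set es" for xs z
        using that
      proof (induction xs arbitrary: z)
        case (Cons x xs)
        have "series_step s x z $ 0 = 0"
          using series.int_pow_closed[OF s(1)] by (cases x) (simp add: series_step_def series_eval_nth_0 tid_iff)
        then show ?case using Cons by simp
      qed simp
      then show ?thesis using y by (simp add: points_def)
    qed
    ultimately have "comp_inv g oo y = fold (series_step s) (rev es) y"
      using comp_inv_left[OF assms(4)] assms(4) by (metis fps_X_fps_compose_startby0 fps_compose_assoc tid_iff)
    then show False using s(2) by simp
  qed
  then show ?thesis using s(1) by blast
qed

subsection \<open>Homomorphisms out of the constructed groups\<close>

definition word_eval :: "('b, 'm) monoid_scheme \<Rightarrow> ('x \<Rightarrow> 'b) \<Rightarrow> 'x word \<Rightarrow> 'b" where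
  "word_eval L \<eta> w = foldr (\<lambda>(x, b) y. (if b then \<eta> x else inv\<^bsub>L\<^esub> \<eta> x) \<otimes>\<^bsub>L\<^esub> y) w \<one>\<^bsub>L\<^esub>"

lemma word_eval_simps [simp]:
  "word_eval L \<eta> [] = \<one>\<^bsub>L\<^esub>"
  "word_eval L \<eta> ((x, b) # w) = (if b then \<eta> x else inv\<^bsub>L\<^esub> \<eta> x) \<otimes>\<^bsub>L\<^esub> word_eval L \<eta> w"
  by (simp_all add: word_eval_def)

context group
begin

lemma word_eval_closed:
  "\<eta> \<in> X \<rightarrow> carrier G \<Longrightarrow> w \<in> words X \<Longrightarrow> word_eval G \<eta> w \<in> carrier G"
  by (induction w) (auto simp: Pi_iff)

lemma word_eval_append:
  "\<eta> \<in> X \<rightarrow> carrier G \<Longrightarrow> v \<in> words X \<Longrightarrow> w \<in> words X \<Longrightarrow>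
    word_eval G \<eta> (v @ w) = word_eval G \<eta> v \<otimes> word_eval G \<eta> w"
proof (induction v)
  case (Cons y v)
  then show ?case by (cases y) (auto simp: word_eval_closed m_assoc Pi_iff)
qed (simp add: word_eval_closed)

lemma word_eval_rel:
  assumes \<eta>: "\<eta> \<in> X \<rightarrow> carrier G" and R: "\<And>w. w \<in> R \<Longrightarrow> w \<in> words X \<Longrightarrow> word_eval G \<eta> w = \<one>"
    and "(v, w) \<in> presented_rel X R"
  shows "word_eval G \<eta> v = word_eval G \<eta> w"
  using assms(3)
proof (induction rule: presented_rel.induct)
  case (cancel u x b v)
  then have "\<eta> x \<in> carrier G" "word_eval G \<eta> u \<in> carrier G" "word_eval G \<eta> v \<in> carrier G"
    using \<eta> by (auto simp: word_eval_closed)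
  then show ?case
    using cancel by (cases b) (simp_all add: word_eval_append[OF \<eta>] flip: m_assoc)
next
  case (relator w u v)
  then show ?case
    using R[of w] by (simp add: word_eval_append[OF \<eta>] word_eval_closed[OF \<eta>])
qed auto

text \<open>Von Dyck's theorem. A class is evaluated at a chosen representative, and
  \<open>word_eval_rel\<close> makes the choice immaterial.\<close>

lemma presented_group_lift:
  assumes \<eta>: "\<eta> \<in> X \<rightarrow> carrier G" and R: "\<And>w. w \<in> R \<Longrightarrow> w \<in> words X \<Longrightarrow> word_eval G \<eta> w = \<one>"
  shows "\<exists>\<Psi>\<in>hom (presented_group X R) G. \<forall>w\<in>words X. \<Psi> (word_class X R w) = word_eval G \<eta> w"
proof -
  define \<Psi> where "\<Psi> A = word_eval G \<eta> (SOME w. w \<in> A)" for A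
  have cl: "\<Psi> (word_class X R w) = word_eval G \<eta> w" if "w \<in> words X" for w
  proof -
    have "w \<in> word_class X R w" using that by (simp add: word_class_def presented_rel.refl)
    then have "(SOME v. v \<in> word_class X R w) \<in> word_class X R w" by (rule someI)
    then show ?thesis
      unfolding \<Psi>_def using word_eval_rel[OF \<eta> R] by (metis ImageE word_class_def singletonD)
  qed
  have "\<Psi> \<in> hom (presented_group X R) G"
  proof (rule homI)
    fix A assume "A \<in> carrier (presented_group X R)"
    then show "\<Psi> A \<in> carrier G" using word_eval_closed[OF \<eta>] by (auto simp: presented_carrier cl)
    fix B assume "B \<in> carrier (presented_group X R)"
    then show "\<Psi> (A \<otimes>\<^bsub>presented_group X R\<^esub> B) = \<Psi> A \<otimes> \<Psi> B"
      using \<open>A \<in> carrier (presented_group X R)\<close>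
      by (auto simp: presented_carrier presented_mult cl word_eval_append[OF \<eta>])
  qed
  then show ?thesis using cl by blast
qed

end

text \<open>The multiplication table says how positive letters multiply. The second claim turns a
  formal inverse letter into the positive letter of the inverse element, so inductions over words
  may treat letters from a group as group elements.\<close>

lemma presented_gen_hom:
  assumes f: "f ` carrier A \<subseteq> X" and A: "group A" and R: "mult_table A f \<subseteq> R"
  shows "(\<lambda>a. word_class X R [(f a, True)]) \<in> hom A (presented_group X R)"
    and "a \<in> carrier A \<Longrightarrow> word_class X R [(f a, False)] = word_class X R [(f (inv\<^bsub>A\<^esub> a), True)]"
proof -
  interpret A: group A by (rule A)
  interpret P: group "presented_group X R" by (rule group_presented_group)
  have eq: "word_class X R [(f a, True), (f b, True)] = word_class X R [(f (a \<otimes>\<^bsub>A\<^esub> b), True)]"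
    if "a \<in> carrier A" "b \<in> carrier A" for a b
  proof -
    have X: "f a \<in> X" "f b \<in> X" "f (a \<otimes>\<^bsub>A\<^esub> b) \<in> X" using that f by auto
    let ?r = "[(f a, True), (f b, True), (f (a \<otimes>\<^bsub>A\<^esub> b), False)]"
    have "?r \<in> R" using that R by (auto simp: mult_table_def)
    from presented_rel.relator[OF this, of "[]" "[(f (a \<otimes>\<^bsub>A\<^esub> b), True)]" X]
    have 1: "(?r @ [(f (a \<otimes>\<^bsub>A\<^esub> b), True)], [(f (a \<otimes>\<^bsub>A\<^esub> b), True)]) \<in> presented_rel X R"
      using X by simp
    have 2: "(?r @ [(f (a \<otimes>\<^bsub>A\<^esub> b), True)], [(f a, True), (f b, True)]) \<in> presented_rel X R"
      using presented_rel.cancel[of "[(f a, True), (f b, True)]" "f (a \<otimes>\<^bsub>A\<^esub> b)" False "[]" X R] X by simp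
    show ?thesis unfolding word_class_def
      using equiv_class_eq[OF equiv_presented_rel 1] equiv_class_eq[OF equiv_presented_rel 2] by simp
  qed
  show hom: "(\<lambda>a. word_class X R [(f a, True)]) \<in> hom A (presented_group X R)"
  proof (rule homI)
    fix a assume a: "a \<in> carrier A"
    then show "word_class X R [(f a, True)] \<in> carrier (presented_group X R)"
      using f by (auto simp: presented_carrier)
    fix b assume b: "b \<in> carrier A"
    then show "word_class X R [(f (a \<otimes>\<^bsub>A\<^esub> b), True)] =
        word_class X R [(f a, True)] \<otimes>\<^bsub>presented_group X R\<^esub> word_class X R [(f b, True)]"
      using a f eq by (simp add: image_subset_iff presented_mult)
  qed
  assume a: "a \<in> carrier A"
  have "word_class X R [(f a, False), (f a, True)] = word_class X R []"
    unfolding word_class_def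
    using presented_rel.cancel[of "[]" "f a" False "[]" X R] a f
    by (intro equiv_class_eq[OF equiv_presented_rel]) (simp add: image_subset_iff)
  then have "word_class X R [(f a, False)] \<otimes>\<^bsub>presented_group X R\<^esub> word_class X R [(f a, True)] = \<one>\<^bsub>presented_group X R\<^esub>"
    using a f by (simp add: presented_mult image_subset_iff) (simp add: presented_group_def)
  then have "word_class X R [(f a, False)] = inv\<^bsub>presented_group X R\<^esub> word_class X R [(f a, True)]"
    using a f by (intro P.inv_equality[symmetric]) (auto simp: presented_carrier)
  also have "\<dots> = word_class X R [(f (inv\<^bsub>A\<^esub> a), True)]"
  proof -
    interpret group_hom A "presented_group X R" "\<lambda>a. word_class X R [(f a, True)]"
      using hom by unfold_locales
    show ?thesis using hom_inv[OF a] by simp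
  qed
  finally show "word_class X R [(f a, False)] = word_class X R [(f (inv\<^bsub>A\<^esub> a), True)]" .
qed

text \<open>Words grow by one letter on the left; W collects what is known about the classes of
  letters.\<close>

lemma presented_group_induct:
  assumes "\<And>x b. x \<in> X \<Longrightarrow> word_class X R [(x, b)] \<in> W"
    and "\<one>\<^bsub>presented_group X R\<^esub> \<in> S"
    and "\<And>a y. a \<in> W \<Longrightarrow> a \<in> carrier (presented_group X R) \<Longrightarrow> y \<in> carrier (presented_group X R) \<Longrightarrow> y \<in> S \<Longrightarrow>
      a \<otimes>\<^bsub>presented_group X R\<^esub> y \<in> S"
  shows "carrier (presented_group X R) \<subseteq> S"
proof -
  have "word_class X R w \<in> S" if "w \<in> words X" for w
    using that
  proof (induction w)
    case Nil
    then show ?case using assms(2) by (simp add: presented_group_def)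
  next
    case (Cons y w)
    obtain x b where y: "y = (x, b)" by fastforce
    have x: "x \<in> X" "w \<in> words X" using Cons.prems y by auto
    have "word_class X R [(x, b)] \<otimes>\<^bsub>presented_group X R\<^esub> word_class X R w \<in> S"
      using Cons x by (intro assms(3) assms(1)) (auto simp: presented_carrier)
    then show ?case using x y by (simp add: presented_mult)
  qed
  then show ?thesis by (auto simp: presented_carrier)
qed

definition group_ext :: "'a monoid \<Rightarrow> 'a monoid \<Rightarrow> bool" where
  "group_ext G H \<longleftrightarrow> group G \<and> group H \<and> subgroup (carrier G) H \<and>
     (\<forall>x\<in>carrier G. \<forall>y\<in>carrier G. x \<otimes>\<^bsub>G\<^esub> y = x \<otimes>\<^bsub>H\<^esub> y)"

lemma group_extD:
  assumes "group_ext G H"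
  shows "group G" "group H" "carrier G \<subseteq> carrier H" "\<one>\<^bsub>H\<^esub> = \<one>\<^bsub>G\<^esub>"
    and "x \<in> carrier G \<Longrightarrow> y \<in> carrier G \<Longrightarrow> x \<otimes>\<^bsub>H\<^esub> y = x \<otimes>\<^bsub>G\<^esub> y"
    and "x \<in> carrier G \<Longrightarrow> inv\<^bsub>H\<^esub> x = inv\<^bsub>G\<^esub> x"
    and "(\<lambda>x. x) \<in> hom G H"
proof -
  interpret G: group G using assms by (simp add: group_ext_def)
  interpret H: group H using assms by (simp add: group_ext_def)
  show "group G" "group H" by unfold_locales
  show sub: "carrier G \<subseteq> carrier H" using assms by (auto simp: group_ext_def dest: subgroup.subset)
  show m: "x \<in> carrier G \<Longrightarrow> y \<in> carrier G \<Longrightarrow> x \<otimes>\<^bsub>H\<^esub> y = x \<otimes>\<^bsub>G\<^esub> y" for x y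
    using assms by (simp add: group_ext_def)
  show hom: "(\<lambda>x. x) \<in> hom G H" using sub m by (auto simp: hom_def)
  then interpret group_hom G H "\<lambda>x. x" by unfold_locales
  show "\<one>\<^bsub>H\<^esub> = \<one>\<^bsub>G\<^esub>" using hom_one by simp
  show "x \<in> carrier G \<Longrightarrow> inv\<^bsub>H\<^esub> x = inv\<^bsub>G\<^esub> x" using hom_inv by simp
qed

text \<open>The pair (g, es) stands for a reduced word: an inner coefficient in C would commute with
  s and let two powers of s meet. The first and the last coefficient are free.\<close>

definition step_code :: "'a monoid \<Rightarrow> 'a set \<Rightarrow> 'a \<times> (int \<times> 'a) list \<Rightarrow> bool" where
  "step_code G C = (\<lambda>(g, es). g \<in> carrier G \<and> (\<forall>x\<in>set es. fst x \<noteq> 0 \<and> snd x \<in> carrier G) \<and>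
     (\<forall>x\<in>set (butlast es). snd x \<notin> C))"

text \<open>\<open>code x\<close> describes how a homomorphism on \<open>H\<close> acts on \<open>x\<close> when it is given by a homomorphism
  \<open>\<phi>\<close> on \<open>G\<close> and an element \<open>s\<close> that commutes with the image of \<open>C\<close>: in an extension of a centralizer
  the stable letter goes to \<open>s\<close>, in an amalgam the second factor is mapped by \<open>f \<mapsto> s \<phi>(f) s\<^sup>-\<^sup>1\<close>.\<close>

definition lifts_to :: "'a monoid \<Rightarrow> 'a monoid \<Rightarrow> 'a set \<Rightarrow> ('a \<Rightarrow> 'a \<times> (int \<times> 'a) list) \<Rightarrow> 'b monoid \<Rightarrow> bool" where
  "lifts_to G H C code L \<longleftrightarrow>
     (\<forall>\<phi>\<in>hom G L. \<forall>s\<in>carrier L. (\<forall>c\<in>C. \<phi> c \<otimes>\<^bsub>L\<^esub> s = s \<otimes>\<^bsub>L\<^esub> \<phi> c) \<longrightarrow>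
       (\<exists>\<Psi>\<in>hom H L. \<forall>x\<in>carrier H.
          \<Psi> x = word_val L s (\<phi> (fst (code x))) (map (apsnd \<phi>) (snd (code x)))))"

lemma (in group) int_pow_commute:
  assumes "x \<otimes> y = y \<otimes> x" "x \<in> carrier G" "y \<in> carrier G"
  shows "x [^] (e::int) \<otimes> y = y \<otimes> x [^] e"
proof -
  have nat: "x [^] n \<otimes> y = y \<otimes> x [^] n" for n :: nat
    using group_commutes_pow[OF assms] .
  have inv: "inv (x [^] n) \<otimes> y = y \<otimes> inv (x [^] n)" for n :: nat
  proof -
    let ?p = "x [^] n"
    have "(?p \<otimes> (y \<otimes> inv ?p)) = y" 
      using assms(2,3) by (simp add: m_assoc[symmetric] nat) (simp add: m_assoc)
    then have "y \<otimes> inv ?p = inv ?p \<otimes> y"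
      using assms(2,3) inv_solve_left[of "y \<otimes> inv ?p" ?p y] by simp
    then show ?thesis by simp
  qed
  show ?thesis
    unfolding int_pow_def2 by (cases "e < 0") (simp_all only: if_True if_False nat inv)
qed

section \<open>Extensions of a centralizer\<close>

definition centralizer_data :: "'a monoid \<Rightarrow> 'a monoid \<Rightarrow> 'a \<Rightarrow> ('a option word set \<Rightarrow> 'a) \<Rightarrow> bool" where
  "centralizer_data G H u h \<longleftrightarrow> group_ext G H \<and> u \<in> carrier G \<and> u \<noteq> \<one>\<^bsub>G\<^esub> \<and>
     h \<in> iso (centralizer_ext G u) H \<and> (\<forall>g\<in>carrier G. h (centralizer_ext_base G u g) = g)"

definition stable_letter :: "'a monoid \<Rightarrow> 'a \<Rightarrow> ('a option word set \<Rightarrow> 'a) \<Rightarrow> 'a" where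
  "stable_letter G u h =
     h (word_class (insert None (Some ` carrier G)) (centralizer_ext_rels G u) [(None, True)])"

lemma iso_transport:
  assumes "group E" "group H" "h \<in> iso E H" "\<Psi> \<in> hom E L"
  shows "\<exists>\<Psi>'\<in>hom H L. \<forall>x\<in>carrier E. \<Psi>' (h x) = \<Psi> x"
proof -
  have "inv_into (carrier E) h \<in> hom H E"
    using group.iso_set_sym[OF assms(1,3)] by (simp add: iso_def)
  then have "\<Psi> \<circ> inv_into (carrier E) h \<in> hom H L"
    using assms(4) by (rule hom_compose)
  moreover have "inj_on h (carrier E)" using assms(3) by (simp add: iso_def bij_betw_def)
  ultimately show ?thesis by (intro bexI[of _ "\<Psi> \<circ> inv_into (carrier E) h"]) auto
qed

context
  fixes G H :: "'a monoid" and u :: 'a and h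
  assumes data: "centralizer_data G H u h"
begin

private abbreviation (input) "X \<equiv> insert None (Some ` carrier G)"
private abbreviation (input) "R \<equiv> centralizer_ext_rels G u"
private abbreviation (input) "t \<equiv> stable_letter G u h"
private abbreviation (input) "C \<equiv> centralizer G u"

private lemma ext: "group_ext G H" and iso: "h \<in> iso (presented_group X R) H"
  and base: "g \<in> carrier G \<Longrightarrow> h (word_class X R [(Some g, True)]) = g"
  using data by (simp_all add: centralizer_data_def centralizer_ext_def centralizer_ext_base_def)

interpretation G: group G using group_extD(1)[OF ext] .
interpretation H: group H using group_extD(2)[OF ext] .
interpretation P: group "presented_group X R" by (rule group_presented_group)
interpretation h: group_hom "presented_group X R" H h
  using iso by unfold_locales (simp add: iso_def)

lemma stable_letter_closed: "t \<in> carrier H"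
  unfolding stable_letter_def by (rule h.hom_closed) (auto simp: presented_carrier)

private lemma t_inv: "inv\<^bsub>H\<^esub> t = h (word_class X R [(None, False)])"
proof -
  have "word_class X R [(None, False), (None, True)] = word_class X R []"
    unfolding word_class_def
    using presented_rel.cancel[of "[]" None False "[]" X R]
    by (intro equiv_class_eq[OF equiv_presented_rel]) simp
  then have "word_class X R [(None, False)] \<otimes>\<^bsub>presented_group X R\<^esub> word_class X R [(None, True)] = \<one>\<^bsub>presented_group X R\<^esub>"
    by (simp add: presented_mult) (simp add: presented_group_def)
  then have "inv\<^bsub>presented_group X R\<^esub> word_class X R [(None, True)] = word_class X R [(None, False)]"
    by (intro P.inv_equality) (auto simp: presented_carrier)
  then show ?thesis
    unfolding stable_letter_def by (subst h.hom_inv[symmetric]) (auto simp: presented_carrier)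
qed

text \<open>Universal property of the presentation, carried over to H by \<open>h\<close>.\<close>

lemma centralizer_ext_lift:
  assumes L: "group L" and \<phi>: "\<phi> \<in> hom G L" and s: "s \<in> carrier L"
    and comm: "\<And>c. c \<in> C \<Longrightarrow> \<phi> c \<otimes>\<^bsub>L\<^esub> s = s \<otimes>\<^bsub>L\<^esub> \<phi> c"
  shows "\<exists>\<Psi>\<in>hom H L. (\<forall>g\<in>carrier G. \<Psi> g = \<phi> g) \<and> \<Psi> t = s"
proof -
  interpret L: group L by (rule L)
  interpret \<phi>: group_hom G L \<phi> using \<phi> by unfold_locales
  define \<eta> where "\<eta> x = (case x of None \<Rightarrow> s | Some g \<Rightarrow> \<phi> g)" for x
  have \<eta>: "\<eta> \<in> X \<rightarrow> carrier L" using s by (auto simp: \<eta>_def)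
  have "word_eval L \<eta> w = \<one>\<^bsub>L\<^esub>" if "w \<in> R" for w
    using that unfolding centralizer_ext_rels_def
  proof (elim UnE)
    assume "w \<in> mult_table G Some"
    then show ?thesis
      by (auto simp: mult_table_def \<eta>_def L.inv_mult_group L.m_assoc[symmetric])
  next
    assume "w \<in> {[(Some c, True), (None, True), (Some c, False), (None, False)] | c. c \<in> C}"
    then obtain c where c: "c \<in> C" and w: "w = [(Some c, True), (None, True), (Some c, False), (None, False)]"
      by blast
    have "\<phi> c \<in> carrier L" using c by (simp add: centralizer_def)
    then have "word_eval L \<eta> w = (\<phi> c \<otimes>\<^bsub>L\<^esub> s) \<otimes>\<^bsub>L\<^esub> inv\<^bsub>L\<^esub> (s \<otimes>\<^bsub>L\<^esub> \<phi> c)"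
      using s by (simp add: w \<eta>_def L.m_assoc L.inv_mult_group)
    then show ?thesis using comm[OF c] s \<open>\<phi> c \<in> carrier L\<close> by simp
  qed
  from L.presented_group_lift[OF \<eta> this]
  obtain \<Psi> where \<Psi>: "\<Psi> \<in> hom (presented_group X R) L"
    "\<And>w. w \<in> words X \<Longrightarrow> \<Psi> (word_class X R w) = word_eval L \<eta> w" by blast
  obtain \<Psi>' where \<Psi>': "\<Psi>' \<in> hom H L" "\<And>x. x \<in> carrier (presented_group X R) \<Longrightarrow> \<Psi>' (h x) = \<Psi> x"
    using iso_transport[OF P.group_axioms H.group_axioms iso \<Psi>(1)] by blast
  have "\<Psi>' g = \<phi> g" if "g \<in> carrier G" for g
    using \<Psi>'(2)[of "word_class X R [(Some g, True)]"] \<Psi>(2)[of "[(Some g, True)]"] base[of g] that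
    by (auto simp: presented_carrier \<eta>_def)
  moreover have "\<Psi>' t = s"
    using \<Psi>'(2)[of "word_class X R [(None, True)]"] \<Psi>(2)[of "[(None, True)]"] s
    by (auto simp: presented_carrier \<eta>_def stable_letter_def)
  ultimately show ?thesis using \<Psi>'(1) by blast
qed

private lemma t_commutes: "c \<in> C \<Longrightarrow> c \<otimes>\<^bsub>H\<^esub> t = t \<otimes>\<^bsub>H\<^esub> c"
proof -
  assume c: "c \<in> C"
  then have cG: "c \<in> carrier G" by (simp add: centralizer_def)
  have iota: "(\<lambda>g. word_class X R [(Some g, True)]) \<in> hom G (presented_group X R)"
    and inv: "word_class X R [(Some c, False)] = word_class X R [(Some (inv\<^bsub>G\<^esub> c), True)]"
    using presented_gen_hom[of Some G X R] G.group_axioms cG by (auto simp: centralizer_ext_rels_def)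
  have "[(Some c, True), (None, True), (Some c, False), (None, False)] \<in> R"
    using c by (auto simp: centralizer_ext_rels_def)
  from presented_rel.relator[OF this, of "[]" "[]" X]
  have "word_class X R [(Some c, True), (None, True), (Some c, False), (None, False)] = word_class X R []"
    using cG unfolding word_class_def by (intro equiv_class_eq[OF equiv_presented_rel]) simp
  moreover have "word_class X R [(Some c, True), (None, True), (Some c, False), (None, False)] =
      word_class X R [(Some c, True)] \<otimes>\<^bsub>presented_group X R\<^esub> (word_class X R [(None, True)] \<otimes>\<^bsub>presented_group X R\<^esub>
       (word_class X R [(Some (inv\<^bsub>G\<^esub> c), True)] \<otimes>\<^bsub>presented_group X R\<^esub> word_class X R [(None, False)]))"
    unfolding inv[symmetric] using cG by (simp add: presented_mult)
  moreover have "word_class X R [] = \<one>\<^bsub>presented_group X R\<^esub>" by (simp add: presented_group_def)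
  ultimately have "h (word_class X R [(Some c, True)] \<otimes>\<^bsub>presented_group X R\<^esub> (word_class X R [(None, True)] \<otimes>\<^bsub>presented_group X R\<^esub>
       (word_class X R [(Some (inv\<^bsub>G\<^esub> c), True)] \<otimes>\<^bsub>presented_group X R\<^esub> word_class X R [(None, False)]))) = \<one>\<^bsub>H\<^esub>"
    by (simp only: h.hom_one)
  moreover have "word_class X R [(Some g, True)] \<in> carrier (presented_group X R)" if "g \<in> carrier G" for g
    using that by (auto simp: presented_carrier)
  moreover have "word_class X R [(None, b)] \<in> carrier (presented_group X R)" for b
    by (auto simp: presented_carrier)
  ultimately have "h (word_class X R [(Some c, True)]) \<otimes>\<^bsub>H\<^esub> (t \<otimes>\<^bsub>H\<^esub> (h (word_class X R [(Some (inv\<^bsub>G\<^esub> c), True)]) \<otimes>\<^bsub>H\<^esub> inv\<^bsub>H\<^esub> t)) = \<one>\<^bsub>H\<^esub>"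
    unfolding t_inv unfolding stable_letter_def using cG by (simp only: h.hom_mult P.m_closed G.inv_closed)
  then have "c \<otimes>\<^bsub>H\<^esub> (t \<otimes>\<^bsub>H\<^esub> (inv\<^bsub>H\<^esub> c \<otimes>\<^bsub>H\<^esub> inv\<^bsub>H\<^esub> t)) = \<one>\<^bsub>H\<^esub>"
    using cG by (simp add: base group_extD(6)[OF ext])
  then have "(c \<otimes>\<^bsub>H\<^esub> t) \<otimes>\<^bsub>H\<^esub> inv\<^bsub>H\<^esub> (t \<otimes>\<^bsub>H\<^esub> c) = \<one>\<^bsub>H\<^esub>"
    using cG group_extD(3)[OF ext] stable_letter_closed by (simp add: subset_iff H.inv_mult_group H.m_assoc)
  then show ?thesis
    using cG group_extD(3)[OF ext] stable_letter_closed
      H.inv_solve_right[of "\<one>\<^bsub>H\<^esub>" "c \<otimes>\<^bsub>H\<^esub> t" "t \<otimes>\<^bsub>H\<^esub> c"] by (simp add: subset_iff)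
qed

private lemma centralizer_ext_induct:
  assumes "\<one>\<^bsub>H\<^esub> \<in> S"
    and "\<And>g y. g \<in> carrier G \<Longrightarrow> y \<in> carrier H \<Longrightarrow> y \<in> S \<Longrightarrow> g \<otimes>\<^bsub>H\<^esub> y \<in> S"
    and "\<And>y. y \<in> carrier H \<Longrightarrow> y \<in> S \<Longrightarrow> t \<otimes>\<^bsub>H\<^esub> y \<in> S"
    and "\<And>y. y \<in> carrier H \<Longrightarrow> y \<in> S \<Longrightarrow> inv\<^bsub>H\<^esub> t \<otimes>\<^bsub>H\<^esub> y \<in> S"
  shows "carrier H \<subseteq> S"
proof -
  define W where "W = {a. h a \<in> carrier G \<or> h a = t \<or> h a = inv\<^bsub>H\<^esub> t}"
  have sub: "carrier (presented_group X R) \<subseteq> {x. h x \<in> S}"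
  proof (rule presented_group_induct[where W = W])
    fix x b assume "x \<in> X"
    then show "word_class X R [(x, b)] \<in> W"
    proof
      assume "x = None"
      then show ?thesis
        by (cases b) (simp_all add: W_def t_inv, simp add: stable_letter_def)
    next
      assume "x \<in> Some ` carrier G"
      then obtain g where g: "x = Some g" "g \<in> carrier G" by blast
      have "word_class X R [(Some g, False)] = word_class X R [(Some (inv\<^bsub>G\<^esub> g), True)]"
        using presented_gen_hom(2)[of Some G X R g] G.group_axioms g by (auto simp: centralizer_ext_rels_def)
      then show ?thesis using g by (cases b) (simp_all add: W_def base)
    qed
  qed (use assms in \<open>auto simp: W_def\<close>)
  have "h ` carrier (presented_group X R) \<subseteq> S"
    using subsetD[OF sub] by (intro image_subsetI) simp
  then show ?thesis using iso by (simp add: iso_def bij_betw_def)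
qed

text \<open>Reduced words are closed under left multiplication by elements of G and by nonzero
  powers of t, and these generate H.\<close>

lemma centralizer_ext_code:
  assumes "x \<in> carrier H"
  shows "\<exists>g es. step_code G C (g, es) \<and> x = word_val H t g es"
proof -
  let ?S = "{x. \<exists>g es. step_code G C (g, es) \<and> x = word_val H t g es}"
  let ?f = "foldr (\<lambda>(e::int, g) x. t [^]\<^bsub>H\<^esub> e \<otimes>\<^bsub>H\<^esub> g \<otimes>\<^bsub>H\<^esub> x)"
  note GH = subsetD[OF group_extD(3)[OF ext]]
  have closed: "?f es \<one>\<^bsub>H\<^esub> \<in> carrier H" if "\<forall>x\<in>set es. snd x \<in> carrier G" for es
    using that by (induction es) (auto simp: GH stable_letter_closed H.int_pow_closed split: prod.splits)
  have tpow: "t [^]\<^bsub>H\<^esub> e \<otimes>\<^bsub>H\<^esub> y \<in> ?S" if y: "y \<in> ?S" and e: "e \<noteq> 0" for e :: int and y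
  proof -
    obtain g es where c: "step_code G C (g, es)" and y: "y = word_val H t g es" using y by blast
    have g: "g \<in> carrier G" "\<forall>x\<in>set es. snd x \<in> carrier G" using c by (auto simp: step_code_def)
    show ?thesis
    proof (cases "es = [] \<or> g \<notin> C")
      case True
      have "step_code G C (\<one>\<^bsub>G\<^esub>, (e, g) # es)"
        using c e True by (auto simp: step_code_def)
      moreover have "t [^]\<^bsub>H\<^esub> e \<otimes>\<^bsub>H\<^esub> y = word_val H t \<one>\<^bsub>G\<^esub> ((e, g) # es)"
        using g closed[of es] by (simp add: y word_val_def GH stable_letter_closed H.m_assoc flip: group_extD(4)[OF ext])
      ultimately show ?thesis by blast
    next
      case False
      \<comment> \<open>Here g lies in C, so it passes to the left of t^e, and t^e merges with the
        first power of the word.\<close>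
      then obtain e1 g1 es' where es: "es = (e1, g1) # es'" by (metis list.exhaust surj_pair)
      have g1: "g1 \<in> carrier G" and cl: "?f es' \<one>\<^bsub>H\<^esub> \<in> carrier H" using g(2) closed[of es'] es by auto
      have "t [^]\<^bsub>H\<^esub> e \<otimes>\<^bsub>H\<^esub> g = g \<otimes>\<^bsub>H\<^esub> t [^]\<^bsub>H\<^esub> e"
      proof -
        have "t \<otimes>\<^bsub>H\<^esub> g = g \<otimes>\<^bsub>H\<^esub> t" using t_commutes False by simp
        then show ?thesis using H.int_pow_commute stable_letter_closed GH[OF g(1)] by blast
      qed
      then have "t [^]\<^bsub>H\<^esub> e \<otimes>\<^bsub>H\<^esub> y = g \<otimes>\<^bsub>H\<^esub> (t [^]\<^bsub>H\<^esub> (e + e1) \<otimes>\<^bsub>H\<^esub> (g1 \<otimes>\<^bsub>H\<^esub> ?f es' \<one>\<^bsub>H\<^esub>))"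
        using g g1 cl by (simp add: y es word_val_def GH stable_letter_closed H.int_pow_mult flip: H.m_assoc)
      moreover have "\<dots> \<in> ?S"
      proof (cases "e + e1 = 0")
        \<comment> \<open>The powers cancel; g1 joins the leading coefficient, which reducedness
          leaves free.\<close>
        case True
        have "step_code G C (g \<otimes>\<^bsub>G\<^esub> g1, es')"
          using c g1 by (auto simp: step_code_def es split: if_splits)
        moreover have "g \<otimes>\<^bsub>H\<^esub> (t [^]\<^bsub>H\<^esub> (e + e1) \<otimes>\<^bsub>H\<^esub> (g1 \<otimes>\<^bsub>H\<^esub> ?f es' \<one>\<^bsub>H\<^esub>)) = word_val H t (g \<otimes>\<^bsub>G\<^esub> g1) es'"
          using g g1 cl True by (simp add: word_val_def GH H.m_assoc flip: group_extD(5)[OF ext])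
        ultimately show ?thesis by blast
      next
        case False
        have "step_code G C (g, (e + e1, g1) # es')"
          using c False by (auto simp: step_code_def es split: if_splits)
        moreover have "g \<otimes>\<^bsub>H\<^esub> (t [^]\<^bsub>H\<^esub> (e + e1) \<otimes>\<^bsub>H\<^esub> (g1 \<otimes>\<^bsub>H\<^esub> ?f es' \<one>\<^bsub>H\<^esub>)) = word_val H t g ((e + e1, g1) # es')"
          using g g1 cl by (simp add: word_val_def GH stable_letter_closed H.m_assoc)
        ultimately show ?thesis by blast
      qed
      ultimately show ?thesis by simp
    qed
  qed
  have "carrier H \<subseteq> ?S"
  proof (rule centralizer_ext_induct)
    have "step_code G C (\<one>\<^bsub>G\<^esub>, [])" "\<one>\<^bsub>H\<^esub> = word_val H t \<one>\<^bsub>G\<^esub> []"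
      by (simp add: step_code_def) (simp add: word_val_def flip: group_extD(4)[OF ext])
    then show "\<one>\<^bsub>H\<^esub> \<in> ?S" by blast
  next
    fix a y assume a: "a \<in> carrier G" and "y \<in> ?S"
    then obtain g es where c: "step_code G C (g, es)" and y: "y = word_val H t g es" by blast
    have g: "g \<in> carrier G" "\<forall>x\<in>set es. snd x \<in> carrier G" using c by (auto simp: step_code_def)
    have "step_code G C (a \<otimes>\<^bsub>G\<^esub> g, es)" using c a by (auto simp: step_code_def)
    moreover have "a \<otimes>\<^bsub>H\<^esub> y = word_val H t (a \<otimes>\<^bsub>G\<^esub> g) es"
      using g a closed[of es] by (simp add: y word_val_def GH H.m_assoc flip: group_extD(5)[OF ext])
    ultimately show "a \<otimes>\<^bsub>H\<^esub> y \<in> ?S" by blast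
  next
    fix y assume "y \<in> ?S"
    then show "t \<otimes>\<^bsub>H\<^esub> y \<in> ?S" "inv\<^bsub>H\<^esub> t \<otimes>\<^bsub>H\<^esub> y \<in> ?S"
      using tpow[of y 1] tpow[of y "-1"] stable_letter_closed by (simp_all add: H.int_pow_neg)
  qed
  then show ?thesis using assms by blast
qed

end

section \<open>Amalgamated products\<close>

definition amalgam_data ::
  "'a monoid \<Rightarrow> 'a set \<Rightarrow> 'a set \<Rightarrow> 'a monoid \<Rightarrow> (('a + 'a) word set \<Rightarrow> 'a) \<Rightarrow> bool" where
  "amalgam_data G F C H h \<longleftrightarrow> group_ext G H \<and> subgroup F G \<and> subgroup C G \<and> C \<subseteq> F \<and>
     h \<in> iso (amalgam G (G\<lparr>carrier := F\<rparr>) C) H \<and>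
     (\<forall>g\<in>carrier G. h (amalgam_left G (G\<lparr>carrier := F\<rparr>) C g) = g)"

definition second_factor :: "'a monoid \<Rightarrow> 'a set \<Rightarrow> 'a set \<Rightarrow> (('a + 'a) word set \<Rightarrow> 'a) \<Rightarrow> 'a \<Rightarrow> 'a" where
  "second_factor G F C h f =
     h (word_class (carrier G <+> F) (amalgam_rels G (G\<lparr>carrier := F\<rparr>) C) [(Inr f, True)])"

definition pairs_val :: "'a monoid \<Rightarrow> ('a \<Rightarrow> 'a) \<Rightarrow> 'a \<Rightarrow> ('a \<times> 'a) list \<Rightarrow> 'a" where
  "pairs_val H k g ps = g \<otimes>\<^bsub>H\<^esub> foldr (\<lambda>(f, g) x. k f \<otimes>\<^bsub>H\<^esub> g \<otimes>\<^bsub>H\<^esub> x) ps \<one>\<^bsub>H\<^esub>"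

text \<open>Reduced words g k(f1) g1 k(f2) g2 ..., where k embeds the second copy of F: no factor
  k(f) collapses into G, and no inner coefficient lies in the second factor.\<close>

definition pairs_code :: "'a monoid \<Rightarrow> 'a set \<Rightarrow> 'a set \<Rightarrow> 'a \<Rightarrow> ('a \<times> 'a) list \<Rightarrow> bool" where
  "pairs_code G F C g ps \<longleftrightarrow> g \<in> carrier G \<and> (\<forall>x\<in>set ps. fst x \<in> F - C \<and> snd x \<in> carrier G) \<and>
     (\<forall>x\<in>set (butlast ps). snd x \<notin> C)"

context
  fixes G H :: "'a monoid" and F C :: "'a set" and h
  assumes data: "amalgam_data G F C H h"
begin

private abbreviation (input) "Y \<equiv> carrier G <+> F"
private abbreviation (input) "Q \<equiv> amalgam_rels G (G\<lparr>carrier := F\<rparr>) C"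
private abbreviation (input) "k \<equiv> second_factor G F C h"

private lemma amalgam_ext: "group_ext G H" and F: "subgroup F G" and C: "subgroup C G" and CF: "C \<subseteq> F"
  and amalgam_iso: "h \<in> iso (presented_group Y Q) H"
  and amalgam_base: "g \<in> carrier G \<Longrightarrow> h (word_class Y Q [(Inl g, True)]) = g"
  using data by (simp_all add: amalgam_data_def amalgam_def amalgam_left_def)

interpretation G: group G using group_extD(1)[OF amalgam_ext] .
interpretation H: group H using group_extD(2)[OF amalgam_ext] .
interpretation F: group "G\<lparr>carrier := F\<rparr>" using G.subgroup_imp_group[OF F] .
interpretation P: group "presented_group Y Q" by (rule group_presented_group)
interpretation h: group_hom "presented_group Y Q" H h
  using amalgam_iso by unfold_locales (simp add: iso_def)

private lemma Y_simps [simp]: "Inl g \<in> Y \<longleftrightarrow> g \<in> carrier G" "Inr f \<in> Y \<longleftrightarrow> f \<in> F"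
  by auto

private lemma FG: "f \<in> F \<Longrightarrow> f \<in> carrier G" "c \<in> C \<Longrightarrow> c \<in> carrier G"
  using subgroup.subset[OF F] CF by auto

text \<open>Universal property of the amalgam, carried over to H by \<open>h\<close>.\<close>

lemma amalgam_lift:
  assumes L: "group L" and \<phi>: "\<phi> \<in> hom G L" and \<psi>: "\<psi> \<in> hom (G\<lparr>carrier := F\<rparr>) L"
    and agree: "\<And>c. c \<in> C \<Longrightarrow> \<phi> c = \<psi> c"
  shows "\<exists>\<Psi>\<in>hom H L. (\<forall>g\<in>carrier G. \<Psi> g = \<phi> g) \<and> (\<forall>f\<in>F. \<Psi> (k f) = \<psi> f)"
proof -
  interpret L: group L by (rule L)
  interpret \<phi>: group_hom G L \<phi> using \<phi> by unfold_locales
  interpret \<psi>: group_hom "G\<lparr>carrier := F\<rparr>" L \<psi> using \<psi> by unfold_locales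
  define \<eta> where "\<eta> x = (case x of Inl g \<Rightarrow> \<phi> g | Inr f \<Rightarrow> \<psi> f)" for x
  have \<psi>_closed: "f \<in> F \<Longrightarrow> \<psi> f \<in> carrier L" for f using \<psi>.hom_closed[of f] by simp
  have \<psi>_mult: "f \<in> F \<Longrightarrow> g \<in> F \<Longrightarrow> \<psi> (f \<otimes>\<^bsub>G\<^esub> g) = \<psi> f \<otimes>\<^bsub>L\<^esub> \<psi> g" for f g
    using \<psi>.hom_mult[of f g] by simp
  have \<eta>: "\<eta> \<in> Y \<rightarrow> carrier L" using \<psi>_closed by (auto simp: \<eta>_def)
  have "word_eval L \<eta> w = \<one>\<^bsub>L\<^esub>" if "w \<in> Q" for w
    using that unfolding amalgam_rels_def
  proof (elim UnE)
    assume "w \<in> mult_table G Inl"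
    then show ?thesis
      by (auto simp: mult_table_def \<eta>_def L.inv_mult_group L.m_assoc[symmetric])
  next
    assume "w \<in> mult_table (G\<lparr>carrier := F\<rparr>) Inr"
    then show ?thesis
      by (auto simp: mult_table_def \<eta>_def L.inv_mult_group L.m_assoc[symmetric] \<psi>_mult \<psi>_closed)
  next
    assume "w \<in> {[(Inl c, True), (Inr c, False)] | c. c \<in> C}"
    then show ?thesis using FG(2) by (auto simp: \<eta>_def simp flip: agree)
  qed
  from L.presented_group_lift[OF \<eta> this]
  obtain \<Psi> where \<Psi>: "\<Psi> \<in> hom (presented_group Y Q) L"
    "\<And>w. w \<in> words Y \<Longrightarrow> \<Psi> (word_class Y Q w) = word_eval L \<eta> w" by blast
  obtain \<Psi>' where \<Psi>': "\<Psi>' \<in> hom H L" "\<And>x. x \<in> carrier (presented_group Y Q) \<Longrightarrow> \<Psi>' (h x) = \<Psi> x"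
    using iso_transport[OF P.group_axioms H.group_axioms amalgam_iso \<Psi>(1)] by blast
  have "\<Psi>' g = \<phi> g" if "g \<in> carrier G" for g
    using \<Psi>'(2)[of "word_class Y Q [(Inl g, True)]"] \<Psi>(2)[of "[(Inl g, True)]"] amalgam_base[of g] that
    by (auto simp: presented_carrier \<eta>_def)
  moreover have "\<Psi>' (k f) = \<psi> f" if "f \<in> F" for f
    using \<Psi>'(2)[of "word_class Y Q [(Inr f, True)]"] \<Psi>(2)[of "[(Inr f, True)]"] that \<psi>_closed[of f]
    by (auto simp: presented_carrier \<eta>_def second_factor_def)
  ultimately show ?thesis using \<Psi>'(1) by blast
qed

private lemma k_hom: "k \<in> hom (G\<lparr>carrier := F\<rparr>) H"
proof -
  have "(\<lambda>f. word_class Y Q [(Inr f, True)]) \<in> hom (G\<lparr>carrier := F\<rparr>) (presented_group Y Q)"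
    using presented_gen_hom(1)[of Inr "G\<lparr>carrier := F\<rparr>" Y Q] F.group_axioms
    by (auto simp: amalgam_rels_def)
  from hom_compose[OF this h.homh] show ?thesis
    by (simp add: second_factor_def[abs_def] comp_def)
qed

lemma second_factor_closed: "f \<in> F \<Longrightarrow> k f \<in> carrier H"
  using k_hom by (auto simp: hom_def)

private lemma k_simps: "f \<in> F \<Longrightarrow> k f \<in> carrier H" "f \<in> F \<Longrightarrow> g \<in> F \<Longrightarrow> k (f \<otimes>\<^bsub>G\<^esub> g) = k f \<otimes>\<^bsub>H\<^esub> k g"
  using k_hom by (auto simp: hom_def)

private lemma k_C: "c \<in> C \<Longrightarrow> k c = c"
proof -
  assume c: "c \<in> C"
  then have cX: "c \<in> carrier G" "c \<in> F" using FG CF by auto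
  have "[(Inl c, True), (Inr c, False)] \<in> Q" using c by (auto simp: amalgam_rels_def)
  from presented_rel.relator[OF this, of "[]" "[(Inr c, True)]" Y]
  have 1: "([(Inl c, True), (Inr c, False), (Inr c, True)], [(Inr c, True)]) \<in> presented_rel Y Q"
    using cX by simp
  have 2: "([(Inl c, True), (Inr c, False), (Inr c, True)], [(Inl c, True)]) \<in> presented_rel Y Q"
    using presented_rel.cancel[of "[(Inl c, True)]" "Inr c" False "[]" Y Q] cX by simp
  have "word_class Y Q [(Inl c, True)] = word_class Y Q [(Inr c, True)]"
    unfolding word_class_def
    using equiv_class_eq[OF equiv_presented_rel 1] equiv_class_eq[OF equiv_presented_rel 2] by simp
  then show ?thesis using amalgam_base[OF cX(1)] by (simp add: second_factor_def)
qed

private lemma amalgam_induct: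
  assumes "\<one>\<^bsub>H\<^esub> \<in> S"
    and "\<And>g y. g \<in> carrier G \<Longrightarrow> y \<in> carrier H \<Longrightarrow> y \<in> S \<Longrightarrow> g \<otimes>\<^bsub>H\<^esub> y \<in> S"
    and "\<And>f y. f \<in> F \<Longrightarrow> y \<in> carrier H \<Longrightarrow> y \<in> S \<Longrightarrow> k f \<otimes>\<^bsub>H\<^esub> y \<in> S"
  shows "carrier H \<subseteq> S"
proof -
  define W where "W = {a. h a \<in> carrier G \<or> h a \<in> k ` F}"
  have sub: "carrier (presented_group Y Q) \<subseteq> {x. h x \<in> S}"
  proof (rule presented_group_induct[where W = W])
    fix x b assume "x \<in> Y"
    then show "word_class Y Q [(x, b)] \<in> W"
    proof
      fix g assume g: "x = Inl g" "g \<in> carrier G"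
      have "word_class Y Q [(Inl g, False)] = word_class Y Q [(Inl (inv\<^bsub>G\<^esub> g), True)]"
        using presented_gen_hom(2)[of Inl G Y Q g] G.group_axioms g by (auto simp: amalgam_rels_def)
      then show ?thesis using g by (cases b) (simp_all add: W_def amalgam_base)
    next
      fix f assume f: "x = Inr f" "f \<in> F"
      have inv: "inv\<^bsub>G\<lparr>carrier := F\<rparr>\<^esub> f \<in> F" using F.inv_closed[of f] f by simp
      have "word_class Y Q [(Inr f, False)] = word_class Y Q [(Inr (inv\<^bsub>G\<lparr>carrier := F\<rparr>\<^esub> f), True)]"
        using presented_gen_hom(2)[of Inr "G\<lparr>carrier := F\<rparr>" Y Q f] F.group_axioms f
        by (auto simp: amalgam_rels_def)
      then have "h (word_class Y Q [(x, b)]) \<in> k ` F"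
        using f inv by (cases b) (auto simp: second_factor_def)
      then show ?thesis by (simp add: W_def)
    qed
  next
    fix a y assume a: "a \<in> W" "a \<in> carrier (presented_group Y Q)"
      and y: "y \<in> carrier (presented_group Y Q)" "y \<in> {x. h x \<in> S}"
    then have "h a \<otimes>\<^bsub>H\<^esub> h y \<in> S"
      using assms(2)[of "h a" "h y"] assms(3)[of _ "h y"] by (auto simp: W_def)
    then show "a \<otimes>\<^bsub>presented_group Y Q\<^esub> y \<in> {x. h x \<in> S}" using a y by simp
  qed (simp add: assms(1))
  have "h ` carrier (presented_group Y Q) \<subseteq> S"
    using subsetD[OF sub] by (intro image_subsetI) simp
  then show ?thesis using amalgam_iso by (simp add: iso_def bij_betw_def)
qed

text \<open>As for extensions of centralizers: multiply a reduced word on the left by a generator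
  and reduce again.\<close>

lemma amalgam_pairs:
  assumes "x \<in> carrier H"
  shows "\<exists>g ps. pairs_code G F C g ps \<and> x = pairs_val H k g ps"
proof -
  let ?S = "{x. \<exists>g ps. pairs_code G F C g ps \<and> x = pairs_val H k g ps}"
  let ?f = "\<lambda>ps. foldr (\<lambda>(f, g) x. k f \<otimes>\<^bsub>H\<^esub> g \<otimes>\<^bsub>H\<^esub> x) ps \<one>\<^bsub>H\<^esub>"
  note GH = subsetD[OF group_extD(3)[OF amalgam_ext]]
  have closed: "?f ps \<in> carrier H" if "\<forall>x\<in>set ps. fst x \<in> F \<and> snd x \<in> carrier G" for ps
    using that by (induction ps) (auto simp: GH k_simps(1) split: prod.splits)
  have left: "a \<otimes>\<^bsub>H\<^esub> y \<in> ?S" if a: "a \<in> carrier G" and y: "y \<in> ?S" for a y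
  proof -
    obtain g ps where c: "pairs_code G F C g ps" and y: "y = pairs_val H k g ps" using y by blast
    have g: "g \<in> carrier G" "\<forall>x\<in>set ps. fst x \<in> F \<and> snd x \<in> carrier G" using c by (auto simp: pairs_code_def)
    have "pairs_code G F C (a \<otimes>\<^bsub>G\<^esub> g) ps" using c a by (auto simp: pairs_code_def)
    moreover have "a \<otimes>\<^bsub>H\<^esub> y = pairs_val H k (a \<otimes>\<^bsub>G\<^esub> g) ps"
      using g a closed[of ps] by (simp add: y pairs_val_def GH H.m_assoc flip: group_extD(5)[OF amalgam_ext])
    ultimately show "a \<otimes>\<^bsub>H\<^esub> y \<in> ?S" by blast
  qed
  have "carrier H \<subseteq> ?S"
  proof (rule amalgam_induct)
    have "pairs_code G F C \<one>\<^bsub>G\<^esub> []" "\<one>\<^bsub>H\<^esub> = pairs_val H k \<one>\<^bsub>G\<^esub> []"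
      by (simp add: pairs_code_def) (simp add: pairs_val_def flip: group_extD(4)[OF amalgam_ext])
    then show "\<one>\<^bsub>H\<^esub> \<in> ?S" by blast
  next
    fix f y assume f: "f \<in> F" and "y \<in> ?S"
    then obtain g ps where c: "pairs_code G F C g ps" and y: "y = pairs_val H k g ps" by blast
    have g: "g \<in> carrier G" "\<forall>x\<in>set ps. fst x \<in> F \<and> snd x \<in> carrier G" using c by (auto simp: pairs_code_def)
    show "k f \<otimes>\<^bsub>H\<^esub> y \<in> ?S"
    proof (cases "f \<in> C")
      case True
      then show ?thesis using left[OF FG(1)[OF f] \<open>y \<in> ?S\<close>] k_C by simp
    next
      case fC: False
      show ?thesis
      proof (cases "ps = [] \<or> g \<notin> C")
        case True
        have "pairs_code G F C \<one>\<^bsub>G\<^esub> ((f, g) # ps)"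
          using c f fC True by (auto simp: pairs_code_def)
        moreover have "k f \<otimes>\<^bsub>H\<^esub> y = pairs_val H k \<one>\<^bsub>G\<^esub> ((f, g) # ps)"
          using g f closed[of ps] by (simp add: y pairs_val_def GH k_simps H.m_assoc flip: group_extD(4)[OF amalgam_ext])
        ultimately show ?thesis by blast
      next
        case False
        then obtain f1 g1 ps' where ps: "ps = (f1, g1) # ps'" by (metis list.exhaust surj_pair)
        have f1: "f1 \<in> F" and g1: "g1 \<in> carrier G" and cl: "?f ps' \<in> carrier H" using g(2) closed[of ps'] ps by auto
        have gF: "g \<in> F" using False CF by auto
        \<comment> \<open>g lies in C and hence in both copies, so f, g and f1 multiply inside the
          second factor.\<close>
        define f' where "f' = f \<otimes>\<^bsub>G\<^esub> g \<otimes>\<^bsub>G\<^esub> f1"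
        have f': "f' \<in> F" unfolding f'_def using f gF f1 by (intro subgroup.m_closed[OF F])
        have "k f' = k f \<otimes>\<^bsub>H\<^esub> k g \<otimes>\<^bsub>H\<^esub> k f1"
          unfolding f'_def using f gF f1 by (simp add: k_simps subgroup.m_closed[OF F])
        then have kf': "k f' = k f \<otimes>\<^bsub>H\<^esub> g \<otimes>\<^bsub>H\<^esub> k f1" using k_C False by simp
        have eq: "k f \<otimes>\<^bsub>H\<^esub> y = k f' \<otimes>\<^bsub>H\<^esub> (g1 \<otimes>\<^bsub>H\<^esub> ?f ps')"
          using g f f1 g1 cl by (simp add: kf' y ps pairs_val_def GH k_simps H.m_assoc)
        show ?thesis
        proof (cases "f' \<in> C")
          \<comment> \<open>The product may fall into C; it is then an element of G and is absorbed
            on the left.\<close>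
          case True
          have "pairs_code G F C g1 ps'"
            using c by (auto simp: pairs_code_def ps split: if_splits)
          then have "g1 \<otimes>\<^bsub>H\<^esub> ?f ps' \<in> ?S" by (auto simp: pairs_val_def)
          then show ?thesis unfolding eq using left[of f'] True FG k_C by simp
        next
          case False
          have "pairs_code G F C \<one>\<^bsub>G\<^esub> ((f', g1) # ps')"
            using c False f' by (auto simp: pairs_code_def ps split: if_splits)
          moreover have "k f \<otimes>\<^bsub>H\<^esub> y = pairs_val H k \<one>\<^bsub>G\<^esub> ((f', g1) # ps')"
            unfolding eq using f' g1 cl by (simp add: pairs_val_def GH k_simps H.m_assoc flip: group_extD(4)[OF amalgam_ext])
          ultimately show ?thesis by blast
        qed
      qed
    qed
  qed (use left in blast)
  then show ?thesis using assms by blast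
qed

end

text \<open>Elements of G get the empty word so that a lifted map restricts to the given one; all
  others get a proper word, to which the nontriviality results apply.\<close>

definition has_code :: "'a monoid \<Rightarrow> 'a monoid \<Rightarrow> 'a set \<Rightarrow> ('a \<Rightarrow> 'a \<times> (int \<times> 'a) list) \<Rightarrow> bool" where
  "has_code G H C code \<longleftrightarrow> (\<forall>x\<in>carrier H. step_code G C (code x) \<and>
     (x \<in> carrier G \<longrightarrow> code x = (x, [])) \<and> (x \<notin> carrier G \<longrightarrow> snd (code x) \<noteq> []))"

lemma (in group_hom) hom_word_val:
  assumes "s \<in> carrier G" "g \<in> carrier G" "\<And>x. x \<in> set es \<Longrightarrow> snd x \<in> carrier G"
  shows "h (word_val G s g es) = word_val H (h s) (h g) (map (apsnd h) es)"
proof -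
  let ?f = "\<lambda>es. foldr (\<lambda>(e, g) x. s [^] (e::int) \<otimes> g \<otimes> x) es \<one>"
  have "?f es \<in> carrier G \<and> h (?f es) =
      foldr (\<lambda>(e, g) x. h s [^]\<^bsub>H\<^esub> (e::int) \<otimes>\<^bsub>H\<^esub> g \<otimes>\<^bsub>H\<^esub> x) (map (apsnd h) es) \<one>\<^bsub>H\<^esub>"
    using assms(3)
  proof (induction es)
    case (Cons y es)
    obtain e a where y: "y = (e, a)" by fastforce
    have "a \<in> carrier G" using Cons.prems[of y] y by simp
    then show ?case using Cons assms(1) by (simp add: y hom_int_pow)
  qed simp
  then show ?thesis using assms by (simp add: word_val_def)
qed

definition centralizer_code ::
  "'a monoid \<Rightarrow> 'a monoid \<Rightarrow> 'a \<Rightarrow> ('a option word set \<Rightarrow> 'a) \<Rightarrow> 'a \<Rightarrow> 'a \<times> (int \<times> 'a) list" where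
  "centralizer_code G H u h x = (if x \<in> carrier G then (x, [])
     else SOME c. step_code G (centralizer G u) c \<and> x = word_val H (stable_letter G u h) (fst c) (snd c))"

lemma
  assumes data: "centralizer_data G H u h" and x: "x \<in> carrier H"
  shows centralizer_code: "step_code G (centralizer G u) (centralizer_code G H u h x)"
    and word_val_centralizer_code: "x = word_val H (stable_letter G u h)
      (fst (centralizer_code G H u h x)) (snd (centralizer_code G H u h x))"
proof -
  have ext: "group_ext G H" using data by (simp add: centralizer_data_def)
  interpret H: group H using group_extD(2)[OF ext] .
  let ?P = "\<lambda>c. step_code G (centralizer G u) c \<and> x = word_val H (stable_letter G u h) (fst c) (snd c)"
  have "?P (centralizer_code G H u h x)"
  proof (cases "x \<in> carrier G")
    case True
    then show ?thesis using x by (simp add: centralizer_code_def step_code_def word_val_def)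
  next
    case False
    have "\<exists>c. ?P c" using centralizer_ext_code[OF data x] by auto
    from someI_ex[OF this] show ?thesis using False by (simp add: centralizer_code_def)
  qed
  then show "step_code G (centralizer G u) (centralizer_code G H u h x)"
    "x = word_val H (stable_letter G u h)
      (fst (centralizer_code G H u h x)) (snd (centralizer_code G H u h x))" by simp_all
qed

lemma centralizer_has_code:
  assumes data: "centralizer_data G H u h"
  shows "has_code G H (centralizer G u) (centralizer_code G H u h)"
proof -
  have ext: "group_ext G H" using data by (simp add: centralizer_data_def)
  interpret H: group H using group_extD(2)[OF ext] .
  have "snd (centralizer_code G H u h x) \<noteq> []" if x: "x \<in> carrier H" "x \<notin> carrier G" for x
  proof
    assume "snd (centralizer_code G H u h x) = []"
    moreover have "fst (centralizer_code G H u h x) \<in> carrier G"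
      using centralizer_code[OF data x(1)] by (auto simp: step_code_def split: prod.splits)
    ultimately have "word_val H (stable_letter G u h) (fst (centralizer_code G H u h x))
        (snd (centralizer_code G H u h x)) \<in> carrier G"
      using group_extD(3)[OF ext] by (auto simp: word_val_def subset_iff)
    then show False using word_val_centralizer_code[OF data x(1)] x(2) by simp
  qed
  then show ?thesis
    using centralizer_code[OF data] by (auto simp: has_code_def) (auto simp: centralizer_code_def)
qed

lemma centralizer_lifts_to:
  assumes data: "centralizer_data G H u h" and L: "group L"
  shows "lifts_to G H (centralizer G u) (centralizer_code G H u h) L"
  unfolding lifts_to_def
proof (intro ballI impI)
  have ext: "group_ext G H" using data by (simp add: centralizer_data_def)
  fix \<phi> s assume \<phi>: "\<phi> \<in> hom G L" and s: "s \<in> carrier L"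
    and comm: "\<forall>c\<in>centralizer G u. \<phi> c \<otimes>\<^bsub>L\<^esub> s = s \<otimes>\<^bsub>L\<^esub> \<phi> c"
  obtain \<Psi> where \<Psi>: "\<Psi> \<in> hom H L" "\<And>g. g \<in> carrier G \<Longrightarrow> \<Psi> g = \<phi> g" "\<Psi> (stable_letter G u h) = s"
    using centralizer_ext_lift[OF data L \<phi> s] comm by blast
  interpret group_hom H L \<Psi>
    using group_extD(2)[OF ext] L \<Psi>(1) by (simp add: group_hom_def group_hom_axioms_def)
  have "\<Psi> x = word_val L s (\<phi> (fst (centralizer_code G H u h x)))
      (map (apsnd \<phi>) (snd (centralizer_code G H u h x)))" if x: "x \<in> carrier H" for x
  proof -
    obtain g es where c: "centralizer_code G H u h x = (g, es)" by fastforce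
    have g: "g \<in> carrier G" "\<And>y. y \<in> set es \<Longrightarrow> snd y \<in> carrier G"
      using centralizer_code[OF data x] c by (auto simp: step_code_def)
    have "\<Psi> x = word_val L s (\<Psi> g) (map (apsnd \<Psi>) es)"
      using word_val_centralizer_code[OF data x] hom_word_val[of "stable_letter G u h" g es]
        stable_letter_closed[OF data] group_extD(3)[OF ext] g c \<Psi>(3) by (auto simp: subset_iff)
    moreover have "map (apsnd \<Psi>) es = map (apsnd \<phi>) es"
      using g \<Psi>(2) by (intro map_cong) (auto simp: apsnd_def map_prod_def)
    ultimately show ?thesis using \<Psi>(2) g c by simp
  qed
  then show "\<exists>\<Psi>\<in>hom H L. \<forall>x\<in>carrier H. \<Psi> x = word_val L s (\<phi> (fst (centralizer_code G H u h x)))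
      (map (apsnd \<phi>) (snd (centralizer_code G H u h x)))"
    using \<Psi>(1) by blast
qed

text \<open>The second factor is mapped by f \<mapsto> s f s^-1, so a pair (f, g) contributes s f
  s^-1 g. Both f and g then sit between opposite powers of s, as in an extension of a
  centralizer.\<close>

definition pairs_to_code :: "('a \<times> 'a) list \<Rightarrow> (int \<times> 'a) list" where
  "pairs_to_code ps = concat (map (\<lambda>(f, g). [(1, f), (-1, g)]) ps)"

lemma pairs_to_code_simps [simp]:
  "pairs_to_code [] = []" "pairs_to_code ((f, g) # ps) = (1, f) # (-1, g) # pairs_to_code ps"
  by (simp_all add: pairs_to_code_def)

lemma pairs_to_code_eq_Nil [simp]: "pairs_to_code ps = [] \<longleftrightarrow> ps = []"
  by (cases ps) auto

lemma even_length_pairs_to_code: "even (length (pairs_to_code ps))"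
  by (induction ps) auto

lemma alternating_pairs_to_code: "alternating (pairs_to_code ps)"
proof (induction ps)
  case (Cons x ps)
  then show ?case by (cases x; cases ps) (auto simp: alternating_def)
qed (simp add: alternating_def)

lemma step_code_pairs:
  assumes "pairs_code G F C g ps" "F \<subseteq> carrier G"
  shows "step_code G C (g, pairs_to_code ps)"
  using assms
proof (induction ps)
  case (Cons x ps)
  then show ?case by (cases x; cases "ps = []") (auto simp: step_code_def pairs_code_def)
qed (simp add: step_code_def pairs_code_def)

definition amalgam_code ::
  "'a monoid \<Rightarrow> 'a set \<Rightarrow> 'a set \<Rightarrow> 'a monoid \<Rightarrow> (('a + 'a) word set \<Rightarrow> 'a) \<Rightarrow> 'a \<Rightarrow> 'a \<times> ('a \<times> 'a) list" where
  "amalgam_code G F C H h x = (if x \<in> carrier G then (x, [])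
     else SOME c. pairs_code G F C (fst c) (snd c) \<and> x = pairs_val H (second_factor G F C h) (fst c) (snd c))"

lemma
  assumes data: "amalgam_data G F C H h" and x: "x \<in> carrier H"
  shows amalgam_code: "pairs_code G F C (fst (amalgam_code G F C H h x)) (snd (amalgam_code G F C H h x))"
    and pairs_val_amalgam_code: "x = pairs_val H (second_factor G F C h)
      (fst (amalgam_code G F C H h x)) (snd (amalgam_code G F C H h x))"
proof -
  have ext: "group_ext G H" using data by (simp add: amalgam_data_def)
  interpret H: group H using group_extD(2)[OF ext] .
  let ?P = "\<lambda>c. pairs_code G F C (fst c) (snd c) \<and> x = pairs_val H (second_factor G F C h) (fst c) (snd c)"
  have "?P (amalgam_code G F C H h x)"
  proof (cases "x \<in> carrier G")
    case True
    then show ?thesis using x by (simp add: amalgam_code_def pairs_code_def pairs_val_def)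
  next
    case False
    have "\<exists>c. ?P c" using amalgam_pairs[OF data x] by auto
    from someI_ex[OF this] show ?thesis using False by (simp add: amalgam_code_def)
  qed
  then show "pairs_code G F C (fst (amalgam_code G F C H h x)) (snd (amalgam_code G F C H h x))"
    "x = pairs_val H (second_factor G F C h)
      (fst (amalgam_code G F C H h x)) (snd (amalgam_code G F C H h x))" by simp_all
qed

abbreviation amalgam_word :: "'a monoid \<Rightarrow> 'a set \<Rightarrow> 'a set \<Rightarrow> 'a monoid \<Rightarrow> (('a + 'a) word set \<Rightarrow> 'a) \<Rightarrow> 'a \<Rightarrow> 'a \<times> (int \<times> 'a) list" where
  "amalgam_word G F C H h x \<equiv> apsnd pairs_to_code (amalgam_code G F C H h x)"

lemma amalgam_has_code:
  assumes data: "amalgam_data G F C H h"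
  shows "has_code G H C (amalgam_word G F C H h)"
proof -
  have ext: "group_ext G H" and F: "F \<subseteq> carrier G"
    using data by (auto simp: amalgam_data_def dest: subgroup.subset)
  interpret H: group H using group_extD(2)[OF ext] .
  have "snd (amalgam_code G F C H h x) \<noteq> []" if x: "x \<in> carrier H" "x \<notin> carrier G" for x
  proof
    assume "snd (amalgam_code G F C H h x) = []"
    moreover have "fst (amalgam_code G F C H h x) \<in> carrier G"
      using amalgam_code[OF data x(1)] by (auto simp: pairs_code_def)
    ultimately have "pairs_val H (second_factor G F C h) (fst (amalgam_code G F C H h x))
        (snd (amalgam_code G F C H h x)) \<in> carrier G"
      using group_extD(3)[OF ext] by (auto simp: pairs_val_def subset_iff)
    then show False using pairs_val_amalgam_code[OF data x(1)] x(2) by simp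
  qed
  moreover have "step_code G C (amalgam_word G F C H h x)" if "x \<in> carrier H" for x
    using step_code_pairs[OF amalgam_code[OF data that] F] by (simp add: apsnd_def map_prod_def case_prod_unfold)
  ultimately show ?thesis by (auto simp: has_code_def) (auto simp: amalgam_code_def)
qed

lemma amalgam_lifts_to:
  assumes data: "amalgam_data G F C H h" and L: "group L"
  shows "lifts_to G H C (amalgam_word G F C H h) L"
  unfolding lifts_to_def
proof (intro ballI impI)
  have ext: "group_ext G H" and F: "F \<subseteq> carrier G" and F': "subgroup F G" and CF: "C \<subseteq> F"
    using data by (auto simp: amalgam_data_def dest: subgroup.subset)
  interpret L: group L by (rule L)
  interpret G: group G using group_extD(1)[OF ext] .
  fix \<phi> s assume \<phi>: "\<phi> \<in> hom G L" and s: "s \<in> carrier L"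
    and comm: "\<forall>c\<in>C. \<phi> c \<otimes>\<^bsub>L\<^esub> s = s \<otimes>\<^bsub>L\<^esub> \<phi> c"
  interpret \<phi>: group_hom G L \<phi> using \<phi> by unfold_locales
  define \<psi> where "\<psi> f = s \<otimes>\<^bsub>L\<^esub> \<phi> f \<otimes>\<^bsub>L\<^esub> inv\<^bsub>L\<^esub> s" for f
  have "\<psi> \<in> hom (G\<lparr>carrier := F\<rparr>) L"
  proof (rule homI)
    fix a b assume ab: "a \<in> carrier (G\<lparr>carrier := F\<rparr>)" "b \<in> carrier (G\<lparr>carrier := F\<rparr>)"
    then have c: "\<phi> a \<in> carrier L" "\<phi> b \<in> carrier L" "a \<in> carrier G" "b \<in> carrier G" using F by auto
    show "\<psi> (a \<otimes>\<^bsub>G\<lparr>carrier := F\<rparr>\<^esub> b) = \<psi> a \<otimes>\<^bsub>L\<^esub> \<psi> b"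
      using c s by (simp add: \<psi>_def L.m_assoc) (simp add: L.m_assoc[symmetric])
  qed (use F s in \<open>auto simp: \<psi>_def\<close>)
  \<comment> \<open>s commutes with the image of C, so conjugation by s fixes it and the two maps
    agree on the amalgamated subgroup.\<close>
  moreover have "\<phi> c = \<psi> c" if "c \<in> C" for c
  proof -
    have "\<phi> c \<in> carrier L" using that CF F by auto
    then show ?thesis using comm that s by (simp add: \<psi>_def L.m_assoc flip: comm[rule_format])
  qed
  ultimately obtain \<Psi> where \<Psi>: "\<Psi> \<in> hom H L" "\<And>g. g \<in> carrier G \<Longrightarrow> \<Psi> g = \<phi> g"
    "\<And>f. f \<in> F \<Longrightarrow> \<Psi> (second_factor G F C h f) = \<psi> f"
    using amalgam_lift[OF data L \<phi>, of \<psi>] by blast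
  interpret group_hom H L \<Psi>
    using group_extD(2)[OF ext] L \<Psi>(1) by (simp add: group_hom_def group_hom_axioms_def)
  have GH: "g \<in> carrier G \<Longrightarrow> g \<in> carrier H" for g using group_extD(3)[OF ext] by blast
  have "\<Psi> x = word_val L s (\<phi> (fst (amalgam_word G F C H h x)))
      (map (apsnd \<phi>) (snd (amalgam_word G F C H h x)))" if x: "x \<in> carrier H" for x
  proof -
    obtain g ps where c: "amalgam_code G F C H h x = (g, ps)" by fastforce
    have g: "g \<in> carrier G" "\<And>y. y \<in> set ps \<Longrightarrow> fst y \<in> F \<and> snd y \<in> carrier G"
      using amalgam_code[OF data x] c by (auto simp: pairs_code_def)
    let ?k = "second_factor G F C h"
    let ?f = "\<lambda>ps. foldr (\<lambda>(f, g) x. ?k f \<otimes>\<^bsub>H\<^esub> g \<otimes>\<^bsub>H\<^esub> x) ps \<one>\<^bsub>H\<^esub>"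
    let ?w = "\<lambda>es. foldr (\<lambda>(e::int, g) x. s [^]\<^bsub>L\<^esub> e \<otimes>\<^bsub>L\<^esub> g \<otimes>\<^bsub>L\<^esub> x) es \<one>\<^bsub>L\<^esub>"
    have "?f ps \<in> carrier H \<and> \<Psi> (?f ps) = ?w (map (apsnd \<phi>) (pairs_to_code ps))"
      using g(2)
    proof (induction ps)
      case (Cons y ps)
      obtain f a where y: "y = (f, a)" by fastforce
      have fa: "f \<in> F" "f \<in> carrier G" "a \<in> carrier G" using Cons.prems[of y] y F by auto
      have IH: "?f ps \<in> carrier H" "\<Psi> (?f ps) = ?w (map (apsnd \<phi>) (pairs_to_code ps))"
        using Cons by auto
      then have w: "?w (map (apsnd \<phi>) (pairs_to_code ps)) \<in> carrier L" by (metis hom_closed)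
      show ?case
        using fa IH w s by (simp add: y GH second_factor_closed[OF data] \<Psi> \<psi>_def L.m_assoc
            L.int_pow_neg)
    qed simp
    then show ?thesis
      using pairs_val_amalgam_code[OF data x] g(1) c \<Psi>(2) by (simp add: pairs_val_def word_val_def GH)
  qed
  then show "\<exists>\<Psi>\<in>hom H L. \<forall>x\<in>carrier H. \<Psi> x = word_val L s (\<phi> (fst (amalgam_word G F C H h x)))
      (map (apsnd \<phi>) (snd (amalgam_word G F C H h x)))"
    using \<Psi>(1) by blast
qed

lemma (in group) subgroup_centralizer:
  assumes "u \<in> carrier G"
  shows "subgroup (centralizer G u) G"
proof
  fix x y assume xy: "x \<in> centralizer G u" 
  then show "inv x \<in> centralizer G u"
    using assms int_pow_commute[of x u "-1"] by (simp add: centralizer_def int_pow_neg)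
  assume y: "y \<in> centralizer G u"
  have xc: "x \<in> carrier G" "x \<otimes> u = u \<otimes> x" and yc: "y \<in> carrier G" "y \<otimes> u = u \<otimes> y"
    using xy y by (simp_all add: centralizer_def)
  have "x \<otimes> y \<otimes> u = x \<otimes> (u \<otimes> y)" using xc(1) yc assms by (simp add: m_assoc)
  also have "\<dots> = (u \<otimes> x) \<otimes> y" using xc yc(1) assms by (simp flip: m_assoc)
  also have "\<dots> = u \<otimes> (x \<otimes> y)" using xc(1) yc(1) assms by (simp add: m_assoc)
  finally show "x \<otimes> y \<in> centralizer G u" using xy y by (simp add: centralizer_def)
qed (use assms in \<open>auto simp: centralizer_def\<close>)

text \<open>One code has to serve three targets of different types: the series, G itself, and later
  \<open>sl2\<close>. A single statement cannot quantify over types, so the three are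
  listed.\<close>

theorem step_has_code:
  fixes L\<^sub>1 :: "'b monoid" and L\<^sub>2 :: "'c monoid" and L\<^sub>3 :: "'d monoid"
  assumes ext: "group_ext G H" and step: "amalgam_step G H \<or> centralizer_step G H"
    and L: "group L\<^sub>1" "group L\<^sub>2" "group L\<^sub>3"
  obtains C code where "has_code G H C code"
    "lifts_to G H C code L\<^sub>1" "lifts_to G H C code L\<^sub>2" "lifts_to G H C code L\<^sub>3"
    "(\<exists>u\<in>carrier G. u \<noteq> \<one>\<^bsub>G\<^esub> \<and> C = centralizer G u) \<or>
      (C = {\<one>\<^bsub>G\<^esub>} \<and> (\<forall>x. alternating (snd (code x)) \<and> even (length (snd (code x)))))"
proof -
  interpret G: group G using group_extD(1)[OF ext] .
  show ?thesis
    using step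
  proof
    assume "centralizer_step G H"
    then obtain u h where u: "u \<in> carrier G" "u \<noteq> \<one>\<^bsub>G\<^esub>" and data: "centralizer_data G H u h"
      using ext unfolding centralizer_step_def centralizer_data_def by blast
    show ?thesis
      by (rule that[OF centralizer_has_code[OF data] L[THEN centralizer_lifts_to[OF data]]])
        (use u in blast)
  next
    assume "amalgam_step G H"
    then obtain F C h where F: "subgroup F G"
      and C: "C = {\<one>\<^bsub>G\<^esub>} \<or> (\<exists>u\<in>F. u \<noteq> \<one>\<^bsub>G\<^esub> \<and> C = centralizer G u \<and> C = centralizer (G\<lparr>carrier := F\<rparr>) u)"
      and h: "h \<in> iso (amalgam G (G\<lparr>carrier := F\<rparr>) C) H"
        "\<forall>g\<in>carrier G. h (amalgam_left G (G\<lparr>carrier := F\<rparr>) C g) = g"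
      unfolding amalgam_step_def by blast
    have "subgroup C G" "C \<subseteq> F"
      using C F G.subgroup_centralizer subgroup.one_closed[OF F] subgroup.subset[OF F] G.triv_subgroup
      by (auto simp: centralizer_def)
    then have data: "amalgam_data G F C H h"
      using ext F h by (simp add: amalgam_data_def)
    show ?thesis
      by (rule that[OF amalgam_has_code[OF data] L[THEN amalgam_lifts_to[OF data]]])
        (use C F alternating_pairs_to_code even_length_pairs_to_code in \<open>auto dest: subgroup.mem_carrier\<close>)
  qed
qed

subsection \<open>Big powers\<close>

text \<open>With \<open>commutation_transitive\<close>, this makes the centralizers of nontrivial
  elements abelian and malnormal.\<close>

definition malnormal_centralizers :: "('a, 'm) monoid_scheme \<Rightarrow> bool" where
  "malnormal_centralizers G \<longleftrightarrow> (\<forall>u\<in>carrier G - {\<one>\<^bsub>G\<^esub>}. \<forall>x\<in>carrier G.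
     (x \<otimes>\<^bsub>G\<^esub> u \<otimes>\<^bsub>G\<^esub> inv\<^bsub>G\<^esub> x) \<otimes>\<^bsub>G\<^esub> u = u \<otimes>\<^bsub>G\<^esub> (x \<otimes>\<^bsub>G\<^esub> u \<otimes>\<^bsub>G\<^esub> inv\<^bsub>G\<^esub> x) \<longrightarrow> x \<in> centralizer G u)"

definition commutation_transitive :: "('a, 'm) monoid_scheme \<Rightarrow> bool" where
  "commutation_transitive G \<longleftrightarrow> (\<forall>u\<in>carrier G - {\<one>\<^bsub>G\<^esub>}.
     \<forall>x\<in>centralizer G u. \<forall>y\<in>centralizer G u. x \<otimes>\<^bsub>G\<^esub> y = y \<otimes>\<^bsub>G\<^esub> x)"

lemma mon_nontrivial:
  assumes "group G" "group L" "\<Phi> \<in> mon G L" "u \<in> carrier G" "u \<noteq> \<one>\<^bsub>G\<^esub>"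
  shows "\<Phi> u \<noteq> \<one>\<^bsub>L\<^esub>"
proof -
  interpret group_hom G L \<Phi>
    using assms(1-3) by (simp add: group_hom_def group_hom_axioms_def mon_def)
  show ?thesis
    using assms by (auto simp: mon_def dest: inj_onD[of \<Phi> "carrier G" u "\<one>\<^bsub>G\<^esub>"])
qed

lemma
  fixes \<Phi> :: "'a \<Rightarrow> 'b::{idom,ring_char_0} fps"
  assumes G: "group G" and \<Phi>: "\<Phi> \<in> mon G series_mon"
  shows malnormal_centralizers_series: "malnormal_centralizers G"
    and commutation_transitive_series: "commutation_transitive G"
proof -
  interpret G: group G by (rule G)
  have hom: "\<Phi> \<in> hom G series_mon" and inj: "inj_on \<Phi> (carrier G)" using \<Phi> by (auto simp: mon_def)
  interpret group_hom G series_mon \<Phi>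
    using hom by unfold_locales
  have nontriv: "tid (\<Phi> u)" "\<Phi> u \<noteq> fps_X" if "u \<in> carrier G" "u \<noteq> \<one>\<^bsub>G\<^esub>" for u
    using that mon_nontrivial[OF G group_series_mon \<Phi>] by auto
  have mult: "\<Phi> (x \<otimes>\<^bsub>G\<^esub> y) = \<Phi> x oo \<Phi> y" if "x \<in> carrier G" "y \<in> carrier G" for x y
    using hom_mult[OF that] by simp
  show "malnormal_centralizers G"
    unfolding malnormal_centralizers_def
  proof (intro ballI impI)
    fix u x assume u: "u \<in> carrier G - {\<one>\<^bsub>G\<^esub>}" and x: "x \<in> carrier G"
    define v where "v = x \<otimes>\<^bsub>G\<^esub> u \<otimes>\<^bsub>G\<^esub> inv\<^bsub>G\<^esub> x"
    assume "(x \<otimes>\<^bsub>G\<^esub> u \<otimes>\<^bsub>G\<^esub> inv\<^bsub>G\<^esub> x) \<otimes>\<^bsub>G\<^esub> u = u \<otimes>\<^bsub>G\<^esub> (x \<otimes>\<^bsub>G\<^esub> u \<otimes>\<^bsub>G\<^esub> inv\<^bsub>G\<^esub> x)"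
    then have vu: "\<Phi> (v \<otimes>\<^bsub>G\<^esub> u) = \<Phi> (u \<otimes>\<^bsub>G\<^esub> v)" by (simp only: v_def)
    have vx: "v \<otimes>\<^bsub>G\<^esub> x = x \<otimes>\<^bsub>G\<^esub> u" and v: "v \<in> carrier G"
      using u x by (simp_all add: v_def G.m_assoc)
    have "\<Phi> v oo \<Phi> u = \<Phi> u oo \<Phi> v" using vu mult[of v u] mult[of u v] u v by simp
    moreover have "\<Phi> v oo \<Phi> x = \<Phi> x oo \<Phi> u" using vx mult[of v x] mult[of x u] u v x by simp
    ultimately have "\<Phi> v = \<Phi> u"
      using series_malnormal[of "\<Phi> u" "\<Phi> x" "\<Phi> v"] nontriv u x v hom_closed by auto
    then have "v = u" using inj u v by (auto dest: inj_onD)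
    then show "x \<in> centralizer G u" using vx x by (simp add: centralizer_def)
  qed
  show "commutation_transitive G"
    unfolding commutation_transitive_def
  proof (intro ballI)
    fix u x y assume u: "u \<in> carrier G - {\<one>\<^bsub>G\<^esub>}" and xy: "x \<in> centralizer G u" "y \<in> centralizer G u"
    then have c: "x \<in> carrier G" "y \<in> carrier G" by (auto simp: centralizer_def)
    have comm: "\<Phi> a oo \<Phi> u = \<Phi> u oo \<Phi> a" if "a \<in> centralizer G u" for a
    proof -
      have a: "a \<in> carrier G" "a \<otimes>\<^bsub>G\<^esub> u = u \<otimes>\<^bsub>G\<^esub> a" using that unfolding centralizer_def by blast+
      have "\<Phi> a oo \<Phi> u = \<Phi> (a \<otimes>\<^bsub>G\<^esub> u)" using mult[of a u] a(1) u by simp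
      also have "\<dots> = \<Phi> u oo \<Phi> a" unfolding a(2) using mult[of u a] a(1) u by simp
      finally show ?thesis .
    qed
    have uu: "tid (\<Phi> u)" "\<Phi> u \<noteq> fps_X" using nontriv u by blast+
    have "\<Phi> x oo \<Phi> y = \<Phi> y oo \<Phi> x"
      by (rule series_commute_trans[OF uu hom_closed[OF c(1)] comm[OF xy(1)] hom_closed[OF c(2)] comm[OF xy(2)]])
    then show "x \<otimes>\<^bsub>G\<^esub> y = y \<otimes>\<^bsub>G\<^esub> x"
      using c inj_onD[OF inj, of "x \<otimes>\<^bsub>G\<^esub> y" "y \<otimes>\<^bsub>G\<^esub> x"] by (simp add: mult)
  qed
qed

section \<open>Big powers and homomorphisms\<close>

lemma power_product_Nil [simp]: "power_product G [] as = \<one>\<^bsub>G\<^esub>"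
  by (simp add: power_product_def)

lemma power_product_Cons [simp]:
  "power_product G (u # us) (a # as) = u [^]\<^bsub>G\<^esub> a \<otimes>\<^bsub>G\<^esub> power_product G us as"
  by (simp add: power_product_def)

lemma (in group) power_product_closed:
  "set us \<subseteq> carrier G \<Longrightarrow> power_product G us as \<in> carrier G"
proof (induction us arbitrary: as)
  case (Cons u us)
  then show ?case by (cases as) (auto simp: power_product_def)
qed simp

lemma (in group_hom) hom_power_product:
  "set us \<subseteq> carrier G \<Longrightarrow> h (power_product G us as) = power_product H (map h us) as"
proof (induction us arbitrary: as)
  case (Cons u us)
  then show ?case
    by (cases as) (auto simp: power_product_def[of _ _ "[]"] hom_int_pow G.power_product_closed)
qed simp

lemma independent_tuple_hom:
  assumes "group H" "group L" "\<Psi> \<in> hom H L" "set us \<subseteq> carrier H" "independent_tuple L (map \<Psi> us)"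
  shows "independent_tuple H us"
proof -
  interpret group_hom H L \<Psi> using assms by (simp add: group_hom_def group_hom_axioms_def)
  obtain n where n: "\<And>as :: int list. length as = length us \<Longrightarrow> \<forall>a\<in>set as. int n \<le> a \<Longrightarrow> power_product L (map \<Psi> us) as \<noteq> \<one>\<^bsub>L\<^esub>"
    using assms(5) by (auto simp: independent_tuple_def)
  have "power_product H us as \<noteq> \<one>\<^bsub>H\<^esub>"
    if "length as = length us" "\<forall>a\<in>set as. int n \<le> a" for as
    using n[OF that] hom_power_product[OF assms(4), of as] by auto
  then show ?thesis unfolding independent_tuple_def by blast
qed

lemma (in group) commutator_eq_one_iff:
  assumes "a \<in> carrier G" "b \<in> carrier G"
  shows "commutator G a b = \<one> \<longleftrightarrow> a \<otimes> b = b \<otimes> a"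
proof -
  have "commutator G a b = a \<otimes> b \<otimes> inv (b \<otimes> a)"
    using assms by (simp add: commutator_def inv_mult_group m_assoc)
  moreover have "\<one> = a \<otimes> b \<otimes> inv (b \<otimes> a) \<longleftrightarrow> a \<otimes> b = b \<otimes> a"
    by (simp only: inv_solve_right assms m_closed one_closed l_one)
  ultimately show ?thesis by (metis (no_types))
qed

lemma (in group_hom) hom_commutator:
  "a \<in> carrier G \<Longrightarrow> b \<in> carrier G \<Longrightarrow> h (commutator G a b) = commutator H (h a) (h b)"
  by (simp add: commutator_def)

lemma commutation_free_hom:
  assumes H: "group H" and L: "group L" and \<Psi>: "\<Psi> \<in> hom H L" and us: "commutation_free H us"
    and nontriv: "\<And>x. x \<in> set us \<union> {commutator H (us ! i) (us ! Suc i) | i. Suc i < length us} \<Longrightarrow> \<Psi> x \<noteq> \<one>\<^bsub>L\<^esub>"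
  shows "commutation_free L (map \<Psi> us)"
proof -
  interpret group_hom H L \<Psi> using assms by (simp add: group_hom_def group_hom_axioms_def)
  have "set us \<subseteq> carrier H" using us by (auto simp: commutation_free_def)
  then have c: "us ! i \<in> carrier H" if "i < length us" for i
    using nth_mem[OF that] by blast
  have "commutator L (\<Psi> (us ! i)) (\<Psi> (us ! Suc i)) \<noteq> \<one>\<^bsub>L\<^esub>" if "Suc i < length us" for i
    using nontriv[of "commutator H (us ! i) (us ! Suc i)"] that c by (auto simp flip: hom_commutator)
  then show ?thesis
    using us nontriv by (auto simp: commutation_free_def)
qed

lemma commutation_free_finite:
  "finite (set us \<union> {commutator H (us ! i) (us ! Suc i) | i. Suc i < length us})"
proof -
  have "{commutator H (us ! i) (us ! Suc i) | i. Suc i < length us}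
      \<subseteq> (\<lambda>i. commutator H (us ! i) (us ! Suc i)) ` {..<length us}" by auto
  then show ?thesis by (simp add: finite_subset)
qed

lemma commutation_free_witnesses:
  assumes "group H" "commutation_free H us"
  shows "set us \<union> {commutator H (us ! i) (us ! Suc i) | i. Suc i < length us} \<subseteq> carrier H - {\<one>\<^bsub>H\<^esub>}"
proof -
  interpret H: group H by (rule assms(1))
  have "set us \<subseteq> carrier H" using assms(2) by (auto simp: commutation_free_def)
  then have "us ! i \<in> carrier H" if "i < length us" for i
    using nth_mem[OF that] by blast
  then show ?thesis using assms(2) by (auto simp: commutation_free_def) (auto simp: commutator_def)
qed

text \<open>A homomorphism that keeps the entries and the commutators of neighbours nontrivial maps
  the tuple to a commutation-free one, and independence of the image pulls back. Only finitely many
  elements have to survive.\<close>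

lemma BP_group_discriminated:
  assumes H: "group H" and G: "BP_group G"
    and disc: "\<And>S. finite S \<Longrightarrow> S \<subseteq> carrier H - {\<one>\<^bsub>H\<^esub>} \<Longrightarrow> \<exists>\<Psi>\<in>hom H G. \<forall>x\<in>S. \<Psi> x \<noteq> \<one>\<^bsub>G\<^esub>"
  shows "BP_group H"
  unfolding BP_group_def
proof (intro conjI allI impI H)
  fix us assume us: "commutation_free H us"
  have G': "group G" using G by (simp add: BP_group_def)
  obtain \<Psi> where \<Psi>: "\<Psi> \<in> hom H G"
    "\<And>x. x \<in> set us \<union> {commutator H (us ! i) (us ! Suc i) | i. Suc i < length us} \<Longrightarrow> \<Psi> x \<noteq> \<one>\<^bsub>G\<^esub>"
    using disc[OF commutation_free_finite commutation_free_witnesses[OF H us]] by blast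
  have "independent_tuple G (map \<Psi> us)"
    using commutation_free_hom[OF H G' \<Psi>(1) us \<Psi>(2)] G by (simp add: BP_group_def)
  then show "independent_tuple H us"
    using independent_tuple_hom[OF H G' \<Psi>(1)] us by (auto simp: commutation_free_def)
qed

section \<open>Words as products of conjugated powers\<close>

context group
begin

lemma conj_int_pow:
  assumes "h \<in> carrier G" "u \<in> carrier G"
  shows "(h \<otimes> u \<otimes> inv h) [^] (n::int) = h \<otimes> u [^] n \<otimes> inv h"
proof -
  have "group_hom G G (\<lambda>x. h \<otimes> x \<otimes> inv h)"
  proof unfold_locales
    show "(\<lambda>x. h \<otimes> x \<otimes> inv h) \<in> hom G G"
    proof (rule homI)
      fix x y assume "x \<in> carrier G" "y \<in> carrier G"
      then show "h \<otimes> (x \<otimes> y) \<otimes> inv h = h \<otimes> x \<otimes> inv h \<otimes> (h \<otimes> y \<otimes> inv h)"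
        using assms by (simp add: m_assoc) (simp add: m_assoc[symmetric])
    qed (use assms in simp)
  qed
  from group_hom.hom_int_pow[OF this assms(2)] show ?thesis by simp
qed

text \<open>The i-th entry is u or its inverse conjugated by the product of the coefficients before
  the i-th power. The sign of the exponent goes into the base because the big powers condition
  speaks of positive exponents.\<close>

primrec conj_list :: "'a \<Rightarrow> 'a \<Rightarrow> (int \<times> 'a) list \<Rightarrow> 'a list" where
  "conj_list u h [] = []"
| "conj_list u h (x # es) = (h \<otimes> u [^] sgn (fst x) \<otimes> inv h) # conj_list u (h \<otimes> snd x) es"

lemma length_conj_list [simp]: "length (conj_list u h es) = length es"
  by (induction es arbitrary: h) auto

lemma set_conj_list:
  assumes "u \<in> carrier G" "u \<noteq> \<one>" "h \<in> carrier G" "\<forall>x\<in>set es. fst x \<noteq> 0 \<and> snd x \<in> carrier G"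
  shows "set (conj_list u h es) \<subseteq> carrier G - {\<one>}"
  using assms(3,4)
proof (induction es arbitrary: h)
  case (Cons x es)
  have "u [^] sgn (fst x) \<noteq> \<one>"
    using assms(1,2) Cons.prems(2) by (auto simp: sgn_if int_pow_neg inv_eq_1_iff)
  then have "h \<otimes> u [^] sgn (fst x) \<otimes> inv h \<noteq> \<one>"
    using assms(1) Cons.prems(1) inv_solve_right[of \<one> "h \<otimes> u [^] sgn (fst x)" h] l_cancel_one
    by (metis inv_closed int_pow_closed m_closed one_closed l_one r_cancel_one r_inv r_one inv_solve_right)
  then show ?case using Cons assms(1) by auto
qed simp

text \<open>Inserting h^-1 h after each power collects the powers into conjugates; what is left over
  is the product of the coefficients, that is the word at s = 1.\<close>

lemma word_val_conj_list:
  assumes "u \<in> carrier G" "h \<in> carrier G" "\<forall>x\<in>set es. snd x \<in> carrier G"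
  shows "word_val G (u [^] (n::nat)) h es =
    power_product G (conj_list u h es) (map (\<lambda>x. int n * \<bar>fst x\<bar>) es) \<otimes> word_val G \<one> h es"
  using assms(2,3)
proof (induction es arbitrary: h)
  case Nil
  then show ?case by (simp add: word_val_def)
next
  case (Cons x es)
  obtain e g where x: "x = (e, g)" by fastforce
  have g: "g \<in> carrier G" using Cons.prems x by simp
  let ?f = "\<lambda>s es. foldr (\<lambda>(e::int, g) x. s [^] e \<otimes> g \<otimes> x) es \<one>"
  have closed: "?f s es \<in> carrier G" if "s \<in> carrier G" "\<forall>x\<in>set es. snd x \<in> carrier G" for s es
    using that(2)
  proof (induction es)
    case (Cons y es)
    then show ?case using that(1) by (cases y) simp
  qed simp
  have pw: "(u [^] n) [^] e = (u [^] sgn e) [^] (int n * \<bar>e\<bar>)"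
    using assms(1) by (simp add: int_pow_int[symmetric] int_pow_pow mult_ac sgn_mult_abs abs_mult_sgn)
       (metis abs_mult_sgn mult.commute mult.left_commute)
  have "word_val G (u [^] n) h (x # es) = (h \<otimes> (u [^] n) [^] e \<otimes> inv h) \<otimes> word_val G (u [^] n) (h \<otimes> g) es"
    using Cons.prems g closed[of "u [^] n" es] assms(1)
    by (simp add: x word_val_def m_assoc) (simp add: m_assoc[symmetric])
  also have "\<dots> = (h \<otimes> (u [^] n) [^] e \<otimes> inv h) \<otimes> (power_product G (conj_list u (h \<otimes> g) es) (map (\<lambda>x. int n * \<bar>fst x\<bar>) es)
      \<otimes> word_val G \<one> (h \<otimes> g) es)"
    using Cons g by simp
  also have "h \<otimes> (u [^] n) [^] e \<otimes> inv h = (h \<otimes> u [^] sgn e \<otimes> inv h) [^] (int n * \<bar>e\<bar>)"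
    using Cons.prems assms(1) by (simp add: conj_int_pow pw)
  also have "word_val G \<one> (h \<otimes> g) es = word_val G \<one> h (x # es)"
    using Cons.prems g closed[of \<one> es] by (simp add: x word_val_def m_assoc)
  also have "(h \<otimes> u [^] sgn e \<otimes> inv h) [^] (int n * \<bar>e\<bar>) \<otimes> (power_product G (conj_list u (h \<otimes> g) es)
      (map (\<lambda>x. int n * \<bar>fst x\<bar>) es) \<otimes> word_val G \<one> h (x # es)) =
      power_product G (conj_list u h (x # es)) (map (\<lambda>x. int n * \<bar>fst x\<bar>) (x # es)) \<otimes> word_val G \<one> h (x # es)"
  proof -
    have "power_product G (conj_list u (h \<otimes> g) es) (map (\<lambda>x. int n * \<bar>fst x\<bar>) es) \<in> carrier G"
    proof (rule power_product_closed)
      have "set (conj_list u h' es) \<subseteq> carrier G" if "h' \<in> carrier G" "\<forall>x\<in>set es. snd x \<in> carrier G" for h' es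
        using that assms(1) by (induction es arbitrary: h') auto
      then show "set (conj_list u (h \<otimes> g) es) \<subseteq> carrier G" using Cons.prems g by simp
    qed
    moreover have "word_val G \<one> h (x # es) \<in> carrier G"
      using Cons.prems g closed[of \<one> "x # es"] by (simp add: word_val_def x)
    ultimately show ?thesis using Cons.prems assms(1) by (simp add: x m_assoc)
  qed
  finally show ?case .
qed

text \<open>Up to a common conjugation, neighbours are powers with exponent 1 or -1 of u and of g u
  g^-1, with g the coefficient between them. If these commuted, malnormality would put g into the
  centralizer of u.\<close>

lemma conj_list_successively:
  assumes mal: "malnormal_centralizers G" and u: "u \<in> carrier G" "u \<noteq> \<one>"
    and "h \<in> carrier G" "\<forall>x\<in>set es. fst x \<noteq> 0 \<and> snd x \<in> carrier G" "\<forall>x\<in>set (butlast es). snd x \<notin> centralizer G u"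
  shows "successively (\<lambda>a b. a \<otimes> b \<noteq> b \<otimes> a) (conj_list u h es)"
  using assms(4-6)
proof (induction es arbitrary: h)
  case (Cons x es)
  have IH: "successively (\<lambda>a b. a \<otimes> b \<noteq> b \<otimes> a) (conj_list u (h \<otimes> snd x) es)"
    using Cons by (cases es) auto
  show ?case
  proof (cases es)
    case Nil
    then show ?thesis by simp
  next
    case (Cons y es')
    define g where "g = snd x"
    define v where "v = g \<otimes> u \<otimes> inv g"
    have g: "g \<in> carrier G" "g \<notin> centralizer G u" and h: "h \<in> carrier G"
      using Cons.prems Cons by (auto simp: g_def)
    have v: "v \<in> carrier G" using g u by (simp add: v_def)
    have e: "sgn (fst x) = 1 \<or> sgn (fst x) = -1" "sgn (fst y) = 1 \<or> sgn (fst y) = -1"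
      using Cons.prems(2) Cons by (auto simp: sgn_if)
    \<comment> \<open>Raising to the exponent 1 or -1 twice changes nothing, so commutation of
      powers gives commutation of the bases.\<close>
    have inv_inv_pow: "(a [^] e) [^] e = a" if "e = 1 \<or> e = -1" "a \<in> carrier G" for a and e :: int
      using that by (auto simp: int_pow_pow)
    let ?a = "u [^] sgn (fst x)" and ?b = "v [^] sgn (fst y)"
    have "?a \<otimes> ?b \<noteq> ?b \<otimes> ?a"
    proof
      assume "?a \<otimes> ?b = ?b \<otimes> ?a"
      from int_pow_commute[OF this, of "sgn (fst x)"]
      have "u \<otimes> ?b = ?b \<otimes> u" using e u v by (simp add: inv_inv_pow)
      from int_pow_commute[OF this[symmetric], of "sgn (fst y)"]
      have "v \<otimes> u = u \<otimes> v" using e u v by (simp add: inv_inv_pow)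
      then show False using mal g u by (auto simp: malnormal_centralizers_def v_def)
    qed
    moreover have "h \<otimes> g \<otimes> u [^] sgn (fst y) \<otimes> inv (h \<otimes> g) = h \<otimes> ?b \<otimes> inv h"
      unfolding v_def conj_int_pow[OF g(1) u(1)] using g h u by (simp add: inv_mult_group m_assoc)
    moreover have "(h \<otimes> a \<otimes> inv h) \<otimes> (h \<otimes> b \<otimes> inv h) = h \<otimes> (a \<otimes> b) \<otimes> inv h" if "a \<in> carrier G" "b \<in> carrier G" for a b
      using that h by (simp add: m_assoc) (simp add: m_assoc[symmetric])
    ultimately show ?thesis
      using IH h u v g by (simp add: Cons flip: g_def)
  qed
qed simp

end

text \<open>If the word were trivial for all n, then n = 0 would make the product of its
  coefficients trivial. What remains is a trivial product of large powers of a commutation-free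
  tuple.\<close>

lemma BP_word_nontrivial:
  assumes BP: "BP_group G" and mal: "malnormal_centralizers G" and u: "u \<in> carrier G" "u \<noteq> \<one>\<^bsub>G\<^esub>"
    and c: "step_code G (centralizer G u) (g, es)" "es \<noteq> []"
  shows "\<exists>n::nat. word_val G (u [^]\<^bsub>G\<^esub> n) g es \<noteq> \<one>\<^bsub>G\<^esub>"
proof (rule ccontr)
  interpret group G using BP by (simp add: BP_group_def)
  assume "\<not> ?thesis"
  then have triv: "word_val G (u [^]\<^bsub>G\<^esub> n) g es = \<one>\<^bsub>G\<^esub>" for n :: nat by blast
  have g: "g \<in> carrier G" and es: "\<forall>x\<in>set es. fst x \<noteq> 0 \<and> snd x \<in> carrier G"
    "\<forall>x\<in>set (butlast es). snd x \<notin> centralizer G u"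
    using c by (auto simp: step_code_def)
  let ?us = "conj_list u g es"
  have closed: "set ?us \<subseteq> carrier G - {\<one>\<^bsub>G\<^esub>}" using set_conj_list[OF u g es(1)] .
  then have mem: "?us ! i \<in> carrier G" if "i < length es" for i
    using nth_mem[of i ?us] that by (metis DiffD1 length_conj_list subsetD)
  have "?us \<noteq> []" using c(2) by (cases es) auto
  then have "commutation_free G ?us"
    using conj_list_successively[OF mal u g es] closed c(2) mem
    by (auto simp: commutation_free_def successively_conv_nth commutator_eq_one_iff)
  then have "independent_tuple G ?us" using BP by (simp add: BP_group_def)
  then obtain N where N: "\<And>as :: int list. length as = length ?us \<Longrightarrow> \<forall>a\<in>set as. int N \<le> a \<Longrightarrow> power_product G ?us as \<noteq> \<one>\<^bsub>G\<^esub>"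
    unfolding independent_tuple_def by blast
  have 1: "word_val G \<one>\<^bsub>G\<^esub> g es = \<one>\<^bsub>G\<^esub>" using triv[of 0] by simp
  have "power_product G ?us (map (\<lambda>x. int N * \<bar>fst x\<bar>) es) = \<one>\<^bsub>G\<^esub>"
  proof -
    have "power_product G ?us (map (\<lambda>x. int N * \<bar>fst x\<bar>) es) \<in> carrier G"
      using closed by (intro power_product_closed) auto
    then show ?thesis
      using word_val_conj_list[OF u(1) g, of es N] es(1) by (simp add: triv 1)
  qed
  moreover have "int N \<le> int N * \<bar>e\<bar>" if "e \<noteq> 0" for e :: int
    using that mult_left_mono[of 1 "\<bar>e\<bar>" "int N"] by simp
  ultimately show False using N[of "map (\<lambda>x. int N * \<bar>fst x\<bar>) es"] es(1) by auto
qed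

lemma (in group) word_val_in_subgroup:
  assumes S: "subgroup S G" and s: "s \<in> S" "g \<in> S" "\<And>x. x \<in> set es \<Longrightarrow> snd x \<in> S"
  shows "word_val G s g es \<in> S"
proof -
  have "foldr (\<lambda>(e::int, g) x. s [^] e \<otimes> g \<otimes> x) es \<one> \<in> S"
    using s(3)
  proof (induction es)
    case (Cons y es)
    obtain e a where y: "y = (e, a)" by fastforce
    have "a \<in> S" using Cons.prems[of y] y by simp
    moreover have "s [^] e \<in> S" using subgroup_int_pow_closed[OF S s(1)] .
    ultimately show ?case using Cons by (simp add: y subgroup.m_closed[OF S])
  qed (simp add: subgroup.one_closed[OF S])
  then show ?thesis using s(2) by (simp add: word_val_def subgroup.m_closed[OF S])
qed

section \<open>Extending an embedding by one letter\<close>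

definition series_embedding ::
  "'a monoid \<Rightarrow> ('a \<Rightarrow> ('x::linorder, 'c::field_char_0) mpoly fps) \<Rightarrow> 'x set \<Rightarrow> bool" where
  "series_embedding G \<Phi> J \<longleftrightarrow> \<Phi> \<in> mon G series_mon \<and> \<Phi> ` carrier G \<subseteq> series_in J"

lemma series_embeddingD:
  assumes "series_embedding G \<Phi> J"
  shows "\<Phi> \<in> mon G series_mon" "\<Phi> \<in> hom G series_mon" "x \<in> carrier G \<Longrightarrow> \<Phi> x \<in> series_in J"
  using assms by (auto simp: series_embedding_def mon_def)

lemma monI:
  assumes "group G" "group L" "\<Phi> \<in> hom G L"
    and "\<And>x. x \<in> carrier G \<Longrightarrow> x \<noteq> \<one>\<^bsub>G\<^esub> \<Longrightarrow> \<Phi> x \<noteq> \<one>\<^bsub>L\<^esub>"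
  shows "\<Phi> \<in> mon G L"
proof -
  interpret group_hom G L \<Phi> using assms(1-3) by (simp add: group_hom_def group_hom_axioms_def)
  have "inj_on \<Phi> (carrier G)" using assms(4) inj_on_one_iff by blast
  then show ?thesis using assms(3) by (simp add: mon_def)
qed

text \<open>The coefficients of the word do not involve the variable j, so setting it to n only
  turns the generic power into v^n. The value is then the image of an element of G.\<close>

lemma word_val_msubst:
  assumes G: "group G" and \<Phi>: "series_embedding G \<Phi> J" and j: "j \<notin> J" and v: "v \<in> carrier G"
    and g: "g \<in> carrier G" "\<And>x. x \<in> set es \<Longrightarrow> snd x \<in> carrier G"
  shows "fps_map (msubst j (of_nat n)) (word_val series_mon (spow (\<Phi> v) (mvar j)) (\<Phi> g) (map (apsnd \<Phi>) es))
    = \<Phi> (word_val G (v [^]\<^bsub>G\<^esub> (n::nat)) g es)"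
proof -
  note \<Phi>D = series_embeddingD[OF \<Phi>]
  let ?m = "fps_map (msubst j (of_nat n)) :: ('b, 'c) mpoly fps \<Rightarrow> ('b, 'c) mpoly fps"
  interpret G: group G by (rule G)
  interpret \<Phi>: group_hom G series_mon \<Phi> using \<Phi>D(2) by unfold_locales
  interpret m: group_hom series_mon series_mon ?m
    using ring_hom1_fps_map_hom[OF ring_hom1_msubst] by unfold_locales
  have fix_m: "?m (\<Phi> x) = \<Phi> x" if "x \<in> carrier G" for x
    using fps_map_msubst_series_in[OF \<Phi>D(3)[OF that] j] .
  have "?m (word_val series_mon (spow (\<Phi> v) (mvar j)) (\<Phi> g) (map (apsnd \<Phi>) es)) =
      word_val series_mon (?m (spow (\<Phi> v) (mvar j))) (?m (\<Phi> g)) (map (apsnd ?m) (map (apsnd \<Phi>) es))"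
    using g \<Phi>.hom_closed tid_spow[OF \<Phi>.hom_closed[OF v]] by (intro m.hom_word_val) auto
  also have "map (apsnd ?m) (map (apsnd \<Phi>) es) = map (apsnd \<Phi>) es"
    using g(2) fix_m by (auto simp: apsnd_def map_prod_def)
  also have "?m (\<Phi> g) = \<Phi> g" by (rule fix_m[OF g(1)])
  also have "?m (spow (\<Phi> v) (mvar j)) = \<Phi> (v [^]\<^bsub>G\<^esub> n)"
    using fps_map_msubst_spow[OF \<Phi>D(3)[OF v] j] by (simp add: \<Phi>.hom_nat_pow[OF v])
  also have "word_val series_mon (\<Phi> (v [^]\<^bsub>G\<^esub> n)) (\<Phi> g) (map (apsnd \<Phi>) es) = \<Phi> (word_val G (v [^]\<^bsub>G\<^esub> n) g es)"
    using g v by (intro \<Phi>.hom_word_val[symmetric]) auto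
  finally show ?thesis .
qed

text \<open>Coefficients depend polynomially on \<open>n\<close>, so a word is trivial for finitely many \<open>n\<close> or for all.\<close>

lemma finite_trivial_powers:
  assumes BP: "BP_group G" and \<Phi>: "series_embedding G \<Phi> J" and j: "j \<notin> J"
    and v: "v \<in> carrier G" "v \<noteq> \<one>\<^bsub>G\<^esub>"
    and c: "step_code G (centralizer G v) (g, es)" "es = [] \<Longrightarrow> g \<noteq> \<one>\<^bsub>G\<^esub>"
  shows "finite {n::nat. word_val G (v [^]\<^bsub>G\<^esub> n) g es = \<one>\<^bsub>G\<^esub>}"
proof (rule ccontr)
  interpret G: group G using BP by (simp add: BP_group_def)
  note \<Phi>D = series_embeddingD[OF \<Phi>]
  interpret \<Phi>: group_hom G series_mon \<Phi> using \<Phi>D(2) by unfold_locales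
  assume inf: "infinite {n::nat. word_val G (v [^]\<^bsub>G\<^esub> n) g es = \<one>\<^bsub>G\<^esub>}"
  have g: "g \<in> carrier G" "\<And>x. x \<in> set es \<Longrightarrow> snd x \<in> carrier G"
    using c(1) by (auto simp: step_code_def)
  let ?w = "word_val series_mon (spow (\<Phi> v) (mvar j)) (\<Phi> g) (map (apsnd \<Phi>) es)"
  note msubst = word_val_msubst[OF G.group_axioms \<Phi> j v(1) g]
  have sub: "{n::nat. word_val G (v [^]\<^bsub>G\<^esub> n) g es = \<one>\<^bsub>G\<^esub>} \<subseteq>
      {n. fps_map (msubst j (of_nat n)) ?w = fps_map (msubst j (of_nat n)) fps_X}"
  proof (rule Collect_mono, rule impI)
    fix n :: nat assume "word_val G (v [^]\<^bsub>G\<^esub> n) g es = \<one>\<^bsub>G\<^esub>"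
    then show "fps_map (msubst j (of_nat n)) ?w = fps_map (msubst j (of_nat n)) fps_X"
      using \<Phi>.hom_one by (simp only: msubst ring_hom1.fps_map_X[OF ring_hom1_msubst] series_mon_simps)
  qed
  have "?w = fps_X" by (rule fps_map_msubst_infinite[OF infinite_super[OF sub inf]])
  then have "\<Phi> (word_val G (v [^]\<^bsub>G\<^esub> n) g es) = fps_X" for n :: nat
    using msubst[where n = n] ring_hom1.fps_map_X[OF ring_hom1_msubst] by metis
  moreover have "word_val G (v [^]\<^bsub>G\<^esub> n) g es \<in> carrier G" for n :: nat
    using G.word_val_in_subgroup[OF G.subgroup_self] g v by simp
  ultimately have triv: "word_val G (v [^]\<^bsub>G\<^esub> n) g es = \<one>\<^bsub>G\<^esub>" for n :: nat
    using mon_nontrivial[OF G.group_axioms group_series_mon \<Phi>D(1)] by (metis series_mon_simps(2))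
  show False
  proof (cases "es = []")
    case True
    then show ?thesis using triv[of 0] c(2) g by (simp add: word_val_def)
  next
    case False
    then show ?thesis
      using BP_word_nontrivial[OF BP malnormal_centralizers_series[OF G.group_axioms \<Phi>D(1)] v c(1)] triv by blast
  qed
qed

lemma has_codeD:
  assumes "has_code G H C code" "x \<in> carrier H"
  shows "step_code G C (fst (code x), snd (code x))"
    and "fst (code x) \<in> carrier G" "y \<in> set (snd (code x)) \<Longrightarrow> snd y \<in> carrier G"
    and "x \<in> carrier G \<Longrightarrow> code x = (x, [])"
    and "snd (code x) = [] \<Longrightarrow> x \<noteq> e \<Longrightarrow> fst (code x) \<noteq> e"
    and "y \<in> set (butlast (snd (code x))) \<Longrightarrow> snd y \<notin> C"
  using assms by (auto simp: has_code_def step_code_def)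

text \<open>On G the new map is \<Phi>, so injectivity is at stake only for words in which s
  occurs.\<close>

lemma lifted_embedding:
  fixes \<Phi> :: "'a \<Rightarrow> ('x::linorder, 'c::field_char_0) mpoly fps"
  assumes ext: "group_ext G H" and \<Phi>: "series_embedding G \<Phi> J"
    and code: "has_code G H C code" and lift: "lifts_to G H C code (series_mon :: ('x, 'c) mpoly fps monoid)"
    and s: "s \<in> series_in K" and comm: "\<And>c. c \<in> C \<Longrightarrow> \<Phi> c oo s = s oo \<Phi> c"
    and inj: "\<And>x. x \<in> carrier H \<Longrightarrow> x \<notin> carrier G \<Longrightarrow>
      word_val series_mon s (\<Phi> (fst (code x))) (map (apsnd \<Phi>) (snd (code x))) \<noteq> fps_X"
  shows "\<exists>\<Phi>'. series_embedding H \<Phi>' (J \<union> K) \<and> (\<forall>x\<in>carrier G. \<Phi>' x = \<Phi> x)"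
proof -
  note \<Phi>D = series_embeddingD[OF \<Phi>] and extD = group_extD[OF ext]
  interpret G: group G by (rule extD(1))
  interpret \<Phi>: group_hom G series_mon \<Phi> using \<Phi>D(2) by unfold_locales
  obtain \<Phi>' where \<Phi>': "\<Phi>' \<in> hom H series_mon"
    "\<And>x. x \<in> carrier H \<Longrightarrow> \<Phi>' x = word_val series_mon s (\<Phi> (fst (code x))) (map (apsnd \<Phi>) (snd (code x)))"
  proof -
    have "\<forall>c\<in>C. \<Phi> c \<otimes>\<^bsub>series_mon\<^esub> s = s \<otimes>\<^bsub>series_mon\<^esub> \<Phi> c" using comm by simp
    then have "\<exists>\<Psi>\<in>hom H series_mon. \<forall>x\<in>carrier H.
        \<Psi> x = word_val series_mon s (\<Phi> (fst (code x))) (map (apsnd \<Phi>) (snd (code x)))"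
      using lift \<Phi>D(2) series_in_tid[OF s] unfolding lifts_to_def by blast
    then show ?thesis using that by blast
  qed
  have ext\<Phi>: "\<Phi>' x = \<Phi> x" if x: "x \<in> carrier G" for x
    using \<Phi>'(2)[of x] has_codeD(4)[OF code _ x] extD(3) x \<Phi>.hom_closed[OF x] by (auto simp: word_val_def)
  have in_series: "series_in J \<subseteq> series_in (J \<union> K)" "series_in K \<subseteq> series_in (J \<union> K)"
    by (simp_all add: series_in_mono)
  have "\<Phi>' x \<in> series_in (J \<union> K)" if x: "x \<in> carrier H" for x
    unfolding \<Phi>'(2)[OF x]
  proof (rule series.word_val_in_subgroup[OF subgroup_series_in])
    show "s \<in> series_in (J \<union> K)" using s in_series(2) by (rule subsetD[rotated])
    show "\<Phi> (fst (code x)) \<in> series_in (J \<union> K)"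
      using \<Phi>D(3)[OF has_codeD(2)[OF code x]] in_series(1) by (rule subsetD[rotated])
    fix y assume "y \<in> set (map (apsnd \<Phi>) (snd (code x)))"
    then obtain z where z: "z \<in> set (snd (code x))" "snd y = \<Phi> (snd z)" by auto
    show "snd y \<in> series_in (J \<union> K)"
      unfolding z(2) using \<Phi>D(3)[OF has_codeD(3)[OF code x z(1)]] in_series(1) by (rule subsetD[rotated])
  qed
  moreover have "\<Phi>' \<in> mon H series_mon"
  proof (rule monI[OF extD(2) group_series_mon \<Phi>'(1)])
    fix x assume x: "x \<in> carrier H" "x \<noteq> \<one>\<^bsub>H\<^esub>"
    show "\<Phi>' x \<noteq> \<one>\<^bsub>series_mon\<^esub>"
    proof (cases "x \<in> carrier G")
      case True
      then show ?thesis
        using ext\<Phi>[OF True] mon_nontrivial[OF extD(1) group_series_mon \<Phi>D(1) True] x(2) extD(4) by simp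
    qed (use \<Phi>'(2) inj x in simp)
  qed
  ultimately show ?thesis
    using ext\<Phi> by (auto simp: series_embedding_def)
qed

text \<open>Retract H onto G by s \<mapsto> v^n. Each element of S dies for finitely many n only, so
  one n serves all of S. The element v may depend on S, which the free case exploits.\<close>

lemma discriminated_by_powers:
  assumes ext: "group_ext G H" and BP: "BP_group G" and \<Phi>: "series_embedding G \<Phi> J" and j: "j \<notin> J"
    and code: "has_code G H C code" and lift: "lifts_to G H C code G"
    and v: "v \<in> carrier G" "v \<noteq> \<one>\<^bsub>G\<^esub>" "C \<subseteq> centralizer G v"
    and S: "finite S" "S \<subseteq> carrier H - {\<one>\<^bsub>H\<^esub>}"
      "\<And>x y. x \<in> S \<Longrightarrow> y \<in> set (butlast (snd (code x))) \<Longrightarrow> snd y \<notin> centralizer G v"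
  shows "\<exists>\<Psi>\<in>hom H G. \<forall>x\<in>S. \<Psi> x \<noteq> \<one>\<^bsub>G\<^esub>"
proof -
  note extD = group_extD[OF ext]
  interpret G: group G by (rule extD(1))
  define B where "B x = {n::nat. word_val G (v [^]\<^bsub>G\<^esub> n) (fst (code x)) (snd (code x)) = \<one>\<^bsub>G\<^esub>}" for x
  have "finite (B x)" if x: "x \<in> S" for x
    unfolding B_def
  proof (rule finite_trivial_powers[OF BP \<Phi> j v(1,2)])
    have xH: "x \<in> carrier H" "x \<noteq> \<one>\<^bsub>G\<^esub>" using S(2) x extD(4) by auto
    show "step_code G (centralizer G v) (fst (code x), snd (code x))"
      using has_codeD(1)[OF code xH(1)] S(3)[OF x] by (auto simp: step_code_def)
    show "fst (code x) \<noteq> \<one>\<^bsub>G\<^esub>" if "snd (code x) = []"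
      using has_codeD(5)[OF code xH(1) that xH(2)] .
  qed
  then have "finite (\<Union>x\<in>S. B x)" using S(1) by blast
  then obtain n where n: "n \<notin> (\<Union>x\<in>S. B x)" using ex_new_if_finite infinite_UNIV_nat by blast
  have "c \<otimes>\<^bsub>G\<^esub> v [^]\<^bsub>G\<^esub> n = v [^]\<^bsub>G\<^esub> n \<otimes>\<^bsub>G\<^esub> c" if "c \<in> C" for c
  proof -
    have "c \<in> carrier G" "v \<otimes>\<^bsub>G\<^esub> c = c \<otimes>\<^bsub>G\<^esub> v" using that v(3) by (auto simp: centralizer_def)
    then show ?thesis using G.group_commutes_pow[of v c n] v(1) by metis
  qed
  moreover have "(\<lambda>x. x) \<in> hom G G" by (simp add: hom_def)
  ultimately have "\<exists>\<Psi>\<in>hom H G. \<forall>x\<in>carrier H.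
      \<Psi> x = word_val G (v [^]\<^bsub>G\<^esub> n) (fst (code x)) (map (apsnd (\<lambda>x. x)) (snd (code x)))"
    using lift[unfolded lifts_to_def, rule_format, of "\<lambda>x. x" "v [^]\<^bsub>G\<^esub> n"] v(1) by blast
  then obtain \<Psi> where "\<Psi> \<in> hom H G" "\<And>x. x \<in> carrier H \<Longrightarrow>
      \<Psi> x = word_val G (v [^]\<^bsub>G\<^esub> n) (fst (code x)) (map (apsnd (\<lambda>x. x)) (snd (code x)))"
    by blast
  then show ?thesis using n S(2) by (intro bexI[of _ \<Psi>]) (auto simp: B_def apsnd_def map_prod_def)
qed

text \<open>With s the generic power of u, setting the exponent to n gives the retraction with s =
  u^n. A trivial generic value would therefore be trivial for all n.\<close>

theorem step_over_centralizer:
  fixes \<Phi> :: "'a \<Rightarrow> ('x::linorder, 'c::field_char_0) mpoly fps"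
  assumes ext: "group_ext G H" and BP: "BP_group G" and \<Phi>: "series_embedding G \<Phi> J" and j: "j \<notin> J"
    and u: "u \<in> carrier G" "u \<noteq> \<one>\<^bsub>G\<^esub>"
    and code: "has_code G H (centralizer G u) code"
    and lift: "lifts_to G H (centralizer G u) code (series_mon :: ('x, 'c) mpoly fps monoid)" "lifts_to G H (centralizer G u) code G"
  shows "BP_group H \<and> (\<exists>\<Phi>'. series_embedding H \<Phi>' (insert j J) \<and> (\<forall>x\<in>carrier G. \<Phi>' x = \<Phi> x))"
proof
  note \<Phi>D = series_embeddingD[OF \<Phi>] and extD = group_extD[OF ext]
  interpret G: group G by (rule extD(1))
  interpret \<Phi>: group_hom G series_mon \<Phi> using \<Phi>D(2) by unfold_locales
  show "BP_group H"
  proof (rule BP_group_discriminated[OF extD(2) BP])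
    fix S assume S: "finite S" "S \<subseteq> carrier H - {\<one>\<^bsub>H\<^esub>}"
    show "\<exists>\<Psi>\<in>hom H G. \<forall>x\<in>S. \<Psi> x \<noteq> \<one>\<^bsub>G\<^esub>"
    proof (rule discriminated_by_powers[OF ext BP \<Phi> j code lift(2) u subset_refl S])
      fix x y assume "x \<in> S" "y \<in> set (butlast (snd (code x)))"
      then show "snd y \<notin> centralizer G u" using has_codeD(6)[OF code, of x y] S(2) by blast
    qed
  qed
  have "spow (\<Phi> u) (mvar j) \<in> series_in (insert j J)"
    using series_in_mono[of J "insert j J"] \<Phi>D(3)[OF u(1)] by (intro spow_in mpolys.mvar) auto
  moreover have "\<Phi> c oo spow (\<Phi> u) (mvar j) = spow (\<Phi> u) (mvar j) oo \<Phi> c" if "c \<in> centralizer G u" for c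
  proof -
    have c: "c \<in> carrier G" "c \<otimes>\<^bsub>G\<^esub> u = u \<otimes>\<^bsub>G\<^esub> c" using that unfolding centralizer_def by blast+
    have "\<Phi> c oo \<Phi> u = \<Phi> u oo \<Phi> c"
      using \<Phi>.hom_mult[OF c(1) u(1)] \<Phi>.hom_mult[OF u(1) c(1)] by (simp add: c(2))
    then show ?thesis by (rule spow_commute[OF \<Phi>D(3)[OF u(1)] \<Phi>D(3)[OF c(1)] j])
  qed
  moreover have "word_val series_mon (spow (\<Phi> u) (mvar j)) (\<Phi> (fst (code x))) (map (apsnd \<Phi>) (snd (code x))) \<noteq> fps_X"
    if x: "x \<in> carrier H" "x \<notin> carrier G" for x
  proof
    assume triv: "word_val series_mon (spow (\<Phi> u) (mvar j)) (\<Phi> (fst (code x))) (map (apsnd \<Phi>) (snd (code x))) = fps_X"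
    have "\<Phi> (word_val G (u [^]\<^bsub>G\<^esub> n) (fst (code x)) (snd (code x))) = \<one>\<^bsub>series_mon\<^esub>" for n :: nat
      using word_val_msubst[OF extD(1) \<Phi> j u(1) has_codeD(2,3)[OF code x(1)], where n = n and es = "snd (code x)"] triv
      by (simp add: ring_hom1.fps_map_X[OF ring_hom1_msubst])
    moreover have "word_val G (u [^]\<^bsub>G\<^esub> n) (fst (code x)) (snd (code x)) \<in> carrier G" for n :: nat
      using G.word_val_in_subgroup[OF G.subgroup_self] has_codeD(2,3)[OF code x(1)] u by simp
    ultimately have "word_val G (u [^]\<^bsub>G\<^esub> n) (fst (code x)) (snd (code x)) = \<one>\<^bsub>G\<^esub>" for n :: nat
      using mon_nontrivial[OF extD(1) group_series_mon \<Phi>D(1)] by metis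
    then have "{n::nat. word_val G (u [^]\<^bsub>G\<^esub> n) (fst (code x)) (snd (code x)) = \<one>\<^bsub>G\<^esub>} = UNIV" by blast
    moreover have "x \<noteq> \<one>\<^bsub>G\<^esub>" using x(2) by auto
    ultimately show False
      using finite_trivial_powers[OF BP \<Phi> j u has_codeD(1)[OF code x(1)]] has_codeD(5)[OF code x(1)] by simp
  qed
  ultimately have "\<exists>\<Phi>'. series_embedding H \<Phi>' (J \<union> insert j J) \<and> (\<forall>x\<in>carrier G. \<Phi>' x = \<Phi> x)"
    by (rule lifted_embedding[OF ext \<Phi> code lift(1)])
  then show "\<exists>\<Phi>'. series_embedding H \<Phi>' (insert j J) \<and> (\<forall>x\<in>carrier G. \<Phi>' x = \<Phi> x)"
    by (simp add: Un_absorb1 subset_insertI)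
qed

text \<open>A tuple of length 1 has no neighbours and is commutation-free as soon as its entry is
  nontrivial; a multiple of k exceeds any bound.\<close>

lemma BP_torsion_free:
  assumes BP: "BP_group G" and x: "x \<in> carrier G" "x \<noteq> \<one>\<^bsub>G\<^esub>" and k: "0 < (k::nat)"
  shows "x [^]\<^bsub>G\<^esub> k \<noteq> \<one>\<^bsub>G\<^esub>"
proof
  interpret G: group G using BP by (simp add: BP_group_def)
  assume xk: "x [^]\<^bsub>G\<^esub> k = \<one>\<^bsub>G\<^esub>"
  have "commutation_free G [x]" using x by (simp add: commutation_free_def)
  then have "independent_tuple G [x]" using BP by (simp add: BP_group_def)
  then obtain n where n: "\<And>as :: int list. length as = length [x] \<Longrightarrow> \<forall>a\<in>set as. int n \<le> a \<Longrightarrow> power_product G [x] as \<noteq> \<one>\<^bsub>G\<^esub>"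
    unfolding independent_tuple_def by blast
  have "x [^]\<^bsub>G\<^esub> (int (k * n)) = \<one>\<^bsub>G\<^esub>"
    unfolding int_pow_int using G.nat_pow_pow[OF x(1), of k n] xk by simp
  moreover have "n \<le> k * n" using k by simp
  then have "int n \<le> int (k * n)" by (simp only: of_nat_le_iff)
  ultimately show False using n[of "[int (k * n)]"] x(1) by simp
qed

text \<open>Among the elements a^m b, a nontrivial e commutes with at most one. If it commuted with
  two, it would commute with a positive power of a, hence by transitivity with a, and then with b;
  so a and b would commute.\<close>

lemma noncommuting_element:
  assumes BP: "BP_group G" and ct: "commutation_transitive G"
    and ab: "a \<in> carrier G" "b \<in> carrier G" "a \<otimes>\<^bsub>G\<^esub> b \<noteq> b \<otimes>\<^bsub>G\<^esub> a"
    and E: "finite E" "E \<subseteq> carrier G - {\<one>\<^bsub>G\<^esub>}"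
  shows "\<exists>v\<in>carrier G - {\<one>\<^bsub>G\<^esub>}. \<forall>e\<in>E. e \<notin> centralizer G v"
proof -
  interpret G: group G using BP by (simp add: BP_group_def)
  define v where "v m = a [^]\<^bsub>G\<^esub> m \<otimes>\<^bsub>G\<^esub> b" for m :: nat
  have v: "v m \<in> carrier G" for m using ab by (simp add: v_def)
  have flip: "x \<in> centralizer G y \<longleftrightarrow> y \<in> centralizer G x" if "x \<in> carrier G" "y \<in> carrier G" for x y
    using that by (auto simp: centralizer_def)
  have one: "m' \<le> m" if e: "e \<in> E" and m: "e \<in> centralizer G (v m)" "e \<in> centralizer G (v m')" for e m m'
  proof (rule ccontr)
    assume "\<not> m' \<le> m"
    then obtain k where k: "m' = k + m" "0 < k" by (metis less_imp_add_positive linorder_not_le add.commute)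
    have eG: "e \<in> carrier G" "e \<noteq> \<one>\<^bsub>G\<^esub>" using e E by auto
    note C = G.subgroup_centralizer[OF eG(1)]
    have vm: "v m \<in> centralizer G e" "v m' \<in> centralizer G e" using m flip v eG by auto
    have am: "a [^]\<^bsub>G\<^esub> n \<in> carrier G" for n :: nat using ab by simp
    have "v m' = a [^]\<^bsub>G\<^esub> k \<otimes>\<^bsub>G\<^esub> v m"
      using ab by (simp add: v_def k(1) G.m_assoc flip: G.nat_pow_mult)
    then have "a [^]\<^bsub>G\<^esub> k = v m' \<otimes>\<^bsub>G\<^esub> inv\<^bsub>G\<^esub> v m"
      using v am by (simp add: G.m_assoc)
    then have ak: "a [^]\<^bsub>G\<^esub> k \<in> centralizer G e"
      using vm C by (simp add: subgroup.m_closed subgroup.m_inv_closed)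
    have "a \<noteq> \<one>\<^bsub>G\<^esub>" using ab by auto
    then have "a [^]\<^bsub>G\<^esub> k \<noteq> \<one>\<^bsub>G\<^esub>" using BP_torsion_free[OF BP ab(1) _ k(2)] by blast
    moreover have "e \<in> centralizer G (a [^]\<^bsub>G\<^esub> k)" using ak flip am eG by auto
    moreover have "a \<in> centralizer G (a [^]\<^bsub>G\<^esub> k)"
      using G.group_commutes_pow[of a a k] ab(1) by (simp add: centralizer_def)
    ultimately have "a \<otimes>\<^bsub>G\<^esub> e = e \<otimes>\<^bsub>G\<^esub> a" using ct am by (auto simp: commutation_transitive_def)
    then have a: "a \<in> centralizer G e" using ab by (simp add: centralizer_def)
    have "a [^]\<^bsub>G\<^esub> m \<in> centralizer G e"
      using G.subgroup_int_pow_closed[OF C a, of "int m"] by (simp add: int_pow_int)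
    moreover have "b = inv\<^bsub>G\<^esub> (a [^]\<^bsub>G\<^esub> m) \<otimes>\<^bsub>G\<^esub> v m"
      using ab by (simp add: v_def flip: G.m_assoc)
    ultimately have "b \<in> centralizer G e"
      using vm C by (simp add: subgroup.m_closed subgroup.m_inv_closed)
    then show False using ct a eG ab(3) by (auto simp: commutation_transitive_def)
  qed
  have "finite {m. e \<in> centralizer G (v m)}" if "e \<in> E" for e
  proof (cases "{m. e \<in> centralizer G (v m)} = {}")
    case False
    then obtain m where "e \<in> centralizer G (v m)" by blast
    then have "{m. e \<in> centralizer G (v m)} \<subseteq> {..m}" using one[OF that] by blast
    then show ?thesis by (rule finite_subset) simp
  qed simp
  then have "finite (\<Union>e\<in>E. {m. e \<in> centralizer G (v m)})" using E(1) by blast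
  then obtain m where m: "m \<notin> (\<Union>e\<in>E. {m. e \<in> centralizer G (v m)})"
    using ex_new_if_finite infinite_UNIV_nat by blast
  \<comment> \<open>Otherwise b would be a power of a and commute with it.\<close>
  have "v m \<noteq> \<one>\<^bsub>G\<^esub>"
  proof
    assume "v m = \<one>\<^bsub>G\<^esub>"
    then have "inv\<^bsub>G\<^esub> b = a [^]\<^bsub>G\<^esub> m"
      using ab by (intro G.inv_equality) (simp_all add: v_def)
    then have b: "b = inv\<^bsub>G\<^esub> (a [^]\<^bsub>G\<^esub> m)" using ab(2) by (metis G.inv_inv)
    have "a \<in> centralizer G a" using ab by (simp add: centralizer_def)
    then have "a [^]\<^bsub>G\<^esub> m \<in> centralizer G a"
      using G.subgroup_int_pow_closed[OF G.subgroup_centralizer[OF ab(1)], of a "int m"] by (simp add: int_pow_int)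
    then have "b \<in> centralizer G a"
      using b subgroup.m_inv_closed[OF G.subgroup_centralizer[OF ab(1)]] by simp
    then show False using ab(3) by (simp add: centralizer_def)
  qed
  then show ?thesis using m v by (intro bexI[of _ "v m"]) auto
qed

text \<open>Over the trivial subgroup, conjugate the second factor by a series with independent coefficients.\<close>

theorem free_step_embedding:
  fixes \<Phi> :: "'a \<Rightarrow> ('x::linorder, 'c::field_char_0) mpoly fps" and j :: "nat \<Rightarrow> 'x"
  assumes ext: "group_ext G H" and \<Phi>: "series_embedding G \<Phi> J"
    and j: "inj j" "range j \<inter> J = {}"
    and code: "has_code G H {\<one>\<^bsub>G\<^esub>} code" and alt: "\<And>x. alternating (snd (code x))"
    and lift: "lifts_to G H {\<one>\<^bsub>G\<^esub>} code (series_mon :: ('x, 'c) mpoly fps monoid)"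
  shows "\<exists>\<Phi>'. series_embedding H \<Phi>' (J \<union> range j) \<and> (\<forall>x\<in>carrier G. \<Phi>' x = \<Phi> x)"
proof -
  note \<Phi>D = series_embeddingD[OF \<Phi>] and extD = group_extD[OF ext]
  interpret G: group G by (rule extD(1))
  interpret \<Phi>: group_hom G series_mon \<Phi> using \<Phi>D(2) by unfold_locales
  define s :: "('x, 'c) mpoly fps" where
    "s = Abs_fps (\<lambda>n. if n = 0 then 0 else if n = 1 then 1 else mvar (j n))"
  have s: "s \<in> series_in (range j)"
    by (auto simp: series_in_def s_def tid_iff intro: mpolys.mvar)
  show ?thesis
  proof (rule lifted_embedding[OF ext \<Phi> code lift s])
    fix c assume "c \<in> {\<one>\<^bsub>G\<^esub>}"
    then show "\<Phi> c oo s = s oo \<Phi> c"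
      using \<Phi>.hom_one series_in_tid[OF s] by (simp add: tid_iff)
  next
    fix x assume x: "x \<in> carrier H" "x \<notin> carrier G"
    note c = has_codeD[OF code x(1)]
    let ?es = "map (apsnd \<Phi>) (snd (code x))"
    have "\<exists>t. tid t \<and> word_val series_mon t (lift_series (\<Phi> (fst (code x)))) (map (apsnd lift_series) ?es) \<noteq> fps_X"
    proof (rule no_mixed_identity)
      show "?es \<noteq> []" using code x by (simp add: has_code_def)
      have "successively (\<lambda>a b. fst b = - fst a) ?es" "fst ` set ?es \<subseteq> {1, -1}"
        using alt[of x] by (auto simp: alternating_def successively_map image_image)
      then show "alternating ?es" by (simp add: alternating_def)
      show "tid (\<Phi> (fst (code x)))" using \<Phi>.hom_closed c(2) .
      fix y assume "y \<in> set ?es"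
      then show "tid (snd y)" using \<Phi>.hom_closed c(3) by auto
    next
      fix y assume "y \<in> set (butlast ?es)"
      then obtain z where z: "z \<in> set (butlast (snd (code x)))" "snd y = \<Phi> (snd z)"
        by (auto simp flip: map_butlast)
      then have "snd z \<in> carrier G" "snd z \<noteq> \<one>\<^bsub>G\<^esub>"
        using c(1) c(3) in_set_butlastD[OF z(1)] by (auto simp: step_code_def)
      then show "snd y \<noteq> fps_X"
        using mon_nontrivial[OF extD(1) group_series_mon \<Phi>D(1)] z(2) by simp
    qed
    then obtain t where t: "tid t"
      "word_val series_mon t (lift_series (\<Phi> (fst (code x)))) (map (apsnd lift_series) ?es) \<noteq> fps_X" by blast
    \<comment> \<open>The fresh variables are specialised to the coefficients of the t found above,
      and all other variables are kept as constants. This carries s to t and the word to one that is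
      known to be nontrivial.\<close>
    define \<eta> :: "('x, 'c) mpoly \<Rightarrow> ('x, 'c) mpoly fps" where
      "\<eta> = meval (\<lambda>c. fps_const (mconst c)) (\<lambda>y. if y \<in> range j then t $ the_inv j y else fps_const (mvar y))"
    have rh: "ring_hom1 (\<lambda>c :: 'c. fps_const (mconst c :: ('x, 'c) mpoly))"
      by standard (simp_all add: ring_hom1.add[OF ring_hom1_mconst] ring_hom1.mult[OF ring_hom1_mconst]
          ring_hom1.one[OF ring_hom1_mconst])
    then have \<eta>: "ring_hom1 \<eta>" unfolding \<eta>_def by (rule ring_hom1_meval)
    interpret \<eta>: group_hom series_mon series_mon "fps_map \<eta>"
      using ring_hom1_fps_map_hom[OF \<eta>] by unfold_locales
    have on_J: "fps_map \<eta> f = lift_series f" if "f \<in> series_in J" for f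
    proof (rule fps_ext)
      fix n
      have "f $ n \<in> mpolys J" using that by (simp add: series_in_def)
      then have "\<eta> (f $ n) = fps_const (f $ n)"
      proof (rule meval_unique_on[OF \<eta> ring_hom1_fps_const])
        show "\<eta> (mconst c) = fps_const (mconst c)" for c by (simp add: \<eta>_def rh)
        show "\<eta> (mvar y) = fps_const (mvar y)" if "y \<in> J" for y
        proof -
          have "y \<notin> range j" using j(2) that by blast
          then show ?thesis by (simp add: \<eta>_def rh)
        qed
      qed
      then show "fps_map \<eta> f $ n = lift_series f $ n" by simp
    qed
    have "\<eta> (mvar (j n)) = t $ n" for n
      using j(1) by (simp add: \<eta>_def rh the_inv_f_f)
    then have "fps_map \<eta> s = t"
      using t(1) by (intro fps_ext) (auto simp: s_def tid_iff ring_hom1.zero[OF \<eta>] ring_hom1.one[OF \<eta>])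
    moreover have "map (apsnd (fps_map \<eta>)) ?es = map (apsnd lift_series) ?es"
      using on_J \<Phi>D(3) c(3) by (auto simp: apsnd_def map_prod_def)
    moreover have "fps_map \<eta> (word_val series_mon s (\<Phi> (fst (code x))) ?es) =
        word_val series_mon (fps_map \<eta> s) (fps_map \<eta> (\<Phi> (fst (code x)))) (map (apsnd (fps_map \<eta>)) ?es)"
    proof (rule \<eta>.hom_word_val[OF series_in_tid[OF s] \<Phi>.hom_closed[OF c(2)]])
      fix y assume "y \<in> set ?es"
      then show "tid (snd y)" using \<Phi>.hom_closed c(3) by auto
    qed
    ultimately have "fps_map \<eta> (word_val series_mon s (\<Phi> (fst (code x))) ?es) \<noteq> fps_X"
      using t(2) on_J[OF \<Phi>D(3)[OF c(2)]] by (simp only: not_False_eq_True)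
    then show "word_val series_mon s (\<Phi> (fst (code x))) ?es \<noteq> fps_X"
      using ring_hom1.fps_map_X[OF \<eta>] by auto
  qed
qed

text \<open>For v commuting with none of the inner coefficients, the words of S stay reduced over
  the centralizer of v.\<close>

lemma nonabelian_free_step_BP:
  assumes ext: "group_ext G H" and BP: "BP_group G" and \<Phi>: "series_embedding G \<Phi> J" and j: "j \<notin> J"
    and code: "has_code G H {\<one>\<^bsub>G\<^esub>} code" and lift: "lifts_to G H {\<one>\<^bsub>G\<^esub>} code G"
    and ab: "a \<in> carrier G" "b \<in> carrier G" "a \<otimes>\<^bsub>G\<^esub> b \<noteq> b \<otimes>\<^bsub>G\<^esub> a"
  shows "BP_group H"
proof (rule BP_group_discriminated[OF group_extD(2)[OF ext] BP])
  interpret G: group G by (rule group_extD(1)[OF ext])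
  fix S assume S: "finite S" "S \<subseteq> carrier H - {\<one>\<^bsub>H\<^esub>}"
  define E where "E = (\<Union>x\<in>S. snd ` set (butlast (snd (code x))))"
  have "E \<subseteq> carrier G - {\<one>\<^bsub>G\<^esub>}"
    using S(2) has_codeD(1)[OF code] by (force simp: E_def step_code_def dest: in_set_butlastD)
  moreover have "finite E" using S(1) by (simp add: E_def)
  ultimately obtain v where v: "v \<in> carrier G - {\<one>\<^bsub>G\<^esub>}" "\<forall>e\<in>E. e \<notin> centralizer G v"
    using noncommuting_element[OF BP commutation_transitive_series[OF G.group_axioms series_embeddingD(1)[OF \<Phi>]] ab]
    by blast
  show "\<exists>\<Psi>\<in>hom H G. \<forall>x\<in>S. \<Psi> x \<noteq> \<one>\<^bsub>G\<^esub>"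
    using v S
    by (intro discriminated_by_powers[OF ext BP \<Phi> j code lift, of v]) (auto simp: E_def centralizer_def)
qed

subsection \<open>Big powers of hyperbolic matrices\<close>

datatype mat2 = Mat2 (m11: real) (m12: real) (m21: real) (m22: real)

definition mmult :: "mat2 \<Rightarrow> mat2 \<Rightarrow> mat2" (infixl "\<odot>" 70) where
  "A \<odot> B = Mat2 (m11 A * m11 B + m12 A * m21 B) (m11 A * m12 B + m12 A * m22 B)
    (m21 A * m11 B + m22 A * m21 B) (m21 A * m12 B + m22 A * m22 B)"

definition mtr :: "mat2 \<Rightarrow> real" where "mtr A = m11 A + m22 A"
definition mdet :: "mat2 \<Rightarrow> real" where "mdet A = m11 A * m22 A - m12 A * m21 A"
definition mone :: mat2 where "mone = Mat2 1 0 0 1"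
definition madj :: "mat2 \<Rightarrow> mat2" where "madj A = Mat2 (m22 A) (- m12 A) (- m21 A) (m11 A)"
definition mscale :: "real \<Rightarrow> mat2 \<Rightarrow> mat2" where
  "mscale c A = Mat2 (c * m11 A) (c * m12 A) (c * m21 A) (c * m22 A)"
definition madd :: "mat2 \<Rightarrow> mat2 \<Rightarrow> mat2" where
  "madd A B = Mat2 (m11 A + m11 B) (m12 A + m12 B) (m21 A + m21 B) (m22 A + m22 B)"

lemmas mat2_defs = mmult_def mtr_def mdet_def mone_def madj_def mscale_def madd_def

lemma mmult_assoc: "(A \<odot> B) \<odot> D = A \<odot> (B \<odot> D)"
  by (simp add: mmult_def algebra_simps)

lemma mdet_mmult: "mdet (A \<odot> B) = mdet A * mdet B"
  by (simp add: mat2_defs algebra_simps)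

lemma mone_simps [simp]: "mone \<odot> A = A" "A \<odot> mone = A"
  by (simp_all add: mat2_defs)

lemma mtr_commute: "mtr (A \<odot> B) = mtr (B \<odot> A)"
  by (simp add: mat2_defs algebra_simps)

definition sl2 :: "mat2 monoid" where
  "sl2 = \<lparr>carrier = {A. mdet A = 1}, monoid.mult = (\<odot>), one = mone\<rparr>"

lemma sl2_simps [simp]: "carrier sl2 = {A. mdet A = 1}" "A \<otimes>\<^bsub>sl2\<^esub> B = A \<odot> B" "\<one>\<^bsub>sl2\<^esub> = mone"
  by (simp_all add: sl2_def)

lemma madj_left: "mdet A = 1 \<Longrightarrow> madj A \<odot> A = mone"
  by (simp add: mat2_defs algebra_simps)

lemma group_sl2: "group sl2"
proof (rule groupI)
  show "\<exists>B\<in>carrier sl2. B \<otimes>\<^bsub>sl2\<^esub> A = \<one>\<^bsub>sl2\<^esub>" if "A \<in> carrier sl2" for A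
    using that madj_left[of A] by (intro bexI[of _ "madj A"]) (simp_all add: mdet_def madj_def algebra_simps)
qed (simp_all add: mdet_mmult mmult_assoc, simp add: mat2_defs)

interpretation sl2: group sl2 by (rule group_sl2)

lemma inv_sl2: "mdet A = 1 \<Longrightarrow> inv\<^bsub>sl2\<^esub> A = madj A"
  by (rule sl2.inv_equality) (simp_all add: madj_left, simp add: mat2_defs algebra_simps)

abbreviation mprod :: "mat2 list \<Rightarrow> mat2" where
  "mprod As \<equiv> foldr (\<odot>) As mone"

definition mlim :: "(nat \<Rightarrow> mat2) \<Rightarrow> mat2 \<Rightarrow> bool" where
  "mlim F A \<longleftrightarrow> (\<lambda>n. m11 (F n)) \<longlonglongrightarrow> m11 A \<and> (\<lambda>n. m12 (F n)) \<longlonglongrightarrow> m12 A \<and>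
     (\<lambda>n. m21 (F n)) \<longlonglongrightarrow> m21 A \<and> (\<lambda>n. m22 (F n)) \<longlonglongrightarrow> m22 A"

lemma mlim_mmult: "mlim F A \<Longrightarrow> mlim H B \<Longrightarrow> mlim (\<lambda>n. F n \<odot> H n) (A \<odot> B)"
  by (auto simp: mlim_def mmult_def intro!: tendsto_intros)

lemma mlim_const: "mlim (\<lambda>n. A) A"
  by (simp add: mlim_def)

lemma mlim_mprod:
  "list_all2 mlim Fs As \<Longrightarrow> mlim (\<lambda>n. mprod (map (\<lambda>F. F n) Fs)) (mprod As)"
  by (induction rule: list_all2_induct) (auto intro: mlim_const mlim_mmult)

lemma mlim_mtr: "mlim F A \<Longrightarrow> (\<lambda>n. mtr (F n)) \<longlonglongrightarrow> mtr A"
  by (auto simp: mlim_def mtr_def intro!: tendsto_intros)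

text \<open>A singular P is a column times a row; the inner product in the middle of P X P is the
  trace of P X.\<close>

lemma singular_sandwich: "mdet P = 0 \<Longrightarrow> P \<odot> X \<odot> P = mscale (mtr (P \<odot> X)) P"
  by (simp add: mat2_defs) algebra

definition mzero :: mat2 where "mzero = Mat2 0 0 0 0"

lemma mscale_eq_zero_iff: "mscale c A = mzero \<longleftrightarrow> c = 0 \<or> A = mzero"
  by (cases A) (auto simp: mscale_def mzero_def)

lemma mzero_mmult [simp]: "mzero \<odot> A = mzero" "A \<odot> mzero = mzero"
  by (simp_all add: mzero_def mmult_def)

text \<open>Matrices of rank one multiply to a nonzero matrix when each row pairs nontrivially with
  the next column; here the product of the two pairings of P and Q is the trace of P Q.\<close>

lemma singular_chain_nonzero:
  assumes "Ps \<noteq> []" "\<And>P. P \<in> set Ps \<Longrightarrow> mdet P = 0 \<and> P \<noteq> mzero"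
    and "successively (\<lambda>P Q. mtr (P \<odot> Q) \<noteq> 0) Ps"
  shows "mprod Ps \<noteq> mzero"
  using assms
proof (induction Ps)
  case (Cons P Ps)
  show ?case
  proof (cases Ps)
    case Nil
    then show ?thesis using Cons.prems by simp
  next
    case (Cons Q Qs)
    have tr: "mtr (P \<odot> Q) \<noteq> 0" using Cons.prems(3) Cons by simp
    have IH: "mprod Ps \<noteq> mzero" using Cons.IH Cons.prems Cons by auto
    show ?thesis
    proof
      assume "mprod (P # Ps) = mzero"
      \<comment> \<open>Multiplying by Q on the left creates a sandwich that reduces to a multiple
        of the shorter product.\<close>
      then have "Q \<odot> P \<odot> Q \<odot> mprod Qs = mzero" by (simp add: Cons mmult_assoc)
      then have "mscale (mtr (Q \<odot> P)) Q \<odot> mprod Qs = mzero"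
        using singular_sandwich[of Q P] Cons.prems(2)[of Q] Cons by simp
      moreover have "mscale c A \<odot> B = mscale c (A \<odot> B)" for c A B
        by (simp add: mat2_defs algebra_simps)
      ultimately have "mscale (mtr (Q \<odot> P)) (mprod Ps) = mzero" by (simp add: Cons)
      then show False using IH tr by (simp add: mscale_eq_zero_iff mtr_commute[of Q])
    qed
  qed
qed simp

text \<open>Closing the cycle gives P W P, which is the trace of P W times P, and this chain is
  nonzero.\<close>

lemma singular_cycle_trace:
  assumes "\<And>Q. Q \<in> set (P # Ps) \<Longrightarrow> mdet Q = 0 \<and> Q \<noteq> mzero"
    and "successively (\<lambda>P Q. mtr (P \<odot> Q) \<noteq> 0) (P # Ps @ [P])"
  shows "mtr (mprod (P # Ps)) \<noteq> 0"
proof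
  assume 0: "mtr (mprod (P # Ps)) = 0"
  have app: "mprod (As @ Bs) = mprod As \<odot> mprod Bs" for As Bs
    by (induction As) (simp_all add: mmult_assoc)
  have "mprod (P # Ps @ [P]) = mscale (mtr (P \<odot> mprod Ps)) P"
    using singular_sandwich[of P "mprod Ps"] assms(1)[of P]
    by (simp add: app mmult_assoc del: foldr_append)
  also have "\<dots> = mzero" using 0 by (simp add: mscale_eq_zero_iff)
  finally show False
    using singular_chain_nonzero[of "P # Ps @ [P]"] assms by auto
qed

text \<open>Fricke's trace identity.\<close>

lemma commutator_trace:
  assumes "mdet A = 1" "mdet B = 1"
  shows "mtr (A \<odot> B \<odot> madj A \<odot> madj B) = mtr A ^ 2 + mtr B ^ 2 + mtr (A \<odot> B) ^ 2
    - mtr A * mtr B * mtr (A \<odot> B) - 2"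
proof -
  obtain a b c d where A: "A = Mat2 a b c d" by (cases A)
  obtain e f g h where B: "B = Mat2 e f g h" by (cases B)
  have 1: "a * d - b * c = 1" "e * h - f * g = 1" using assms by (simp_all add: A B mdet_def)
  show ?thesis
    unfolding A B mmult_def mtr_def madj_def mat2.sel using 1 by algebra
qed

section \<open>Spectral decomposition of hyperbolic matrices\<close>

definition eigenvalue :: "mat2 \<Rightarrow> real" where
  "eigenvalue A = (SOME l. l ^ 2 - mtr A * l + 1 = 0 \<and> \<bar>l\<bar> > 1)"

lemma eigenvalue:
  assumes "\<bar>mtr A\<bar> > 2"
  shows "eigenvalue A ^ 2 - mtr A * eigenvalue A + 1 = 0" "\<bar>eigenvalue A\<bar> > 1"
proof -
  define t where "t = \<bar>mtr A\<bar>"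
  \<comment> \<open>The larger root for the absolute value of the trace; the sign is restored when
    the witness is given.\<close>
  define r where "r = (t + sqrt (t ^ 2 - 4)) / 2"
  have t: "t > 2" using assms by (simp add: t_def)
  have "t ^ 2 > 4" using power_strict_mono[of 2 t 2] t by simp
  then have "r ^ 2 - t * r + 1 = 0" and "r > 1"
    using t by (auto simp: r_def field_simps power2_eq_square)
      (metis add.commute add_less_cancel_left less_add_same_cancel1 one_add_one real_sqrt_gt_0_iff diff_gt_0_iff_gt power2_eq_square add_strict_mono)
  then have "\<exists>l. l ^ 2 - mtr A * l + 1 = 0 \<and> \<bar>l\<bar> > 1"
    by (intro exI[of _ "if mtr A \<ge> 0 then r else - r"]) (auto simp: t_def)
  from someI_ex[OF this] show "eigenvalue A ^ 2 - mtr A * eigenvalue A + 1 = 0" "\<bar>eigenvalue A\<bar> > 1"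
    by (simp_all add: eigenvalue_def)
qed

text \<open>The projection onto the expanding eigenspace.\<close>

definition mproj :: "mat2 \<Rightarrow> mat2" where
  "mproj A = (let l = eigenvalue A in mscale (1 / (l - 1 / l)) (madd A (mscale (- 1 / l) mone)))"

definition mcoproj :: "mat2 \<Rightarrow> mat2" where
  "mcoproj A = madd mone (mscale (-1) (mproj A))"

lemma mat2_eq_iff: "A = B \<longleftrightarrow> m11 A = m11 B \<and> m12 A = m12 B \<and> m21 A = m21 B \<and> m22 A = m22 B"
  by (cases A; cases B) auto

lemma mproj_facts:
  assumes "mdet A = 1" "\<bar>mtr A\<bar> > 2"
  defines "l \<equiv> eigenvalue A"
  shows "mtr (mproj A) = 1" "mdet (mproj A) = 0"
    "A = madd (mscale l (mproj A)) (mscale (1 / l) (mcoproj A))" "l + 1 / l = mtr A"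
proof -
  have l: "l ^ 2 - mtr A * l + 1 = 0" "\<bar>l\<bar> > 1" unfolding l_def using eigenvalue[OF assms(2)] by blast+
  have l0: "l \<noteq> 0" using l by auto
  have "l ^ 2 \<noteq> 1" using l(2) by (auto simp: power2_eq_1_iff)
  then have d: "l - 1 / l \<noteq> 0" using l0 by (simp add: field_simps power2_eq_square)
  show t: "l + 1 / l = mtr A" using l(1) l0 by (simp add: field_simps power2_eq_square)
  define k where "k = 1 / l"
  have kl: "k * l = 1" "l - k \<noteq> 0" using l0 d by (simp_all add: k_def)
  obtain a b c e where A: "A = Mat2 a b c e" by (cases A)
  have tr: "a + e = l + k" and det: "a * e - b * c = 1" using t assms(1) by (simp_all add: A mtr_def mdet_def k_def)
  have "mproj A = mscale (1 / (l - 1 / l)) (madd A (mscale (- 1 / l) mone))"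
    by (simp only: mproj_def Let_def l_def)
  then have P: "mproj A = Mat2 ((a - k) / (l - k)) (b / (l - k)) (c / (l - k)) ((e - k) / (l - k))"
    by (simp add: A mscale_def madd_def mone_def k_def)
  have e: "e = l + k - a" using tr by simp
  show "mtr (mproj A) = 1" 
  proof -
    have "a - k + (e - k) = l - k" using e by simp
    then show ?thesis unfolding P mtr_def mat2.sel using kl(2) by (simp flip: add_divide_distrib)
  qed
  have "(a - k) * (e - k) = b * c" using det tr kl(1) by algebra
  then show "mdet (mproj A) = 0" 
    unfolding P mdet_def by (simp only: mat2.sel times_divide_times_eq)
  have x: "l * (x / (l - k)) - k * (x / (l - k)) = x" for x
  proof -
    have "l * (x / (l - k)) - k * (x / (l - k)) = (l - k) * (x / (l - k))" by (rule left_diff_distrib[symmetric])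
    then show ?thesis using kl(2) by simp
  qed
  show "A = madd (mscale l (mproj A)) (mscale (1 / l) (mcoproj A))"
  proof -
    define q1 q2 q3 q4 where q: "q1 = (a - k) / (l - k)" "q2 = b / (l - k)" "q3 = c / (l - k)" "q4 = (e - k) / (l - k)"
    have "l * q1 - k * q1 = a - k" "l * q2 - k * q2 = b" "l * q3 - k * q3 = c" "l * q4 - k * q4 = e - k"
      unfolding q by (rule x)+
    then show ?thesis
      unfolding mcoproj_def P k_def[symmetric] q[symmetric]
      by (simp add: A madd_def mscale_def mone_def algebra_simps)
  qed
qed

lemma mproj_idem:
  assumes "mdet A = 1" "\<bar>mtr A\<bar> > 2"
  shows "mproj A \<odot> mproj A = mproj A" "mproj A \<odot> mcoproj A = mzero" "mcoproj A \<odot> mproj A = mzero"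
    "mcoproj A \<odot> mcoproj A = mcoproj A"
proof -
  obtain a b c d where P: "mproj A = Mat2 a b c d" by (cases "mproj A")
  have 1: "a + d = 1" "a * d - b * c = 0" using mproj_facts[OF assms] by (simp_all add: P mtr_def mdet_def)
  have d: "d = 1 - a" using 1 by simp
  have "a * a + b * c = a" "a * b + b * d = b" "c * a + d * c = c" "c * b + d * d = d"
    using 1 by algebra+
  then show "mproj A \<odot> mproj A = mproj A" "mproj A \<odot> mcoproj A = mzero" "mcoproj A \<odot> mproj A = mzero"
    "mcoproj A \<odot> mcoproj A = mcoproj A"
    by (simp_all add: mcoproj_def P mmult_def mzero_def madd_def mscale_def mone_def algebra_simps)
qed

lemma mat2_power:
  assumes "mdet A = 1" "\<bar>mtr A\<bar> > 2"
  shows "A [^]\<^bsub>sl2\<^esub> (n::nat) = madd (mscale (eigenvalue A ^ n) (mproj A)) (mscale ((1 / eigenvalue A) ^ n) (mcoproj A))"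
proof (induction n)
  case 0
  have "madd (mproj A) (mcoproj A) = mone" by (simp add: mcoproj_def mat2_defs)
  then show ?case by (simp add: mscale_def)
next
  case (Suc n)
  let ?l = "eigenvalue A"
  have dist: "madd X Y \<odot> madd Z W = madd (madd (X \<odot> Z) (X \<odot> W)) (madd (Y \<odot> Z) (Y \<odot> W))" for X Y Z W
    by (simp add: mat2_defs algebra_simps)
  have sc: "mscale x X \<odot> mscale y Y = mscale (x * y) (X \<odot> Y)" for x y X Y
    by (simp add: mat2_defs algebra_simps)
  have z: "mscale x mzero = mzero" "madd X mzero = X" "madd mzero X = X" for x X
    by (simp_all add: mscale_def madd_def mzero_def)
  have "A [^]\<^bsub>sl2\<^esub> Suc n = A [^]\<^bsub>sl2\<^esub> n \<odot> A" by simp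
  also have "\<dots> = madd (mscale (?l ^ n) (mproj A)) (mscale ((1 / ?l) ^ n) (mcoproj A)) \<odot>
      madd (mscale ?l (mproj A)) (mscale (1 / ?l) (mcoproj A))"
    using Suc mproj_facts(3)[OF assms] by simp
  also have "\<dots> = madd (mscale (?l ^ Suc n) (mproj A)) (mscale ((1 / ?l) ^ Suc n) (mcoproj A))"
    unfolding dist sc mproj_idem[OF assms] z by (simp add: mult.commute)
  finally show ?case .
qed

text \<open>Pairing 0 means that the expanding line of one matrix is the contracting line of the
  other. Matrices with a common eigenline are simultaneously triangular, and their commutator has
  trace 2.\<close>

lemma mproj_pairing:
  assumes A: "mdet A = 1" "\<bar>mtr A\<bar> > 2" and B: "mdet B = 1" "\<bar>mtr B\<bar> > 2"
    and AB: "mtr (A \<odot> B \<odot> madj A \<odot> madj B) \<noteq> 2"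
  shows "mtr (mproj A \<odot> mproj B) \<noteq> 0"
proof
  assume 0: "mtr (mproj A \<odot> mproj B) = 0"
  define l k where "l = eigenvalue A" and "k = 1 / l"
  define m j where "m = eigenvalue B" and "j = 1 / m"
  obtain a b c d where P: "mproj A = Mat2 a b c d" by (cases "mproj A")
  obtain a' b' c' d' where Q: "mproj B = Mat2 a' b' c' d'" by (cases "mproj B")
  have l0: "l \<noteq> 0" "m \<noteq> 0" using eigenvalue(2)[OF A(2)] eigenvalue(2)[OF B(2)] by (auto simp: l_def m_def)
  have kl: "k * l = 1" "j * m = 1" using l0 by (simp_all add: k_def j_def)
  have tr: "mtr A = l + k" "mtr B = m + j"
    using mproj_facts(4)[OF A] mproj_facts(4)[OF B] by (simp_all add: l_def k_def m_def j_def)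
  have t: "a + d = 1" "a' + d' = 1" "a * a' + b * c' + (c * b' + d * d') = 0"
    using mproj_facts(1)[OF A] mproj_facts(1)[OF B] 0 by (simp_all add: P Q mtr_def mmult_def)
  have "mtr (A \<odot> B) = mtr (madd (mscale l (mproj A)) (mscale k (mcoproj A)) \<odot> madd (mscale m (mproj B)) (mscale j (mcoproj B)))"
    using mproj_facts(3)[OF A] mproj_facts(3)[OF B] by (simp add: l_def k_def m_def j_def)
  \<comment> \<open>When the projections pair to 0, so do the complementary ones, and each mixed
    pairing has trace 1.\<close>
  also have "\<dots> = l * j + k * m"
    unfolding P Q mcoproj_def mmult_def mtr_def madd_def mscale_def mone_def mat2.sel using t by algebra
  finally have ab: "mtr (A \<odot> B) = l * j + k * m" .
  have "mtr (A \<odot> B \<odot> madj A \<odot> madj B) = 2"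
    unfolding commutator_trace[OF A(1) B(1)] ab tr using kl by algebra
  then show False using AB by simp
qed

text \<open>Divided by the same powers of the expanding eigenvalues, large powers tend to the
  projections \<open>mproj\<close>, whose product is nonzero because neighbours pair nontrivially.
  If the power products were the identity for arbitrarily large exponents, the same normalisation
  would send them to 0.\<close>

theorem hyperbolic_independent:
  assumes us: "us \<noteq> []" "\<And>A. A \<in> set us \<Longrightarrow> mdet A = 1 \<and> \<bar>mtr A\<bar> > 2"
    and comm: "successively (\<lambda>A B. mtr (A \<odot> B \<odot> madj A \<odot> madj B) \<noteq> 2) us"
  shows "independent_tuple sl2 us"
proof (rule ccontr)
  assume "\<not> ?thesis"
  then have "\<forall>n::nat. \<exists>as::int list. length as = length us \<and> (\<forall>a\<in>set as. int n \<le> a) \<and> power_product sl2 us as = mone"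
    by (auto simp: independent_tuple_def)
  then obtain as where as: "\<And>n. length (as n) = length us" "\<And>n a. a \<in> set (as n) \<Longrightarrow> int n \<le> a"
    "\<And>n. power_product sl2 us (as n) = mone" by metis
  define e where "e n i = nat (as n ! i)" for n i
  have e: "n \<le> e n i" "as n ! i = int (e n i)" if "i < length us" for n i
    using as(2)[of "as n ! i" n] nth_mem[of i "as n"] as(1) that by (auto simp: e_def)
  \<comment> \<open>The normalised i-th power for the n-th choice of exponents, all of which are at
    least n.\<close>
  define F where "F i n = mscale ((1 / eigenvalue (us ! i)) ^ e n i) (us ! i [^]\<^bsub>sl2\<^esub> e n i)" for i n
  have lim: "mlim (F i) (mproj (us ! i))" if i: "i < length us" for i
  proof -
    let ?A = "us ! i" let ?l = "eigenvalue ?A"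
    have A: "mdet ?A = 1" "\<bar>mtr ?A\<bar> > 2" using us(2) i by auto
    have l: "\<bar>?l\<bar> > 1" using eigenvalue(2)[OF A(2)] .
    have F: "F i n = madd (mproj ?A) (mscale (((1 / ?l) ^ 2) ^ e n i) (mcoproj ?A))" for n
    proof -
      have "mscale x (madd (mscale y X) (mscale z Y)) = madd (mscale (x * y) X) (mscale (x * z) Y)" for x y z X Y
        by (simp add: mat2_defs algebra_simps)
      moreover have "(1 / ?l) ^ e n i * ?l ^ e n i = 1" using l by (auto simp flip: power_mult_distrib)
      moreover have "(1 / ?l) ^ e n i * (1 / ?l) ^ e n i = ((1 / ?l) ^ 2) ^ e n i"
        by (simp only: power2_eq_square power_mult_distrib)
      moreover have "mscale 1 X = X" for X by (simp add: mscale_def)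
      ultimately show ?thesis unfolding F_def mat2_power[OF A] by simp
    qed
    have "filterlim (\<lambda>n. e n i) at_top sequentially"
      using e(1)[OF i] by (intro filterlim_at_top_mono[OF filterlim_ident]) auto
    moreover have "(\<lambda>n. ((1 / ?l) ^ 2) ^ n) \<longlonglongrightarrow> 0"
    proof (rule LIMSEQ_power_zero)
      have "\<bar>1 / ?l\<bar> < 1" using l by (simp add: divide_less_eq_1)
      then have "\<bar>1 / ?l\<bar> ^ 2 < 1 ^ 2" by (intro power_strict_mono) simp_all
      then show "norm ((1 / ?l) ^ 2) < 1" by (simp only: real_norm_def power_abs power_one)
    qed
    ultimately have "(\<lambda>n. ((1 / ?l) ^ 2) ^ e n i) \<longlonglongrightarrow> 0"
      by (rule filterlim_compose[rotated])
    then show ?thesis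
      unfolding mlim_def F madd_def mscale_def mat2.sel
      by (auto intro!: tendsto_eq_intros)
  qed
  have "list_all2 mlim (map F [0..<length us]) (map mproj us)"
    using lim by (simp add: list_all2_conv_all_nth)
  from mlim_mprod[OF this]
  have lim: "mlim (\<lambda>n. mprod (map (\<lambda>i. F i n) [0..<length us])) (mprod (map mproj us))"
    by (simp add: comp_def)
  define c where "c n = (\<Prod>i<length us. (1 / eigenvalue (us ! i)) ^ e n i)" for n
  have prod: "mprod (map (\<lambda>i. F i n) [0..<length us]) = mscale (c n) mone" for n
  proof -
    have "mprod (map (\<lambda>i. F i n) [k..<length us]) =
        mscale (\<Prod>i\<in>{k..<length us}. (1 / eigenvalue (us ! i)) ^ e n i) (power_product sl2 (drop k us) (drop k (as n)))"
      if "k \<le> length us" for k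
      using that
    proof (induction k rule: inc_induct)
      case base
      then show ?case by (simp add: as(1) mscale_def mone_def)
    next
      case (step k)
      have d: "drop k us = us ! k # drop (Suc k) us" "drop k (as n) = as n ! k # drop (Suc k) (as n)"
        using step as(1) by (simp_all add: Cons_nth_drop_Suc)
      have s: "mscale x X \<odot> mscale y Y = mscale (x * y) (X \<odot> Y)" for x y X Y
        by (simp add: mat2_defs algebra_simps)
      have "mprod (map (\<lambda>i. F i n) [k..<length us]) = F k n \<odot> mprod (map (\<lambda>i. F i n) [Suc k..<length us])"
        using step by (simp add: upt_conv_Cons)
      also have "\<dots> = mscale ((1 / eigenvalue (us ! k)) ^ e n k * (\<Prod>i\<in>{Suc k..<length us}. (1 / eigenvalue (us ! i)) ^ e n i))
          (us ! k [^]\<^bsub>sl2\<^esub> e n k \<odot> power_product sl2 (drop (Suc k) us) (drop (Suc k) (as n)))"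
      proof -
        have "F k n = mscale ((1 / eigenvalue (us ! k)) ^ e n k) (us ! k [^]\<^bsub>sl2\<^esub> e n k)" by (simp only: F_def)
        then show ?thesis by (simp only: step.IH s)
      qed
      also have "\<dots> = mscale (\<Prod>i\<in>{k..<length us}. (1 / eigenvalue (us ! i)) ^ e n i) (power_product sl2 (drop k us) (drop k (as n)))"
        using step e(2)[of k n] by (simp add: d int_pow_int prod.atLeast_Suc_lessThan)
      finally show ?case .
    qed
    from this[of 0] show ?thesis by (simp add: as(3) c_def atLeast0LessThan)
  qed
  have "c \<longlonglongrightarrow> 0"
  proof -
    \<comment> \<open>The decay of the first factor is enough, the others being at most 1 in
      absolute value.\<close>
    have bound: "\<bar>c n\<bar> \<le> \<bar>1 / eigenvalue (us ! 0)\<bar> ^ n" for n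
    proof -
      have l: "\<bar>1 / eigenvalue (us ! i)\<bar> \<le> 1" if "i < length us" for i
        using us(2)[of "us ! i"] eigenvalue(2)[of "us ! i"] that by (simp add: divide_le_eq_1)
      have "\<bar>c n\<bar> = \<bar>1 / eigenvalue (us ! 0)\<bar> ^ e n 0 * (\<Prod>i\<in>{1..<length us}. \<bar>1 / eigenvalue (us ! i)\<bar> ^ e n i)"
        using us(1) unfolding c_def abs_prod power_abs atLeast0LessThan[symmetric]
        by (subst prod.atLeast_Suc_lessThan) simp_all
      also have "\<dots> \<le> \<bar>1 / eigenvalue (us ! 0)\<bar> ^ e n 0 * 1"
        using l by (intro mult_left_mono prod_le_1) (auto intro!: power_le_one)
      also have "\<dots> \<le> \<bar>1 / eigenvalue (us ! 0)\<bar> ^ n"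
        using l[of 0] e(1)[of 0 n] us(1) by (auto intro!: power_decreasing)
      finally show ?thesis .
    qed
    have lim0: "(\<lambda>n. \<bar>1 / eigenvalue (us ! 0)\<bar> ^ n) \<longlonglongrightarrow> 0"
      using us(2)[of "us ! 0"] eigenvalue(2)[of "us ! 0"] us(1)
      by (intro LIMSEQ_power_zero) (simp add: divide_less_eq_1)
    have "(\<lambda>n. \<bar>c n\<bar>) \<longlonglongrightarrow> 0"
      by (rule tendsto_sandwich[OF _ _ tendsto_const lim0])
        (rule always_eventually, simp, rule always_eventually, rule allI, rule bound)
    then show ?thesis by (rule tendsto_rabs_zero_cancel)
  qed
  then have "mlim (\<lambda>n. mscale (c n) mone) mzero"
    by (auto simp: mlim_def mscale_def mone_def mzero_def)
  then have "mprod (map mproj us) = mzero"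
    using lim unfolding prod mlim_def mat2_eq_iff by (meson LIMSEQ_unique)
  moreover have "mprod (map mproj us) \<noteq> mzero"
  proof (rule singular_chain_nonzero)
    show "mdet P = 0 \<and> P \<noteq> mzero" if "P \<in> set (map mproj us)" for P
    proof -
      have "\<exists>A\<in>set us. P = mproj A" using that by auto
      then obtain A where "A \<in> set us" "P = mproj A" by blast
      then have "mtr P = 1" "mdet P = 0" using us(2)[of A] mproj_facts(1,2)[of A] by auto
      then show ?thesis by (auto simp: mtr_def mzero_def)
    qed
    show "successively (\<lambda>P Q. mtr (P \<odot> Q) \<noteq> 0) (map mproj us)"
      unfolding successively_map
      by (rule successively_mono[OF comm]) (use us(2) mproj_pairing in blast)
  qed (use us(1) in simp)
  ultimately show False by contradiction
qed

subsection \<open>Free products over an abelian group\<close>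

text \<open>A one-parameter group, so an additive function on a group gives a homomorphism to
  \<open>sl2\<close>.\<close>

definition mdiag :: "real \<Rightarrow> mat2" where "mdiag c = Mat2 (exp c) 0 0 (exp (- c))"

text \<open>Rotation by pi/4 for e = 1 and its inverse for e = -1. The entries are nonzero, so
  rotated coordinate axes never coincide with coordinate axes.\<close>

definition mrot :: "int \<Rightarrow> mat2" where
  "mrot e = Mat2 (1 / sqrt 2) (- of_int e / sqrt 2) (of_int e / sqrt 2) (1 / sqrt 2)"

lemma mdiag_simps: "mdiag (a + b) = mdiag a \<odot> mdiag b" "mdet (mdiag a) = 1" "mdiag 0 = mone"
  by (simp_all add: mdiag_def mmult_def mdet_def mone_def algebra_simps flip: exp_add)

lemma mrot_simps: "mdet (mrot 1) = 1" "madj (mrot 1) = mrot (-1)" "mrot 1 \<odot> mrot (-1) = mone" "mrot (-1) \<odot> mrot 1 = mone"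
  by (simp_all add: mrot_def mdet_def madj_def mmult_def mone_def real_sqrt_mult_self field_simps)

lemma mrot_int_pow: "e = 1 \<or> e = -1 \<Longrightarrow> mrot 1 [^]\<^bsub>sl2\<^esub> e = mrot e"
  using mrot_simps by (auto simp: sl2.int_pow_neg inv_sl2)

definition mword :: "nat \<Rightarrow> (int \<times> real) list \<Rightarrow> mat2" where
  "mword n es = mprod (map (\<lambda>(e, c). mrot e \<odot> mdiag (of_nat n * c)) es)"

lemma mprod_append: "mprod (As @ Bs) = mprod As \<odot> mprod Bs"
  by (induction As) (simp_all add: mmult_assoc)

lemma filterlim_abs_mult_exp:
  assumes "X \<longlonglongrightarrow> x" "x \<noteq> 0" "0 < (r::real)"
  shows "filterlim (\<lambda>n. \<bar>exp (of_nat n * r) * X n\<bar>) at_top sequentially"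
proof -
  have "filterlim (\<lambda>n. exp (of_nat n * r)) at_top sequentially"
    using assms(3)
    by (intro filterlim_compose[OF exp_at_top] filterlim_at_top_mult_tendsto_pos[OF tendsto_const _ filterlim_real_sequentially]) auto
  moreover have "(\<lambda>n. \<bar>X n\<bar>) \<longlonglongrightarrow> \<bar>x\<bar>" using assms(1) by (rule tendsto_rabs)
  ultimately have "filterlim (\<lambda>n. exp (of_nat n * r) * \<bar>X n\<bar>) at_top sequentially"
    using assms(2) filterlim_at_top_mult_tendsto_pos[of "\<lambda>n. \<bar>X n\<bar>" "\<bar>x\<bar>" sequentially "\<lambda>n. exp (of_nat n * r)"]
    by simp
  then show ?thesis by (simp add: abs_mult)
qed

text \<open>Divided by exp (n r), with r the sum of the absolute values of the coefficients, the
  word tends to a product of singular matrices. Cyclic neighbours among them pair nontrivially since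
  rotations have no zero entry, so the limit has nonzero trace and the trace itself grows like exp
  (n r).\<close>

lemma trace_growth_reduced:
  assumes "es \<noteq> []" "\<And>x. x \<in> set es \<Longrightarrow> (fst x = 1 \<or> fst x = -1) \<and> snd x \<noteq> 0"
  shows "filterlim (\<lambda>n. \<bar>mtr (mword n es)\<bar>) at_top sequentially"
proof -
  \<comment> \<open>The limit of mdiag (n c) divided by its larger entry.\<close>
  define E where "E c = (if c > 0 then Mat2 1 0 0 0 else Mat2 0 0 0 1)" for c :: real
  define F where "F x n = mscale (exp (- of_nat n * \<bar>snd x\<bar>)) (mrot (fst x) \<odot> mdiag (of_nat n * snd x))" for x :: "int \<times> real" and n
  define P where "P x = mrot (fst x) \<odot> E (snd x)" for x :: "int \<times> real"
  have decay: "(\<lambda>n. exp (- (of_nat n * r))) \<longlonglongrightarrow> 0" if "r > 0" for r :: real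
  proof -
    have "(\<lambda>n. exp (- r) ^ n) \<longlonglongrightarrow> 0" using that by (intro LIMSEQ_power_zero) simp
    then show ?thesis by (simp add: exp_of_nat_mult[symmetric])
  qed
  have lim: "mlim (F x) (P x)" if x: "x \<in> set es" for x
  proof -
    obtain e c where ec: "x = (e, c)" by fastforce
    have c: "c \<noteq> 0" using assms(2)[OF x] ec by simp
    have "mlim (\<lambda>n. mscale (exp (- of_nat n * \<bar>c\<bar>)) (mdiag (of_nat n * c))) (E c)"
    proof (cases "c > 0")
      case True
      have "exp (- (real n * c)) * exp (- (real n * c)) = exp (- (real n * (2 * c)))" for n
        by (simp flip: exp_add)
      then show ?thesis
        using True decay[of "2 * c"] by (simp add: mlim_def mscale_def mdiag_def E_def mult_ac flip: exp_add)
    next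
      case False
      have "exp (real n * c) * exp (real n * c) = exp (- (real n * (2 * - c)))" for n
        by (simp flip: exp_add)
      then show ?thesis
        using False c decay[of "2 * - c"] by (simp add: mlim_def mscale_def mdiag_def E_def mult_ac flip: exp_add)
    qed
    then have "mlim (\<lambda>n. mrot e \<odot> mscale (exp (- of_nat n * \<bar>c\<bar>)) (mdiag (of_nat n * c))) (mrot e \<odot> E c)"
      by (intro mlim_mmult mlim_const)
    moreover have "A \<odot> mscale r B = mscale r (A \<odot> B)" for A r B by (simp add: mat2_defs algebra_simps)
    ultimately show ?thesis by (simp add: F_def[abs_def] P_def ec)
  qed
  have "list_all2 mlim (map F es) (map P es)"
    using lim by (simp add: list_all2_conv_all_nth)
  from mlim_mtr[OF mlim_mprod[OF this]]
  have "(\<lambda>n. mtr (mprod (map (\<lambda>x. F x n) es))) \<longlonglongrightarrow> mtr (mprod (map P es))"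
    by (simp add: comp_def)
  moreover define r where "r = (\<Sum>x\<leftarrow>es. \<bar>snd x\<bar>)"
  have "mtr (mprod (map (\<lambda>x. F x n) es)) = exp (- of_nat n * r) * mtr (mword n es)" for n
  proof -
    have "mprod (map (\<lambda>x. F x n) es) = mscale (exp (- of_nat n * r)) (mword n es)"
      unfolding r_def mword_def
      by (induction es) (auto simp: F_def mat2_defs algebra_simps exp_add exp_diff case_prod_unfold exp_minus field_simps)
    then show ?thesis by (simp add: mtr_def mscale_def algebra_simps)
  qed
  ultimately have "(\<lambda>n. exp (- of_nat n * r) * mtr (mword n es)) \<longlonglongrightarrow> mtr (mprod (map P es))" by simp
  moreover have "mtr (mprod (map P es)) \<noteq> 0"
  proof -
    have good: "mdet (P x) = 0 \<and> P x \<noteq> mzero \<and> mtr (P x \<odot> P y) \<noteq> 0" if "x \<in> set es" "y \<in> set es" for x y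
      using assms(2)[OF that(1)] assms(2)[OF that(2)]
      by (auto simp: P_def E_def mrot_def mat2_defs mzero_def)
    obtain x xs where es: "es = x # xs" using assms(1) by (cases es) auto
    have succ: "successively (\<lambda>A B. mtr (A \<odot> B) \<noteq> 0) (map P ys)" if "set ys \<subseteq> set es" for ys
      using that by (induction ys rule: induct_list012) (auto simp: good)
    have "successively (\<lambda>A B. mtr (A \<odot> B) \<noteq> 0) (P x # map P xs @ [P x])"
      using succ[of "x # xs @ [x]"] by (simp add: es)
    moreover have "mdet A = 0 \<and> A \<noteq> mzero" if "A \<in> set (P x # map P xs)" for A
    proof -
      have "\<exists>y\<in>set es. A = P y" using that by (auto simp: es)
      then obtain y where "y \<in> set es" "A = P y" by blast
      then show ?thesis using good[of y y] by simp
    qed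
    ultimately have "mtr (mprod (P x # map P xs)) \<noteq> 0" by (rule singular_cycle_trace[where P = "P x" and Ps = "map P xs", rotated])
    then show ?thesis by (simp add: es)
  qed
  moreover have "r > 0"
  proof -
    obtain x xs where es: "es = x # xs" using assms(1) by (cases es) auto
    have "\<bar>snd x\<bar> > 0" using assms(2)[of x] es by simp
    moreover have "(\<Sum>x\<leftarrow>xs. \<bar>snd x\<bar>) \<ge> 0" by (intro sum_list_nonneg) auto
    ultimately show ?thesis by (simp add: r_def es)
  qed
  ultimately have "filterlim (\<lambda>n. \<bar>exp (of_nat n * r) * (exp (- of_nat n * r) * mtr (mword n es))\<bar>) at_top sequentially"
    by (rule filterlim_abs_mult_exp)
  then show ?thesis by (simp add: exp_minus_inverse flip: mult.assoc exp_add)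
qed

lemma filterlim_mtr_mdiag:
  assumes "c \<noteq> 0"
  shows "filterlim (\<lambda>n. \<bar>mtr (mdiag (of_nat n * c))\<bar>) at_top sequentially"
proof (rule filterlim_at_top_mono)
  show "filterlim (\<lambda>n. \<bar>exp (of_nat n * \<bar>c\<bar>) * 1\<bar>) at_top sequentially"
    using filterlim_abs_mult_exp[of "\<lambda>_. 1" 1 "\<bar>c\<bar>"] assms by simp
  show "\<forall>\<^sub>F n in sequentially. \<bar>exp (of_nat n * \<bar>c\<bar>) * 1\<bar> \<le> \<bar>mtr (mdiag (of_nat n * c))\<bar>"
  proof (intro always_eventually allI)
    fix n
    have "exp (of_nat n * \<bar>c\<bar>) \<le> exp (of_nat n * c) + exp (- (of_nat n * c))"
      by (cases "c \<ge> 0") simp_all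
    then show "\<bar>exp (of_nat n * \<bar>c\<bar>) * 1\<bar> \<le> \<bar>mtr (mdiag (of_nat n * c))\<bar>"
      by (simp add: mtr_def mdiag_def abs_of_pos add_pos_pos)
  qed
qed

text \<open>When the last letter is trivial, the word cancels cyclically to a shorter one.\<close>

lemma trace_growth:
  assumes "es \<noteq> []" "alternating es" "even (length es)" "\<And>x. x \<in> set (butlast es) \<Longrightarrow> snd x \<noteq> 0"
  shows "filterlim (\<lambda>n. \<bar>mtr (mword n es)\<bar>) at_top sequentially"
  using assms
proof (induction "length es" arbitrary: es rule: less_induct)
  case less
  have signs: "fst x = 1 \<or> fst x = -1" if "x \<in> set es" for x
    using less.prems(2) that by (auto simp: alternating_def)
  show ?case
  proof (cases "snd (last es) = 0")
    case False
    then have "snd x \<noteq> 0" if "x \<in> set es" for x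
    proof -
      have "x \<in> set (butlast es) \<or> x = last es"
        using that by (cases es rule: rev_cases) auto
      then show ?thesis using less.prems(4) False by blast
    qed
    then show ?thesis using signs less.prems(1) by (intro trace_growth_reduced) auto
  next
    case True
    obtain e c es1 where es1: "es = (e, c) # es1" using less.prems(1) by (cases es) auto
    have "es1 \<noteq> []" using less.prems(3) es1 by auto
    then obtain e' es2 where es2: "es1 = es2 @ [(e', 0)]"
      using True es1 by (cases es1 rule: rev_cases) auto
    \<comment> \<open>In an alternating word of even length the first and the last exponent are
      opposite, so the rotations at the two ends cancel cyclically.\<close>
    have parity: "fst (last xs) = (if even (length xs) then - e0 else e0)"
      if "alternating xs" "xs \<noteq> []" "fst (hd xs) = e0" for xs :: "(int \<times> real) list" and e0
      using that
    proof (induction xs arbitrary: e0)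
      case (Cons x xs)
      show ?case
      proof (cases xs)
        case (Cons y ys)
        then show ?thesis using Cons.IH[of "- e0"] Cons.prems by (auto simp: alternating_def)
      qed (use Cons.prems in auto)
    qed simp
    have e': "e' = - e" using parity[of es e] less.prems(1-3) by (simp add: es1 es2)
    have cancel: "mrot e' \<odot> mrot e = mone" using signs[of "(e, c)"] e' mrot_simps by (auto simp: es1)
    define W where "W n = mprod (map (\<lambda>(e, c). mrot e \<odot> mdiag (of_nat n * c)) es2)" for n
    have "mtr (mword n es) = mtr (mdiag (of_nat n * c) \<odot> W n)" for n
    proof -
      have "mword n es = mrot e \<odot> (mdiag (of_nat n * c) \<odot> W n \<odot> mrot e')"
        by (simp add: mword_def es1 es2 mprod_append W_def mdiag_simps mmult_assoc del: foldr_append)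
      also have "mtr \<dots> = mtr (mdiag (of_nat n * c) \<odot> W n \<odot> mrot e' \<odot> mrot e)" by (rule mtr_commute)
      also have "\<dots> = mtr (mdiag (of_nat n * c) \<odot> W n)" by (simp add: mmult_assoc cancel)
      finally show ?thesis .
    qed
    note tr = this
    have c: "c \<noteq> 0" using less.prems(4)[of "(e, c)"] by (simp add: es1 es2)
    show ?thesis
    proof (cases es2 rule: rev_cases)
      case Nil
      then show ?thesis using filterlim_mtr_mdiag[OF c] by (simp add: tr W_def)
    next
      case (snoc es3 x)
      obtain a b where x: "x = (a, b)" by fastforce
      \<comment> \<open>The first coefficient c joins the last remaining one. Their sum may be 0,
        which is why the induction leaves the last coefficient free.\<close>
      let ?es = "es3 @ [(a, b + c)]"
      have "mtr (mdiag (of_nat n * c) \<odot> W n) = mtr (mword n ?es)" for n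
      proof -
        have "mtr (mdiag (of_nat n * c) \<odot> W n) = mtr (W n \<odot> mdiag (of_nat n * c))" by (rule mtr_commute)
        also have "W n \<odot> mdiag (of_nat n * c) = mword n ?es"
          by (simp add: W_def snoc x mword_def mprod_append distrib_left mdiag_simps(1) mmult_assoc del: foldr_append)
        finally show ?thesis .
      qed
      moreover have "filterlim (\<lambda>n. \<bar>mtr (mword n ?es)\<bar>) at_top sequentially"
      proof (rule less.hyps)
        have "successively (\<lambda>x y. fst y = - fst x) ?es"
          using less.prems(2)
          by (auto simp: alternating_def es1 es2 snoc x successively_append_iff successively_Cons)
        then show "alternating ?es"
          using less.prems(2) by (auto simp: alternating_def es1 es2 snoc x)
        show "snd y \<noteq> 0" if "y \<in> set (butlast ?es)" for y
          using that less.prems(4)[of y] by (auto simp: es1 es2 snoc butlast_append)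
      qed (use less.prems(3) in \<open>auto simp: es1 es2 snoc\<close>)
      ultimately show ?thesis by (simp add: tr)
    qed
  qed
qed

text \<open>In an abelian group of series all elements commute with one nontrivial u, so their
  coefficients between degrees 1 and k+1 vanish and the coefficient at k+1 is additive. It is
  injective by \<open>commuting_series_eq\<close>, and a generic real functional on \<complex> is
  nonzero at finitely many nonzero values.\<close>

lemma additive_functional:
  fixes \<Phi> :: "'a \<Rightarrow> 'b::{idom,ring_char_0} fps" and \<theta> :: "'b \<Rightarrow> complex"
  assumes G: "group G" and \<Phi>: "\<Phi> \<in> mon G series_mon" and \<theta>: "ring_hom1 \<theta>" "inj \<theta>"
    and comm: "\<And>x y. x \<in> carrier G \<Longrightarrow> y \<in> carrier G \<Longrightarrow> x \<otimes>\<^bsub>G\<^esub> y = y \<otimes>\<^bsub>G\<^esub> x"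
    and E: "finite E" "E \<subseteq> carrier G - {\<one>\<^bsub>G\<^esub>}"
  shows "\<exists>\<chi> :: 'a \<Rightarrow> real. (\<forall>x\<in>carrier G. \<forall>y\<in>carrier G. \<chi> (x \<otimes>\<^bsub>G\<^esub> y) = \<chi> x + \<chi> y) \<and> (\<forall>x\<in>E. \<chi> x \<noteq> 0)"
proof (cases "carrier G = {\<one>\<^bsub>G\<^esub>}")
  case True
  then show ?thesis using E by (intro exI[of _ "\<lambda>_. 0"]) auto
next
  case False
  interpret group_hom G series_mon \<Phi>
    using \<Phi> G by (simp add: group_hom_def group_hom_axioms_def mon_def group_series_mon)
  obtain u where u: "u \<in> carrier G" "u \<noteq> \<one>\<^bsub>G\<^esub>" using False by auto
  have tu: "tid (\<Phi> u)" "\<Phi> u \<noteq> fps_X"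
    using hom_closed[OF u(1)] mon_nontrivial[OF G group_series_mon \<Phi> u] by simp_all
  obtain k where k: "0 < k" "\<Phi> u $ Suc k \<noteq> 0" "\<And>l. 1 < l \<Longrightarrow> l \<le> k \<Longrightarrow> \<Phi> u $ l = 0"
    using series_order tu by blast
  have commutes: "\<Phi> x oo \<Phi> u = \<Phi> u oo \<Phi> x" if "x \<in> carrier G" for x
    using hom_mult[OF that u(1)] hom_mult[OF u(1) that] comm[OF that u(1)] by simp
  have low: "\<Phi> x $ l = 0" if "x \<in> carrier G" "1 < l" "l \<le> k" for x l
    using commuting_series_low[OF tu(1) k(2,1) hom_closed[OF that(1)] commutes[OF that(1)] k(3) that(2,3)] .
  define z where "z x = \<theta> (\<Phi> x $ Suc k)" for x
  have add: "z (x \<otimes>\<^bsub>G\<^esub> y) = z x + z y" if "x \<in> carrier G" "y \<in> carrier G" for x y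
    using compose_nth_low[OF hom_closed[OF that(1)] hom_closed[OF that(2)] k(1) low[OF that(1)], of "Suc k"]
      k(1) hom_mult[OF that] by (simp add: z_def ring_hom1.add[OF \<theta>(1)])
  have inj_z: "z x \<noteq> 0" if x: "x \<in> carrier G" "x \<noteq> \<one>\<^bsub>G\<^esub>" for x
  proof
    assume "z x = 0"
    then have "\<Phi> x $ Suc k = 0"
      using injD[OF \<theta>(2), of _ 0] by (simp add: z_def ring_hom1.zero[OF \<theta>(1)])
    then have eq: "\<Phi> x $ l = fps_X $ l" if "l \<le> Suc k" for l
      using low[OF x(1), of l] that hom_closed[OF x(1)] k(1)
      by (cases "l \<le> 1"; cases "l = Suc k") (auto simp: tid_iff fps_X_def le_Suc_eq)
    have X: "tid (fps_X :: 'b fps)" "fps_X oo \<Phi> u = \<Phi> u oo fps_X"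
      using tu(1) by (simp_all add: tid_iff)
    have "\<Phi> x = fps_X"
      by (rule commuting_series_eq[OF tu(1) k(3,2,1) hom_closed[OF x(1)] commutes[OF x(1)] X eq])
    then show False using mon_nontrivial[OF G group_series_mon \<Phi> x] by simp
  qed
  \<comment> \<open>The slopes m for which Re - m Im vanishes at z x; there is at most one.\<close>
  define B where "B x = {m::nat. Re (z x) = of_nat m * Im (z x)}" for x
  have "finite (B x)" if "x \<in> E" for x
  proof -
    have "z x \<noteq> 0" using inj_z E that by auto
    then have "m = m'" if "m \<in> B x" "m' \<in> B x" for m m'
      using that by (cases "Im (z x) = 0") (auto simp: B_def complex_eq_iff)
    then have "is_singleton (B x) \<or> B x = {}" by (metis is_singletonI' )
    then show ?thesis by (auto elim: is_singletonE)
  qed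
  then have "finite (\<Union>x\<in>E. B x)" using E(1) by blast
  then obtain m where m: "m \<notin> (\<Union>x\<in>E. B x)" using ex_new_if_finite infinite_UNIV_nat by blast
  show ?thesis
    using m add by (intro exI[of _ "\<lambda>x. Re (z x) - of_nat m * Im (z x)"]) (auto simp: B_def algebra_simps)
qed

text \<open>Map G to diagonal matrices through a character and conjugate the second factor by a
  rotation. After enough scaling of the character, the entries of the tuple and the commutators of
  neighbours are hyperbolic, and independence is pulled back from \<open>sl2\<close>.\<close>

theorem abelian_free_step_BP:
  fixes \<Phi> :: "'a \<Rightarrow> 'b::{idom,ring_char_0} fps" and \<theta> :: "'b \<Rightarrow> complex"
  assumes ext: "group_ext G H" and \<Phi>: "\<Phi> \<in> mon G series_mon" and \<theta>: "ring_hom1 \<theta>" "inj \<theta>"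
    and code: "has_code G H {\<one>\<^bsub>G\<^esub>} code" and lift: "lifts_to G H {\<one>\<^bsub>G\<^esub>} code sl2"
    and alt: "\<And>x. alternating (snd (code x))" "\<And>x. even (length (snd (code x)))"
    and comm: "\<And>x y. x \<in> carrier G \<Longrightarrow> y \<in> carrier G \<Longrightarrow> x \<otimes>\<^bsub>G\<^esub> y = y \<otimes>\<^bsub>G\<^esub> x"
  shows "BP_group H"
  unfolding BP_group_def
proof (intro conjI allI impI)
  note extD = group_extD[OF ext]
  show H: "group H" by (rule extD(2))
  interpret G: group G by (rule extD(1))
  fix us assume us: "commutation_free H us"
  \<comment> \<open>Commutators are included because \<open>hyperbolic_independent\<close> asks for
    commutator traces other than 2.\<close>
  define S where "S = set us \<union> {commutator H (us ! i) (us ! Suc i) | i. Suc i < length us}"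
  have S: "finite S" "S \<subseteq> carrier H - {\<one>\<^bsub>H\<^esub>}"
    unfolding S_def by (rule commutation_free_finite, rule commutation_free_witnesses[OF H us])
  \<comment> \<open>The inner coefficients of proper words, and the elements of S that lie in G and
    are their own coefficient.\<close>
  define E where "E = (\<Union>x\<in>S. snd ` set (butlast (snd (code x)))) \<union> fst ` code ` {x\<in>S. snd (code x) = []}"
  have "finite E" using S(1) by (simp add: E_def)
  moreover have "E \<subseteq> carrier G - {\<one>\<^bsub>G\<^esub>}"
  proof
    fix g assume "g \<in> E"
    then consider x y where "x \<in> S" "y \<in> set (butlast (snd (code x)))" "g = snd y"
      | x where "x \<in> S" "snd (code x) = []" "g = fst (code x)"
      unfolding E_def by blast
    then show "g \<in> carrier G - {\<one>\<^bsub>G\<^esub>}"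
    proof cases
      case 1
      then have "x \<in> carrier H" using S(2) by blast
      from has_codeD(3)[OF code this in_set_butlastD[OF 1(2)]] has_codeD(6)[OF code this 1(2)]
      show ?thesis using 1(3) by simp
    next
      case 2
      then show ?thesis using has_codeD(2)[OF code, of x] has_codeD(5)[OF code, of x "\<one>\<^bsub>G\<^esub>"] S(2) extD(4) by auto
    qed
  qed
  ultimately obtain \<chi> :: "'a \<Rightarrow> real" where \<chi>: "\<And>x y. x \<in> carrier G \<Longrightarrow> y \<in> carrier G \<Longrightarrow> \<chi> (x \<otimes>\<^bsub>G\<^esub> y) = \<chi> x + \<chi> y"
    "\<And>x. x \<in> E \<Longrightarrow> \<chi> x \<noteq> 0"
    using additive_functional[OF G.group_axioms \<Phi> \<theta> comm, of E] by blast
  have "\<chi> \<one>\<^bsub>G\<^esub> = 0" using \<chi>(1)[of "\<one>\<^bsub>G\<^esub>" "\<one>\<^bsub>G\<^esub>"] by simp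
  \<comment> \<open>One homomorphism for each n; scaling by n drives the traces of all elements of S
    to infinity together.\<close>
  have lifts: "\<exists>\<Psi>\<in>hom H sl2. \<forall>x\<in>carrier H. \<Psi> x = word_val sl2 (mrot 1) (mdiag (of_nat n * \<chi> (fst (code x))))
      (map (apsnd (\<lambda>g. mdiag (of_nat n * \<chi> g))) (snd (code x)))" for n
  proof -
    have hom: "(\<lambda>g. mdiag (of_nat n * \<chi> g)) \<in> hom G sl2"
      by (rule homI) (simp_all add: mdiag_simps \<chi>(1) distrib_left)
    have c: "\<forall>c\<in>{\<one>\<^bsub>G\<^esub>}. mdiag (of_nat n * \<chi> c) \<otimes>\<^bsub>sl2\<^esub> mrot 1 = mrot 1 \<otimes>\<^bsub>sl2\<^esub> mdiag (of_nat n * \<chi> c)"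
      using \<open>\<chi> \<one>\<^bsub>G\<^esub> = 0\<close> by (simp add: mdiag_simps)
    have "mrot 1 \<in> carrier sl2" by (simp add: mrot_simps)
    from bspec[OF bspec[OF lift[unfolded lifts_to_def] hom] this, THEN mp, OF c]
    show ?thesis .
  qed
  have growth: "filterlim (\<lambda>n. \<bar>mtr (word_val sl2 (mrot 1) (mdiag (of_nat n * \<chi> (fst (code x))))
      (map (apsnd (\<lambda>g. mdiag (of_nat n * \<chi> g))) (snd (code x))))\<bar>) at_top sequentially" if x: "x \<in> S" for x
  proof (cases "snd (code x)" rule: rev_cases)
    case Nil
    then have "fst (code x) \<in> E" using x by (auto simp: E_def)
    then show ?thesis using filterlim_mtr_mdiag[OF \<chi>(2)] Nil by (simp add: word_val_def)
  next
    case (snoc bs y)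
    obtain e g where y: "y = (e, g)" by fastforce
    define g0 where "g0 = \<chi> (fst (code x))"
    define cs where "cs = map (apsnd \<chi>) bs"
    \<comment> \<open>The trace is cyclic, so the leading coefficient moves to the end and joins the
      last one.\<close>
    let ?es = "cs @ [(e, \<chi> g + g0)]"
    have sg: "fst y = 1 \<or> fst y = -1" if "y \<in> set (snd (code x))" for y
      using alt(1)[of x] that by (auto simp: alternating_def)
    have w: "foldr (\<lambda>(e, g) y. mrot 1 [^]\<^bsub>sl2\<^esub> e \<otimes>\<^bsub>sl2\<^esub> g \<otimes>\<^bsub>sl2\<^esub> y) (map (apsnd (\<lambda>g. mdiag (of_nat n * \<chi> g))) zs) \<one>\<^bsub>sl2\<^esub>
        = mword n (map (apsnd \<chi>) zs)" if "set zs \<subseteq> set (snd (code x))" for n zs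
      using that sg by (induction zs) (auto simp: mword_def mrot_int_pow)
    have "mtr (word_val sl2 (mrot 1) (mdiag (of_nat n * \<chi> (fst (code x))))
        (map (apsnd (\<lambda>g. mdiag (of_nat n * \<chi> g))) (snd (code x)))) = mtr (mword n ?es)" for n
    proof -
      have "mtr (mdiag (of_nat n * g0) \<odot> mword n (map (apsnd \<chi>) (snd (code x)))) =
          mtr (mword n (map (apsnd \<chi>) (snd (code x))) \<odot> mdiag (of_nat n * g0))" by (rule mtr_commute)
      also have "mword n (map (apsnd \<chi>) (snd (code x))) \<odot> mdiag (of_nat n * g0) = mword n ?es"
        by (simp add: snoc y mword_def mprod_append cs_def distrib_left mdiag_simps(1) mmult_assoc del: foldr_append)
      finally show ?thesis using w[of "snd (code x)" n] by (simp add: word_val_def g0_def)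
    qed
    moreover have "filterlim (\<lambda>n. \<bar>mtr (mword n ?es)\<bar>) at_top sequentially"
    proof (rule trace_growth)
      have "successively (\<lambda>x y. fst y = - fst x) ?es"
        using alt(1)[of x]
        by (cases "bs = []") (auto simp: alternating_def snoc y cs_def successively_append_iff successively_map last_map)
      then show "alternating ?es"
        using alt(1)[of x] by (auto simp: alternating_def snoc y cs_def)
      show "even (length ?es)" using alt(2)[of x] by (simp add: snoc cs_def)
      show "snd z \<noteq> 0" if "z \<in> set (butlast ?es)" for z
      proof -
        obtain z' where "z' \<in> set bs" "snd z = \<chi> (snd z')" using \<open>z \<in> set (butlast ?es)\<close> by (auto simp: cs_def)
        moreover have "snd z' \<in> E" using x \<open>z' \<in> set bs\<close> by (force simp: E_def snoc)
        ultimately show ?thesis using \<chi>(2) by simp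
      qed
    qed simp
    ultimately show ?thesis by simp
  qed
  have "\<forall>\<^sub>F n in sequentially. \<forall>x\<in>S. 3 \<le> \<bar>mtr (word_val sl2 (mrot 1) (mdiag (of_nat n * \<chi> (fst (code x))))
      (map (apsnd (\<lambda>g. mdiag (of_nat n * \<chi> g))) (snd (code x))))\<bar>"
    using growth S(1) by (intro eventually_ball_finite) (auto simp: filterlim_at_top)
  then obtain n where n: "\<And>x. x \<in> S \<Longrightarrow> 3 \<le> \<bar>mtr (word_val sl2 (mrot 1) (mdiag (of_nat n * \<chi> (fst (code x))))
      (map (apsnd (\<lambda>g. mdiag (of_nat n * \<chi> g))) (snd (code x))))\<bar>"
    by (auto simp: eventually_sequentially)
  obtain \<Psi> where \<Psi>: "\<Psi> \<in> hom H sl2" "\<And>x. x \<in> S \<Longrightarrow> 3 \<le> \<bar>mtr (\<Psi> x)\<bar>"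
    using lifts[of n] n S(2) by (metis DiffD1 subsetD)
  interpret Psi: group_hom H sl2 \<Psi> using \<Psi>(1) H group_sl2 by (simp add: group_hom_def group_hom_axioms_def)
  have sub: "set us \<subseteq> carrier H" using us by (auto simp: commutation_free_def)
  have "independent_tuple sl2 (map \<Psi> us)"
  proof (rule hyperbolic_independent)
    show "map \<Psi> us \<noteq> []" using us by (simp add: commutation_free_def)
    fix A assume "A \<in> set (map \<Psi> us)"
    then obtain x where x: "x \<in> set us" "A = \<Psi> x" by auto
    then show "mdet A = 1 \<and> \<bar>mtr A\<bar> > 2" using \<Psi>(2)[of x] Psi.hom_closed[of x] sub by (auto simp: S_def)
  next
    have "mtr (\<Psi> (us ! i) \<odot> \<Psi> (us ! Suc i) \<odot> madj (\<Psi> (us ! i)) \<odot> madj (\<Psi> (us ! Suc i))) \<noteq> 2"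
      if i: "Suc i < length us" for i
    proof -
      have mem: "us ! i \<in> carrier H" "us ! Suc i \<in> carrier H"
        using sub nth_mem[of i us] nth_mem[OF i] i by auto
      then have "mdet (\<Psi> (us ! i)) = 1" "mdet (\<Psi> (us ! Suc i)) = 1" using Psi.hom_closed by force+
      then have "\<Psi> (commutator H (us ! i) (us ! Suc i)) =
          \<Psi> (us ! i) \<odot> \<Psi> (us ! Suc i) \<odot> madj (\<Psi> (us ! i)) \<odot> madj (\<Psi> (us ! Suc i))"
        using Psi.hom_commutator[OF mem] by (simp add: commutator_def inv_sl2)
      moreover have "commutator H (us ! i) (us ! Suc i) \<in> S" using i by (auto simp: S_def)
      ultimately show ?thesis using \<Psi>(2) by fastforce
    qed
    then show "successively (\<lambda>A B. mtr (A \<odot> B \<odot> madj A \<odot> madj B) \<noteq> 2) (map \<Psi> us)"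
      by (simp add: successively_conv_nth)
  qed
  then show "independent_tuple H us"
    by (rule independent_tuple_hom[OF H group_sl2 \<Psi>(1) sub])
qed

subsection \<open>Embedding a domain of cardinality at most the continuum into the complex numbers\<close>

lemma lists_ordLeq:
  assumes "infinite B"
  shows "|lists B| \<le>o |B|"
proof -
  have step: "|{xs. set xs \<subseteq> B \<and> length xs = n}| \<le>o |B|" for n
  proof (induction n)
    case 0
    have "{xs. set xs \<subseteq> B \<and> length xs = 0} = {[]}" by auto
    then show ?case using assms by (simp add: card_of_singl_ordLeq infinite_imp_nonempty)
  next
    case (Suc n)
    have "{xs. set xs \<subseteq> B \<and> length xs = Suc n} \<subseteq>
        (\<lambda>(x, xs). x # xs) ` (B \<times> {xs. set xs \<subseteq> B \<and> length xs = n})"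
      by (auto simp: length_Suc_conv image_iff)
    then have "|{xs. set xs \<subseteq> B \<and> length xs = Suc n}| \<le>o |B \<times> {xs. set xs \<subseteq> B \<and> length xs = n}|"
      using surj_imp_ordLeq by blast
    also have "|B \<times> {xs. set xs \<subseteq> B \<and> length xs = n}| \<le>o |B \<times> B|"
      by (rule card_of_Times_mono2[OF Suc])
    also have "|B \<times> B| =o |B|" by (rule card_of_Times_same_infinite[OF assms])
    finally show ?case .
  qed
  have "lists B = (\<Union>n. {xs. set xs \<subseteq> B \<and> length xs = n})" by auto
  moreover have "|\<Union>n. {xs. set xs \<subseteq> B \<and> length xs = n}| \<le>o |B|"
    using assms step by (intro card_of_UNION_ordLeq_infinite) (auto simp: infinite_iff_card_of_nat)
  ultimately show ?thesis by simp
qed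

lemma sums_of_products_ordLeq:
  assumes "infinite B"
  shows "|(\<lambda>xss. \<Sum>xs\<leftarrow>xss. prod_list xs) ` lists (lists B)| \<le>o |B|"
proof -
  have "infinite ((\<lambda>x. [x]) ` B)" using assms by (auto dest: finite_imageD simp: inj_on_def)
  then have "infinite (lists B)" by (rule infinite_super[rotated]) auto
  then have "|lists (lists B)| \<le>o |lists B|" by (rule lists_ordLeq)
  then have "|lists (lists B)| \<le>o |B|" using lists_ordLeq[OF assms] ordLeq_transitive by blast
  then show ?thesis using card_of_image ordLeq_transitive by blast
qed

text \<open>Sums of products, coded as lists of lists, are closed under addition and multiplication.
  The size of the image is thereby bounded through that of the set of generators.\<close>

lemma mpoly_image_sums_of_products:
  fixes f :: "('x, 'c::comm_ring_1) mpoly \<Rightarrow> 'q::comm_ring_1"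
  assumes f: "ring_hom1 f" and B: "range (f \<circ> mconst) \<union> range (f \<circ> mvar) \<subseteq> B"
  shows "f p \<in> (\<lambda>xss. \<Sum>xs\<leftarrow>xss. prod_list xs) ` lists (lists B)"
proof -
  let ?S = "(\<lambda>xss. \<Sum>xs\<leftarrow>xss. prod_list xs) ` lists (lists B)"
  have gen: "b \<in> ?S" if "b \<in> B" for b
    using that by (intro image_eqI[of _ _ "[[b]]"]) auto
  have add: "x + y \<in> ?S" if xy: "x \<in> ?S" "y \<in> ?S" for x y
  proof -
    obtain xss yss where "xss \<in> lists (lists B)" "x = (\<Sum>xs\<leftarrow>xss. prod_list xs)"
      "yss \<in> lists (lists B)" "y = (\<Sum>xs\<leftarrow>yss. prod_list xs)" using xy by blast
    then show ?thesis by (intro image_eqI[of _ _ "xss @ yss"]) auto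
  qed
  have mult1: "prod_list xs * y \<in> ?S" if "xs \<in> lists B" "y \<in> ?S" for xs y
  proof -
    obtain yss where y: "yss \<in> lists (lists B)" "y = (\<Sum>ys\<leftarrow>yss. prod_list ys)" using \<open>y \<in> ?S\<close> by blast
    have "prod_list xs * y = (\<Sum>ys\<leftarrow>map ((@) xs) yss. prod_list ys)"
      by (simp add: y(2) sum_list_const_mult[symmetric] comp_def)
    then show ?thesis using y(1) that(1) by (intro image_eqI[of _ _ "map ((@) xs) yss"]) (auto simp: in_lists_conv_set)
  qed
  have mult: "x * y \<in> ?S" if "x \<in> ?S" "y \<in> ?S" for x y
  proof -
    obtain xss where x: "xss \<in> lists (lists B)" "x = (\<Sum>xs\<leftarrow>xss. prod_list xs)" using \<open>x \<in> ?S\<close> by blast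
    have "(\<Sum>xs\<leftarrow>xss. prod_list xs) * y \<in> ?S" using x(1)
    proof (induction xss)
      case Nil
      show ?case by (intro image_eqI[of _ _ "[]"]) auto
    next
      case (Cons xs xss)
      then show ?case using add[OF mult1[OF _ that(2), of xs]] by (simp add: distrib_right)
    qed
    then show ?thesis using x by simp
  qed
  have "p \<in> mpolys UNIV" by (rule mpolys_UNIV)
  then show ?thesis
  proof (induction rule: mpolys.induct)
    case (mconst c)
    then show ?case using B by (intro gen) auto
  next
    case (mvar x)
    then show ?case using B by (intro gen) auto
  qed (simp_all only: ring_hom1.add[OF f] ring_hom1.mult[OF f] add mult)
qed

text \<open>Division with remainder without inverting the leading coefficient: each reduction step
  costs one more factor of it.\<close>

lemma pseudo_division:
  fixes p f :: "'a::comm_ring_1 poly"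
  shows "\<exists>N s r. smult (lead_coeff p ^ N) f = p * s + r \<and> (r = 0 \<or> degree r < degree p)"
proof (induction "degree f" arbitrary: f rule: less_induct)
  case less
  show ?case
  proof (cases "f = 0 \<or> degree f < degree p")
    case True
    then show ?thesis by (intro exI[of _ 0] exI[of _ "0::'a poly"] exI[of _ f]) auto
  next
    case False
    define n where "n = degree f - degree p"
    define g where "g = smult (lead_coeff p) f - p * monom (lead_coeff f) n"
    have deg: "degree f = degree p + n" using False by (simp add: n_def)
    have coeff0: "coeff g i = 0" if "degree f \<le> i" for i
    proof (cases "i = degree f")
      case True
      have "coeff (p * monom (lead_coeff f) n) (degree p + n) = lead_coeff p * lead_coeff f"
      proof -
        have "coeff (monom (lead_coeff f) n * p) (degree p + n) = lead_coeff f * lead_coeff p"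
          by (simp add: coeff_monom_mult)
        then show ?thesis by (simp only: mult.commute)
      qed
      then show ?thesis using True deg by (simp add: g_def)
    next
      case False
      then have "degree f < i" using that by simp
      moreover have "degree (p * monom (lead_coeff f) n) \<le> degree f"
        using degree_mult_le[of p "monom (lead_coeff f) n"] degree_monom_le[of "lead_coeff f" n] deg by linarith
      ultimately show ?thesis by (simp add: g_def coeff_eq_0)
    qed
    have eq: "smult (lead_coeff p) f = p * monom (lead_coeff f) n + g" by (simp add: g_def)
    have "\<exists>N s r. smult (lead_coeff p ^ N) g = p * s + r \<and> (r = 0 \<or> degree r < degree p)"
    proof (cases "degree f = 0")
      case True
      then have "g = 0" using coeff0 by (intro poly_eqI) simp
      then show ?thesis by (intro exI[of _ 0] exI[of _ "0::'a poly"]) auto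
    next
      case False
      then have "degree g < degree f"
        using coeff0 by (metis degree_lessI gr0I leading_coeff_0_iff degree_0 linorder_not_le)
      then show ?thesis by (rule less)
    qed
    then obtain N s r where r: "smult (lead_coeff p ^ N) g = p * s + r" "r = 0 \<or> degree r < degree p" by blast
    have "smult (lead_coeff p ^ Suc N) f = smult (lead_coeff p ^ N) (smult (lead_coeff p) f)"
      by (simp add: mult.commute)
    also have "\<dots> = p * (smult (lead_coeff p ^ N) (monom (lead_coeff f) n) + s) + r"
      unfolding eq using r(1) by (simp add: smult_add_right algebra_simps)
    finally show ?thesis using r(2) by blast
  qed
qed

section \<open>Adjoining an algebraic element\<close>

lemma ring_hom1_poly_map: "ring_hom1 h \<Longrightarrow> ring_hom1 (\<lambda>q. poly (map_poly h q) z)"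
  by standard (simp_all add: ring_hom1.map_poly_add ring_hom1.map_poly_mult ring_hom1.one ring_hom1.zero map_poly_1)

context
  fixes \<alpha> :: "'r::comm_ring_1 \<Rightarrow> 'd::{idom,ring_char_0}" and \<beta> :: "'r \<Rightarrow> complex"
  assumes \<alpha>: "ring_hom1 \<alpha>" and \<beta>: "ring_hom1 \<beta>" and ker: "\<And>x. \<alpha> x = 0 \<longleftrightarrow> \<beta> x = 0"
begin

private lemma map_zero: "map_poly \<alpha> q = 0 \<longleftrightarrow> map_poly \<beta> q = 0"
  by (simp add: poly_eq_iff coeff_map_poly ring_hom1.zero[OF \<alpha>] ring_hom1.zero[OF \<beta>] ker)

text \<open>Top coefficients in the common kernel are cut off, so that degrees before and after
  applying \<alpha> agree.\<close>

private lemma truncate: "\<exists>q'. map_poly \<alpha> q' = map_poly \<alpha> q \<and> map_poly \<beta> q' = map_poly \<beta> q \<and>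
    degree q' = degree (map_poly \<alpha> q)"
proof -
  let ?n = "degree (map_poly \<alpha> q)"
  define q' where "q' = poly_cutoff (Suc ?n) q"
  have high: "\<alpha> (coeff q i) = 0" if "?n < i" for i
    using coeff_eq_0[OF that] by (simp add: coeff_map_poly ring_hom1.zero[OF \<alpha>])
  have c: "coeff q' i = (if i \<le> ?n then coeff q i else 0)" for i
    by (auto simp: q'_def coeff_poly_cutoff)
  have 1: "map_poly \<alpha> q' = map_poly \<alpha> q" "map_poly \<beta> q' = map_poly \<beta> q"
    using high by (auto intro!: poly_eqI simp: coeff_map_poly ring_hom1.zero[OF \<alpha>] ring_hom1.zero[OF \<beta>] c ker)
  have "degree q' \<le> ?n" by (rule degree_le) (simp add: c)
  moreover have "?n \<le> degree q'"
    using map_poly_degree_leq[of \<alpha> q'] 1(1) by simp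
  ultimately show ?thesis using 1 by (intro exI[of _ q']) auto
qed

text \<open>A nonzero relation of least degree plays the part of the minimal polynomial of k, and
  any complex root of its image under \<beta> satisfies exactly the relations of k. Pseudo-division
  lets the argument stay in the ring instead of its field of fractions.\<close>

lemma extend_algebraic:
  assumes p: "poly (map_poly \<alpha> p) k = 0" "map_poly \<alpha> p \<noteq> 0"
  shows "\<exists>z. \<forall>q. poly (map_poly \<alpha> q) k = 0 \<longleftrightarrow> poly (map_poly \<beta> q) z = 0"
proof -
  let ?I = "\<lambda>q. poly (map_poly \<alpha> q) k = 0 \<and> map_poly \<alpha> q \<noteq> 0 \<and> degree q = degree (map_poly \<alpha> q)"
  have "\<exists>q. ?I q" using truncate[of p] p by metis
  then obtain p where pI: "?I p" and pmin: "\<And>q. ?I q \<Longrightarrow> degree p \<le> degree q"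
    using exists_least_iff[of "\<lambda>n. \<exists>q. ?I q \<and> degree q = n"] by (metis not_le)
  have low: "map_poly \<alpha> q = 0" if "poly (map_poly \<alpha> q) k = 0" "degree (map_poly \<alpha> q) < degree p" for q
    using truncate[of q] pmin that by (metis not_le)
  interpret A: ring_hom1 "\<lambda>q. poly (map_poly \<alpha> q) k" by (rule ring_hom1_poly_map[OF \<alpha>])
  have deg_le: "degree (map_poly \<alpha> q) \<le> degree q" for q by (rule map_poly_degree_leq)
  have p0: "degree p > 0"
  proof (rule ccontr)
    assume "\<not> ?thesis"
    then have "degree (map_poly \<alpha> p) = 0" using pI by simp
    then obtain c where c: "map_poly \<alpha> p = [:c:]" by (rule degree_eq_zeroE)
    have "poly (map_poly \<alpha> p) k = 0" "map_poly \<alpha> p \<noteq> 0" using pI by blast+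
    then show False by (simp add: c)
  qed
  have bdeg: "degree (map_poly \<beta> q) = degree (map_poly \<alpha> q)" for q
  proof (rule antisym)
    have "coeff (map_poly \<beta> q) i = 0 \<longleftrightarrow> coeff (map_poly \<alpha> q) i = 0" for i
      by (simp add: coeff_map_poly ring_hom1.zero[OF \<alpha>] ring_hom1.zero[OF \<beta>] ker)
    then show "degree (map_poly \<beta> q) \<le> degree (map_poly \<alpha> q)" "degree (map_poly \<alpha> q) \<le> degree (map_poly \<beta> q)"
      by (intro degree_le; metis coeff_eq_0)+
  qed
  then have "degree (map_poly \<beta> p) > 0" using p0 pI by simp
  then obtain z where z: "poly (map_poly \<beta> p) z = 0"
    using fundamental_theorem_of_algebra constant_degree by (metis less_irrefl)
  interpret B: ring_hom1 "\<lambda>q. poly (map_poly \<beta> q) z" by (rule ring_hom1_poly_map[OF \<beta>])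
  have const: "poly (map_poly h [:c:]) y = h c" if "ring_hom1 h" for h :: "'r \<Rightarrow> 's::comm_ring_1" and c y
    by (simp add: map_poly_pCons ring_hom1.zero[OF that])
  have smult_c: "smult c q = [:c:] * q" for c and q :: "'r poly" by simp
  have lc: "\<alpha> (lead_coeff p ^ N) \<noteq> 0" for N
  proof -
    have "\<alpha> (lead_coeff p) \<noteq> 0" using pI by (metis coeff_map_poly leading_coeff_0_iff ring_hom1.zero[OF \<alpha>])
    then show ?thesis by (simp add: ring_hom1.power[OF \<alpha>])
  qed
  have fwd: "poly (map_poly \<beta> q) z = 0" if q: "poly (map_poly \<alpha> q) k = 0" for q
  proof -
    obtain N s r where r: "smult (lead_coeff p ^ N) q = p * s + r" "r = 0 \<or> degree r < degree p"
      using pseudo_division by blast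
    have "poly (map_poly \<alpha> r) k = 0"
      using arg_cong[OF r(1), of "\<lambda>q. poly (map_poly \<alpha> q) k"] q pI
      unfolding smult_c A.add A.mult by simp
    then have "map_poly \<alpha> r = 0" using low deg_le[of r] r(2) by (cases "r = 0") auto
    then have "map_poly \<beta> r = 0" using map_zero by blast
    then have "\<beta> (lead_coeff p ^ N) * poly (map_poly \<beta> q) z = 0"
      using arg_cong[OF r(1), of "\<lambda>q. poly (map_poly \<beta> q) z"] z
      unfolding smult_c B.add B.mult const[OF \<beta>] by simp
    then show ?thesis using lc ker by auto
  qed
  have bwd: "poly (map_poly \<alpha> q) k = 0" if q: "poly (map_poly \<beta> q) z = 0" for q
  proof -
    let ?K = "\<lambda>q. poly (map_poly \<beta> q) z = 0 \<and> poly (map_poly \<alpha> q) k \<noteq> 0 \<and> degree q = degree (map_poly \<alpha> q)"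
    show ?thesis
    proof (rule ccontr)
      assume "poly (map_poly \<alpha> q) k \<noteq> 0"
      \<comment> \<open>Otherwise there is a counterexample of least degree; reducing it modulo p
        shows that its degree is below that of p.\<close>
      then have "\<exists>q. ?K q" using truncate[of q] q by metis
      then obtain g where g: "?K g" and gmin: "\<And>q. ?K q \<Longrightarrow> degree g \<le> degree q"
        using exists_least_iff[of "\<lambda>n. \<exists>q. ?K q \<and> degree q = n"] by (metis not_le)
      have gmin': "poly (map_poly \<alpha> q) k = 0" if "poly (map_poly \<beta> q) z = 0" "degree (map_poly \<alpha> q) < degree g" for q
        using truncate[of q] gmin that by (metis not_le)
      have g0: "\<alpha> (lead_coeff g) \<noteq> 0"
      proof -
        have "map_poly \<alpha> g \<noteq> 0" using g by auto
        then show ?thesis using g by (metis coeff_map_poly leading_coeff_0_iff ring_hom1.zero[OF \<alpha>])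
      qed
      have gp: "degree g < degree p"
      proof (rule ccontr)
        assume "\<not> ?thesis"
        obtain N s r where r: "smult (lead_coeff p ^ N) g = p * s + r" "r = 0 \<or> degree r < degree p"
          using pseudo_division by blast
        have "poly (map_poly \<beta> r) z = 0"
          using arg_cong[OF r(1), of "\<lambda>q. poly (map_poly \<beta> q) z"] g z
          unfolding smult_c B.add B.mult by simp
        then have "poly (map_poly \<alpha> r) k = 0"
          using gmin'[of r] deg_le[of r] r(2) \<open>\<not> degree g < degree p\<close> by (cases "r = 0") (auto simp: A.zero)
        then have "\<alpha> (lead_coeff p ^ N) * poly (map_poly \<alpha> g) k = 0"
          using arg_cong[OF r(1), of "\<lambda>q. poly (map_poly \<alpha> q) k"] pI
          unfolding smult_c A.add A.mult const[OF \<alpha>] by simp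
        then show False using lc g by simp
      qed
      have gdeg: "degree g > 0"
      proof (rule ccontr)
        assume "\<not> ?thesis"
        then obtain c where "g = [:c:]" using degree_eq_zeroE by blast
        then show False using g ker[of c] const[OF \<alpha>] const[OF \<beta>] by auto
      qed
      \<comment> \<open>Now p is divided by g. The remainder has smaller degree than g, hence
        vanishes at k, and smaller degree than p, hence is zero under \<alpha>. So p is g s up to a
        constant, s vanishes at k, and its degree contradicts the choice of p.\<close>
      obtain N s r where r: "smult (lead_coeff g ^ N) p = g * s + r" "r = 0 \<or> degree r < degree g"
        using pseudo_division by blast
      have "poly (map_poly \<beta> r) z = 0"
        using arg_cong[OF r(1), of "\<lambda>q. poly (map_poly \<beta> q) z"] g z
        unfolding smult_c B.add B.mult by simp
      then have rk: "poly (map_poly \<alpha> r) k = 0"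
        using gmin'[of r] deg_le[of r] r(2) gdeg by (cases "r = 0") (auto simp: A.zero)
      then have r0: "map_poly \<alpha> r = 0"
        using low[of r] deg_le[of r] r(2) gp gdeg by (cases "r = 0") auto
      have gs: "poly (map_poly \<alpha> g) k * poly (map_poly \<alpha> s) k = 0"
        using arg_cong[OF r(1), of "\<lambda>q. poly (map_poly \<alpha> q) k"] pI rk
        unfolding smult_c A.add A.mult by simp
      then have sk: "poly (map_poly \<alpha> s) k = 0" using g by simp
      have prod: "smult (\<alpha> (lead_coeff g ^ N)) (map_poly \<alpha> p) = map_poly \<alpha> g * map_poly \<alpha> s"
      proof -
        have "map_poly \<alpha> (smult (lead_coeff g ^ N) p) = map_poly \<alpha> g * map_poly \<alpha> s + map_poly \<alpha> r"
          unfolding r(1) by (simp only: ring_hom1.map_poly_add[OF \<alpha>] ring_hom1.map_poly_mult[OF \<alpha>])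
        then show ?thesis
          unfolding smult_c ring_hom1.map_poly_mult[OF \<alpha>] r0 by (simp add: map_poly_pCons ring_hom1.zero[OF \<alpha>])
      qed
      have "\<alpha> (lead_coeff g ^ N) \<noteq> 0" using g0 by (simp add: ring_hom1.power[OF \<alpha>])
      then have nz: "map_poly \<alpha> g * map_poly \<alpha> s \<noteq> 0" and d: "degree (map_poly \<alpha> g * map_poly \<alpha> s) = degree p"
        using prod pI by (metis smult_eq_0_iff, metis degree_smult_eq)
      then have "degree (map_poly \<alpha> s) < degree p"
        using g gdeg by (simp add: degree_mult_eq)
      then show False using low[OF sk] nz by simp
    qed
  qed
  show ?thesis using fwd bwd by (intro exI[of _ z]) blast
qed

end

section \<open>Adjoining a transcendental element\<close>

lemma (in ring_hom1) of_int: "h (of_int n) = of_int n"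
proof (cases n rule: int_cases2)
  case (nonneg k)
  then show ?thesis by (simp add: of_nat)
next
  case (nonpos k)
  then show ?thesis by (simp add: of_nat uminus)
qed

lemma ring_hom1_of_int: "ring_hom1 (of_int :: int \<Rightarrow> 'a::comm_ring_1)"
  by standard simp_all

lemma ring_hom1_compose: "ring_hom1 g \<Longrightarrow> ring_hom1 f \<Longrightarrow> ring_hom1 (\<lambda>x. g (f x))"
  by (simp add: ring_hom1_def)

lemma finite_ordLess_infinite_set: "finite A \<Longrightarrow> infinite B \<Longrightarrow> |A| <o |B|"
  by (rule finite_ordLess_infinite) (simp_all add: card_of_well_order_on Field_card_of)

lemma Un_ordLeq:
  assumes "infinite C" "|A| \<le>o |C|" "|B| \<le>o |C|"
  shows "|A \<union> B| \<le>o |C|"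
proof -
  have "|{A, B}| \<le>o |C|" using assms(1) by (intro ordLess_imp_ordLeq finite_ordLess_infinite_set) auto
  then have "|\<Union>i\<in>{A, B}. i| \<le>o |C|" using assms by (intro card_of_UNION_ordLeq_infinite) auto
  then show ?thesis by simp
qed

text \<open>The image of \<beta> is generated by fewer than continuum many elements, so its nonzero
  polynomials have fewer than continuum many roots in all.\<close>

lemma transcendental_exists:
  fixes \<beta> :: "('x, int) mpoly \<Rightarrow> complex"
  assumes \<beta>: "ring_hom1 \<beta>" and small: "|range (\<lambda>x. \<beta> (mvar x))| <o |UNIV :: complex set|"
  shows "\<exists>z. \<forall>q. map_poly \<beta> q \<noteq> 0 \<longrightarrow> poly (map_poly \<beta> q) z \<noteq> 0"
proof -
  define B where "B = range (\<beta> \<circ> mconst) \<union> range (\<beta> \<circ> mvar)"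
  define A where "A = (\<lambda>xss. \<Sum>xs\<leftarrow>xss. prod_list xs) ` lists (lists (range (of_nat :: nat \<Rightarrow> complex) \<union> B))"
  have const: "\<beta> (mconst c) = of_int c" for c
    using ring_hom1_meval[OF ring_hom1_of_int] ring_hom1.of_int[OF ring_hom1_compose[OF \<beta> ring_hom1_mconst], of c] by simp
  have countable: "|X| <o |UNIV :: complex set|" if "countable X" for X :: "complex set"
  proof -
    have "\<not> |UNIV :: complex set| \<le>o |X|"
      using that uncountable_UNIV_complex countable_image_inj_on countable_subset
      unfolding card_of_ordLeq[symmetric] by metis
    then show ?thesis by (simp add: not_ordLeq_iff_ordLess card_of_Well_order)
  qed
  have infC: "infinite (UNIV :: complex set)" by (rule infinite_UNIV_char_0)
  \<comment> \<open>Contains the natural numbers and is therefore infinite, as the cardinal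
    arithmetic requires.\<close>
  define B' where "B' = range (of_nat :: nat \<Rightarrow> complex) \<union> B"
  have infB: "infinite B'"
    unfolding B'_def using range_inj_infinite[OF inj_of_nat] by auto
  have "|B'| <o |UNIV :: complex set|"
    unfolding B'_def B_def
  proof (intro card_of_Un_ordLess_infinite[OF infC])
    show "|range (of_nat :: nat \<Rightarrow> complex)| <o |UNIV :: complex set|"
      by (intro countable countable_image) simp
    show "|range (\<beta> \<circ> mconst)| <o |UNIV :: complex set|"
      by (intro countable countable_image) simp
    show "|range (\<beta> \<circ> mvar)| <o |UNIV :: complex set|" using small by (simp add: comp_def)
  qed
  have A_le: "|A| \<le>o |B'|" unfolding A_def B'_def[symmetric] by (rule sums_of_products_ordLeq[OF infB])
  have \<beta>A: "\<beta> p \<in> A" for p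
    unfolding A_def by (rule mpoly_image_sums_of_products[OF \<beta>]) (auto simp: B_def)
  have sub: "B' \<subseteq> A"
    unfolding A_def B'_def[symmetric] by (auto intro!: image_eqI[of _ _ "[[_]]"])
  have infA: "infinite A" using sub infB infinite_super by blast
  \<comment> \<open>Polynomials are enumerated by their coefficient lists; each contributes finitely
    many roots.\<close>
  define Z where "Z = (\<Union>l\<in>lists A. if Poly l = 0 then {} else {z. poly (Poly l) z = 0})"
  have "|Z| \<le>o |A|"
    unfolding Z_def using infA lists_ordLeq[OF infA]
    by (intro card_of_UNION_ordLeq_infinite)
      (auto intro!: ordLess_imp_ordLeq finite_ordLess_infinite_set poly_roots_finite)
  then have "|Z| <o |UNIV :: complex set|"
    using A_le \<open>|B'| <o |UNIV :: complex set|\<close> ordLeq_transitive ordLeq_ordLess_trans by metis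
  then have "Z \<noteq> UNIV" using ordLess_irreflexive by blast
  then obtain z where z: "z \<notin> Z" by blast
  have "poly (map_poly \<beta> q) z \<noteq> 0" if "map_poly \<beta> q \<noteq> 0" for q
  proof
    assume "poly (map_poly \<beta> q) z = 0"
    moreover have "map \<beta> (coeffs q) \<in> lists A" using \<beta>A by auto
    moreover have "Poly (map \<beta> (coeffs q)) = map_poly \<beta> q" by (simp add: map_poly_def)
    ultimately show False using z that unfolding Z_def by fastforce
  qed
  then show ?thesis by blast
qed

text \<open>The variable indexed by d stands for d itself. Variables outside S get the value 0, so
  one type of polynomials serves all sets S.\<close>

abbreviation restr_eval :: "'d set \<Rightarrow> ('d \<Rightarrow> 'q::comm_ring_1) \<Rightarrow> ('d, int) mpoly \<Rightarrow> 'q" where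
  "restr_eval S f \<equiv> meval of_int (\<lambda>d. if d \<in> S then f d else 0)"

lemma ring_hom1_restr_eval: "ring_hom1 (restr_eval S f)"
  by (rule ring_hom1_meval[OF ring_hom1_of_int])

lemma restr_eval_cong:
  assumes "p \<in> mpolys F" "\<And>d. d \<in> F \<Longrightarrow> d \<in> S \<longleftrightarrow> d \<in> T" "\<And>d. d \<in> F \<inter> S \<Longrightarrow> f d = g d"
  shows "restr_eval S f p = restr_eval T g p"
  by (rule meval_unique_on[OF ring_hom1_restr_eval ring_hom1_restr_eval assms(1)])
    (use assms(2,3) in \<open>auto simp: ring_hom1_of_int\<close>)

text \<open>The elements of S and their images satisfy the same polynomial relations over the
  integers, so f induces an isomorphism between the subrings they generate.\<close>

definition same_relations :: "'d::{idom,ring_char_0} set \<Rightarrow> ('d \<Rightarrow> complex) \<Rightarrow> bool" where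
  "same_relations S f \<longleftrightarrow> (\<forall>p. restr_eval S (\<lambda>d. d) p = 0 \<longleftrightarrow> restr_eval S f p = 0)"

text \<open>If x is algebraic over the ring generated by S, its image is a suitable root; if not,
  the smallness of S leaves room for a transcendental value.\<close>

lemma same_relations_insert:
  fixes f :: "'d::{idom,ring_char_0} \<Rightarrow> complex"
  assumes S: "same_relations S f" and x: "x \<notin> S" and small: "|S| <o |UNIV :: complex set|"
  shows "\<exists>z. same_relations (insert x S) (f(x := z))"
proof -
  let ?\<alpha> = "restr_eval S (\<lambda>d. d) :: ('d, int) mpoly \<Rightarrow> 'd" and ?\<beta> = "restr_eval S f"
  have \<alpha>: "ring_hom1 ?\<alpha>" and \<beta>: "ring_hom1 ?\<beta>" by (rule ring_hom1_restr_eval)+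
  have ker: "?\<alpha> p = 0 \<longleftrightarrow> ?\<beta> p = 0" for p using S by (simp add: same_relations_def)
  have "\<exists>z. \<forall>q. poly (map_poly ?\<alpha> q) x = 0 \<longleftrightarrow> poly (map_poly ?\<beta> q) z = 0"
  proof (cases "\<exists>p. poly (map_poly ?\<alpha> p) x = 0 \<and> map_poly ?\<alpha> p \<noteq> 0")
    case True
    then show ?thesis using extend_algebraic[OF \<alpha> \<beta> ker] by blast
  next
    case False
    have "range (\<lambda>d. ?\<beta> (mvar d)) \<subseteq> insert 0 (f ` S)" by (auto simp: ring_hom1_of_int)
    moreover have "|insert 0 (f ` S)| <o |UNIV :: complex set|"
    proof -
      have "|f ` S| <o |UNIV :: complex set|" using small card_of_image ordLeq_ordLess_trans by blast
      moreover have "|{0 :: complex}| <o |UNIV :: complex set|"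
        by (intro finite_ordLess_infinite_set) (auto simp: infinite_UNIV_char_0)
      ultimately have "|{0} \<union> f ` S| <o |UNIV :: complex set|"
        by (intro card_of_Un_ordLess_infinite infinite_UNIV_char_0)
      then show ?thesis by simp
    qed
    ultimately have "|range (\<lambda>d. ?\<beta> (mvar d))| <o |UNIV :: complex set|"
      using card_of_mono1 ordLeq_ordLess_trans by blast
    then obtain z where z: "\<And>q. map_poly ?\<beta> q \<noteq> 0 \<Longrightarrow> poly (map_poly ?\<beta> q) z \<noteq> 0"
      using transcendental_exists[OF \<beta>] by blast
    have zero: "map_poly ?\<alpha> q = 0 \<longleftrightarrow> map_poly ?\<beta> q = 0" for q
      by (simp add: poly_eq_iff coeff_map_poly ring_hom1.zero[OF \<alpha>] ring_hom1.zero[OF \<beta>] ker)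
    then have "poly (map_poly ?\<alpha> q) x = 0 \<longleftrightarrow> poly (map_poly ?\<beta> q) z = 0" for q
    proof (cases "map_poly ?\<alpha> q = 0")
      case True
      then have "map_poly ?\<beta> q = 0" by (rule zero[THEN iffD1])
      then show ?thesis using True by simp
    next
      case nz: False
      then have "map_poly ?\<beta> q \<noteq> 0" by (rule contrapos_nn) (rule zero[THEN iffD2])
      then show ?thesis using nz False z by blast
    qed
    then show ?thesis by blast
  qed
  then obtain z where z: "\<And>q. poly (map_poly ?\<alpha> q) x = 0 \<longleftrightarrow> poly (map_poly ?\<beta> q) z = 0" by blast
  \<comment> \<open>Reads a polynomial as univariate in the variable of x, with coefficients in the
    other variables.\<close>
  define sp :: "('d, int) mpoly \<Rightarrow> ('d, int) mpoly poly" where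
    "sp = meval of_int (\<lambda>d. if d = x then [:0, 1:] else [:mvar d:])"
  have sp: "ring_hom1 sp" unfolding sp_def by (rule ring_hom1_meval[OF ring_hom1_of_int])
  have split: "restr_eval (insert x S) (g(x := y)) p = poly (map_poly (restr_eval S g) (sp p)) y"
    for g :: "'d \<Rightarrow> 'q::comm_ring_1" and y p
  proof (rule mpoly_hom_eqI[OF ring_hom1_restr_eval ring_hom1_compose[OF ring_hom1_poly_map[OF ring_hom1_restr_eval] sp]])
    show "restr_eval (insert x S) (g(x := y)) (mconst c) = poly (map_poly (restr_eval S g) (sp (mconst c))) y" for c
      by (simp add: sp_def ring_hom1_of_int ring_hom1.of_int[OF ring_hom1_poly_map[OF ring_hom1_restr_eval]])
    show "restr_eval (insert x S) (g(x := y)) (mvar d) = poly (map_poly (restr_eval S g) (sp (mvar d))) y" for d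
      using x by (auto simp: sp_def ring_hom1_of_int map_poly_pCons
          ring_hom1.zero[OF ring_hom1_restr_eval] ring_hom1.one[OF ring_hom1_restr_eval])
  qed
  have id: "(\<lambda>d. d)(x := x) = (\<lambda>d. d)" by auto
  have "restr_eval (insert x S) (\<lambda>d. d) p = 0 \<longleftrightarrow> restr_eval (insert x S) (f(x := z)) p = 0" for p
    using split[of "\<lambda>d. d" x p] unfolding id split[of f z p] by (simp only: z)
  then have "same_relations (insert x S) (f(x := z))"
    unfolding same_relations_def by blast
  then show ?thesis by blast
qed

text \<open>The domain is enumerated along a well-order and embedded element by element, preserving
  all polynomial relations among the elements treated so far.\<close>

theorem embed_complex:
  assumes "|UNIV :: 'd::{idom,ring_char_0} set| \<le>o |UNIV :: complex set|"
  shows "\<exists>\<theta> :: 'd \<Rightarrow> complex. ring_hom1 \<theta> \<and> inj \<theta>"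
proof -
  \<comment> \<open>The cardinal order has proper initial segments of size less than the continuum,
    as the transcendental case requires.\<close>
  define r where "r = |UNIV :: 'd set|"
  have r: "Card_order r" "Well_order r" "Field r = UNIV"
    by (simp_all add: r_def card_of_card_order_on card_of_well_order_on Field_card_of)
  interpret wo: wo_rel r using r(2) by (simp add: wo_rel_def)
  define P where "P f x z \<longleftrightarrow> same_relations (insert x (underS r x)) (f(x := z))" for f :: "'d \<Rightarrow> complex" and x z
  have tot: "a = b \<or> a \<in> underS r b \<or> b \<in> underS r a" for a b
    using wo.TOTALS r(3) by (auto simp: underS_def)
  have trans: "underS r a \<subseteq> underS r b" if "a \<in> underS r b" for a b
    using that wo.TRANS wo.ANTISYM by (auto simp: underS_def dest: transD antisymD)
  \<comment> \<open>A polynomial has finitely many variables, so the greatest of them reduces it to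
    one earlier stage.\<close>
  have greatest: "\<exists>y\<in>A. A \<subseteq> insert y (underS r y)" if "finite A" "A \<noteq> {}" for A
    using that
  proof (induction rule: finite_ne_induct)
    case (insert a A)
    then obtain y where y: "y \<in> A" "A \<subseteq> Set.insert y (underS r y)" by blast
    show ?case
      using tot[of a y] y trans[of y a] by auto
  qed auto
  have "\<exists>f. \<forall>x. P f x (f x)"
  proof (rule dependent_wf_choice)
    show "wf (r - Id)" by (rule wo.WF)
    show "P f x z = P g x z" if "\<And>y. (y, x) \<in> r - Id \<Longrightarrow> f y = g y" for f g x z
    proof -
      have "restr_eval (insert x (underS r x)) (f(x := z)) p = restr_eval (insert x (underS r x)) (g(x := z)) p" for p
        by (rule restr_eval_cong[OF mpolys_UNIV]) (use that in \<open>auto simp: underS_def\<close>)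
      then show ?thesis by (simp add: P_def same_relations_def)
    qed
    fix x and f :: "'d \<Rightarrow> complex"
    assume IH: "\<And>y. (y, x) \<in> r - Id \<Longrightarrow> P f y (f y)"
    have "same_relations (underS r x) f"
      unfolding same_relations_def
    proof
      fix p :: "('d, int) mpoly"
      obtain F where F: "finite F" "p \<in> mpolys F" using mpolys_finite_support by blast
      show "restr_eval (underS r x) (\<lambda>d. d) p = 0 \<longleftrightarrow> restr_eval (underS r x) f p = 0"
      proof (cases "F \<inter> underS r x = {}")
        case True
        \<comment> \<open>No variable of p lies in the segment, so p evaluates to an integer; in
          characteristic 0 it vanishes in both rings or in neither.\<close>
        have e: "restr_eval (underS r x) g p = of_int (restr_eval {} (\<lambda>_. 0) p)" for g :: "'d \<Rightarrow> 'q::comm_ring_1"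
          using True by (intro meval_unique_on[OF ring_hom1_restr_eval ring_hom1_compose[OF ring_hom1_of_int ring_hom1_restr_eval] F(2)])
            (auto simp: ring_hom1_of_int ring_hom1_ident[folded id_def])
        show ?thesis unfolding e by simp
      next
        case False
        obtain y where y: "y \<in> F \<inter> underS r x" "F \<inter> underS r x \<subseteq> insert y (underS r y)"
          using greatest[of "F \<inter> underS r x"] F(1) False by blast
        have eq: "restr_eval (underS r x) g p = restr_eval (insert y (underS r y)) g p" for g :: "'d \<Rightarrow> 'q::comm_ring_1"
          by (rule restr_eval_cong[OF F(2)]) (use y trans[of y x] in auto)
        have "same_relations (insert y (underS r y)) f"
          using IH[of y] y(1) by (auto simp: P_def underS_def)
        then show ?thesis unfolding eq by (simp add: same_relations_def)
      qed
    qed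
    moreover have "x \<notin> underS r x" by (simp add: underS_def)
    moreover have "|underS r x| <o |UNIV :: complex set|"
      using card_of_underS[OF r(1), of x] assms r(3) ordLess_ordLeq_trans unfolding r_def by blast
    ultimately show "\<exists>z. P f x z" unfolding P_def by (rule same_relations_insert)
  qed
  then obtain f where f: "\<And>x. same_relations (insert x (underS r x)) f" by (auto simp: P_def)
  have all: "meval of_int (\<lambda>d. d) p = 0 \<longleftrightarrow> meval of_int f p = 0" for p :: "('d, int) mpoly"
  proof -
    obtain F where F: "finite F" "p \<in> mpolys F" using mpolys_finite_support by blast
    \<comment> \<open>Adding 0 makes the index set nonempty, as \<open>greatest\<close>
      requires.\<close>
    have F': "p \<in> mpolys (insert 0 F)" using mpolys_mono[OF F(2)] by blast
    obtain y where y: "insert 0 F \<subseteq> insert y (underS r y)" using greatest[of "insert 0 F"] F(1) by blast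
    have eq: "meval of_int g p = restr_eval (insert y (underS r y)) g p" for g :: "'d \<Rightarrow> 'q::comm_ring_1"
      by (rule meval_unique_on[OF ring_hom1_meval[OF ring_hom1_of_int] ring_hom1_restr_eval F'])
        (use y in \<open>auto simp: ring_hom1_of_int\<close>)
    show ?thesis unfolding eq[of f] eq[of "\<lambda>d. d"] using f[of y] by (simp add: same_relations_def)
  qed
  have id: "ring_hom1 (meval of_int (\<lambda>d. d) :: ('d, int) mpoly \<Rightarrow> 'd)" and mf: "ring_hom1 (meval of_int f)"
    by (rule ring_hom1_meval[OF ring_hom1_of_int])+
  note hom_simps = ring_hom1.add[OF id] ring_hom1.add[OF mf] ring_hom1.diff[OF id] ring_hom1.diff[OF mf]
    ring_hom1.mult[OF id] ring_hom1.mult[OF mf] ring_hom1.one[OF id] ring_hom1.one[OF mf] meval_mvar[OF ring_hom1_of_int]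
  have "ring_hom1 f"
  proof
    \<comment> \<open>Additivity at x and y is itself a polynomial relation between x, y and x + y,
      and f preserves relations.\<close>
    show "f (x + y) = f x + f y" for x y
      using all[of "mvar (x + y) - (mvar x + mvar y)"] by (simp add: hom_simps)
    show "f (x * y) = f x * f y" for x y
      using all[of "mvar (x * y) - mvar x * mvar y"] by (simp add: hom_simps)
    show "f 1 = 1"
      using all[of "mvar 1 - 1"] by (simp add: hom_simps)
  qed
  moreover have "inj f"
  proof (rule injI)
    fix x y assume "f x = f y"
    then show "x = y" using all[of "mvar x - mvar y"] by (simp add: hom_simps)
  qed
  ultimately show ?thesis by blast
qed

lemma mpoly_complex_card:
  "|UNIV :: ((real, complex) mpoly) set| \<le>o |UNIV :: complex set|"
proof -
  let ?B = "range (mconst :: complex \<Rightarrow> (real, complex) mpoly) \<union> range (mvar :: real \<Rightarrow> (real, complex) mpoly)"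
  have infC: "infinite (UNIV :: complex set)" by (rule infinite_UNIV_char_0)
  have "|range (mvar :: real \<Rightarrow> (real, complex) mpoly)| \<le>o |UNIV :: real set|" by (rule card_of_image)
  moreover have "|UNIV :: real set| \<le>o |UNIV :: complex set|"
    unfolding card_of_ordLeq[symmetric] by (intro exI[of _ complex_of_real]) (auto simp: inj_on_def)
  ultimately have B: "|?B| \<le>o |UNIV :: complex set|"
    using infC card_of_image ordLeq_transitive by (intro Un_ordLeq) blast+
  have "inj (mconst :: complex \<Rightarrow> (real, complex) mpoly)"
    using meval_mconst[OF ring_hom1_ident, of "\<lambda>_. 0 :: complex"] by (metis injI)
  then have "infinite ?B" using infC finite_imageD by blast
  from sums_of_products_ordLeq[OF this]
  have "|(\<lambda>xss. \<Sum>xs\<leftarrow>xss. prod_list xs) ` lists (lists ?B)| \<le>o |?B|" .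
  moreover have "p \<in> (\<lambda>xss. \<Sum>xs\<leftarrow>xss. prod_list xs) ` lists (lists ?B)" for p :: "(real, complex) mpoly"
    using mpoly_image_sums_of_products[OF ring_hom1_ident, of ?B p] by (simp add: comp_def)
  then have "(UNIV :: ((real, complex) mpoly) set) = (\<lambda>xss. \<Sum>xs\<leftarrow>xss. prod_list xs) ` lists (lists ?B)" by blast
  ultimately show ?thesis using B ordLeq_transitive by metis
qed

subsection \<open>The chain\<close>

lemma series_embedding_mono: "series_embedding G \<Phi> J \<Longrightarrow> J \<subseteq> K \<Longrightarrow> series_embedding G \<Phi> K"
  using series_in_mono unfolding series_embedding_def by blast

theorem successor_step:
  fixes \<Phi> :: "'a \<Rightarrow> (real, complex) mpoly fps" and j :: "nat \<Rightarrow> real"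
  assumes ext: "group_ext G H" and step: "amalgam_step G H \<or> centralizer_step G H"
    and BP: "BP_group G" and \<Phi>: "series_embedding G \<Phi> J" and j: "inj j" "range j \<inter> J = {}"
  shows "BP_group H \<and> (\<exists>\<Phi>'. series_embedding H \<Phi>' (J \<union> range j) \<and> (\<forall>x\<in>carrier G. \<Phi>' x = \<Phi> x))"
proof -
  have j0: "j 0 \<notin> J" using j(2) by blast
  obtain C code where code: "has_code G H C code"
    and lift: "lifts_to G H C code (series_mon :: (real, complex) mpoly fps monoid)" "lifts_to G H C code G" "lifts_to G H C code sl2"
    and C: "(\<exists>u\<in>carrier G. u \<noteq> \<one>\<^bsub>G\<^esub> \<and> C = centralizer G u) \<or>
      (C = {\<one>\<^bsub>G\<^esub>} \<and> (\<forall>x. alternating (snd (code x)) \<and> even (length (snd (code x)))))"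
    using step_has_code[OF ext step group_series_mon group_extD(1)[OF ext] group_sl2] by metis
  from C show ?thesis
  proof
    assume "\<exists>u\<in>carrier G. u \<noteq> \<one>\<^bsub>G\<^esub> \<and> C = centralizer G u"
    then obtain u where u: "u \<in> carrier G" "u \<noteq> \<one>\<^bsub>G\<^esub>" "C = centralizer G u" by blast
    obtain \<Phi>' where "BP_group H" "series_embedding H \<Phi>' (insert (j 0) J)" "\<forall>x\<in>carrier G. \<Phi>' x = \<Phi> x"
      using step_over_centralizer[OF ext BP \<Phi> j0 u(1,2)] code lift(1,2) unfolding u(3) by blast
    moreover have "insert (j 0) J \<subseteq> J \<union> range j" by blast
    ultimately show ?thesis using series_embedding_mono by blast
  next
    assume "C = {\<one>\<^bsub>G\<^esub>} \<and> (\<forall>x. alternating (snd (code x)) \<and> even (length (snd (code x))))"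
    then have C1: "C = {\<one>\<^bsub>G\<^esub>}" and alt: "\<And>x. alternating (snd (code x))" "\<And>x. even (length (snd (code x)))"
      by blast+
    note code = code[unfolded C1] and lift = lift[unfolded C1]
    have "BP_group H"
    proof (cases "\<exists>a\<in>carrier G. \<exists>b\<in>carrier G. a \<otimes>\<^bsub>G\<^esub> b \<noteq> b \<otimes>\<^bsub>G\<^esub> a")
      case True
      then show ?thesis using nonabelian_free_step_BP[OF ext BP \<Phi> j0 code lift(2)] by blast
    next
      case False
      obtain \<theta> :: "(real, complex) mpoly \<Rightarrow> complex" where "ring_hom1 \<theta>" "inj \<theta>"
        using embed_complex[OF mpoly_complex_card] by blast
      from abelian_free_step_BP[OF ext series_embeddingD(1)[OF \<Phi>] this code lift(3) alt]
      show ?thesis using False by blast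
    qed
    then show ?thesis using free_step_embedding[OF ext \<Phi> j code alt(1) lift(1)] by blast
  qed
qed

lemma group_chainD:
  assumes "group_chain r G" "(a, b) \<in> r"
  shows "group_ext (G a) (G b)"
proof -
  have "a \<in> Field r" "b \<in> Field r" using assms(2) by (auto intro: FieldI1 FieldI2)
  then show ?thesis using assms by (simp add: group_chain_def group_ext_def)
qed

lemma power_product_group_ext:
  assumes ext: "group_ext G H" and us: "set us \<subseteq> carrier G"
  shows "power_product H us as = power_product G us as"
proof -
  interpret group_hom G H "\<lambda>x. x"
    using group_extD(1,2,7)[OF ext] by (simp add: group_hom_def group_hom_axioms_def)
  show ?thesis using hom_power_product[OF us, of as] by simp
qed

lemma BP_group_ext:
  assumes ext: "group_ext G H" and BP: "BP_group H"
  shows "BP_group G"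
proof (rule BP_group_discriminated[OF group_extD(1)[OF ext] BP])
  fix S assume "S \<subseteq> carrier G - {\<one>\<^bsub>G\<^esub>}"
  then show "\<exists>\<Psi>\<in>hom G H. \<forall>x\<in>S. \<Psi> x \<noteq> \<one>\<^bsub>H\<^esub>"
    using group_extD(4,7)[OF ext] by (intro bexI[of _ "\<lambda>x. x"]) auto
qed

text \<open>A tuple is finite and therefore lies in one member, where commutators and power products
  have the same values.\<close>

lemma BP_group_directed_union:
  assumes I: "I \<noteq> {}" and ext: "\<And>a. a \<in> I \<Longrightarrow> group_ext (G a) H" and BP: "\<And>a. a \<in> I \<Longrightarrow> BP_group (G a)"
    and H: "carrier H \<subseteq> (\<Union>a\<in>I. carrier (G a))"
    and dir: "\<And>a b. a \<in> I \<Longrightarrow> b \<in> I \<Longrightarrow> carrier (G a) \<subseteq> carrier (G b) \<or> carrier (G b) \<subseteq> carrier (G a)"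
  shows "BP_group H"
proof -
  have grp: "group H" using I ext group_extD(2) by blast
  have cover: "\<exists>a\<in>I. F \<subseteq> carrier (G a)" if "finite F" "F \<subseteq> carrier H" for F
    using that
  proof (induction rule: finite_induct)
    case empty
    then show ?case using I by blast
  next
    case (insert x F)
    then obtain a where a: "a \<in> I" "F \<subseteq> carrier (G a)" by blast
    obtain b where b: "b \<in> I" "x \<in> carrier (G b)" using insert.prems H by blast
    show ?case using a b dir[OF a(1) b(1)] by blast
  qed
  show ?thesis
    unfolding BP_group_def
  proof (intro conjI allI impI grp)
    fix us assume us: "commutation_free H us"
    then have sub: "set us \<subseteq> carrier H" by (auto simp: commutation_free_def)
    obtain a where a: "a \<in> I" "set us \<subseteq> carrier (G a)" using cover[OF finite_set sub] by blast
    note e = ext[OF a(1)] 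
    interpret Ga: group "G a" using group_extD(1)[OF e] .
    have "commutator (G a) x y = commutator H x y" if "x \<in> carrier (G a)" "y \<in> carrier (G a)" for x y
      using that group_extD(5,6)[OF e] by (simp add: commutator_def)
    moreover have "us ! i \<in> carrier (G a)" if "i < length us" for i
      using a(2) nth_mem[OF that] by blast
    ultimately have "commutation_free (G a) us"
      using us a(2) group_extD(4)[OF e] by (auto simp: commutation_free_def)
    then have "independent_tuple (G a) us" using BP[OF a(1)] by (simp add: BP_group_def)
    then show "independent_tuple H us"
      using power_product_group_ext[OF e a(2)] group_extD(4)[OF e] by (simp add: independent_tuple_def)
  qed
qed

context
  fixes r :: "'i rel" and zero \<delta> :: 'i and G :: "'i \<Rightarrow> 'a monoid"
  assumes wo: "Well_order r"
    and zero: "zero \<in> Field r" "\<forall>\<alpha>\<in>Field r. (zero, \<alpha>) \<in> r"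
    and \<delta>: "\<delta> \<in> Field r" "\<forall>\<alpha>\<in>Field r. (\<alpha>, \<delta>) \<in> r"
    and card: "|underS r \<delta>| \<le>o |UNIV :: real set|"
    and chain: "group_chain r G"
    and limit: "\<And>l. is_limit r l \<Longrightarrow> carrier (G l) = (\<Union>\<alpha>\<in>underS r l. carrier (G \<alpha>))"
    and succ: "\<And>\<alpha> \<beta>. is_successor r \<alpha> \<beta> \<Longrightarrow> amalgam_step (G \<alpha>) (G \<beta>) \<or> centralizer_step (G \<alpha>) (G \<beta>)"
begin

interpretation wo: wo_rel r using wo by (simp add: wo_rel_def)

private lemma underS_trans: "a \<in> underS r b \<Longrightarrow> b \<in> underS r c \<Longrightarrow> a \<in> underS r c"
  using wo.TRANS wo.ANTISYM by (auto simp: underS_def dest: transD antisymD)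

private lemma underS_total: "a \<in> Field r \<Longrightarrow> b \<in> Field r \<Longrightarrow> a = b \<or> a \<in> underS r b \<or> b \<in> underS r a"
  using wo.TOTALS by (auto simp: underS_def)

private lemma underS_ext: "a \<in> underS r b \<Longrightarrow> group_ext (G a) (G b)"
  using group_chainD[OF chain] by (simp add: underS_def)

text \<open>Reserves for every stage its own countable supply of variables among the reals; this is
  where the bound on the length of the chain enters.\<close>

lemma variable_indices: "\<exists>k :: 'i \<times> nat \<Rightarrow> real. inj_on k (Field r \<times> UNIV)"
proof -
  have inf: "infinite (UNIV :: real set)" by (rule infinite_UNIV_char_0)
  have "Field r \<subseteq> {\<delta>} \<union> underS r \<delta>" using \<delta>(2) by (auto simp: underS_def)
  then have "|Field r| \<le>o |{\<delta>} \<union> underS r \<delta>|" by (rule card_of_mono1)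
  moreover have "|{\<delta>} \<union> underS r \<delta>| \<le>o |UNIV :: real set|"
    using card inf by (intro Un_ordLeq) (auto intro: ordLess_imp_ordLeq finite_ordLess_infinite_set)
  ultimately have "|Field r| \<le>o |UNIV :: real set|" using ordLeq_transitive by blast
  moreover have "|UNIV :: nat set| \<le>o |UNIV :: real set|" using inf by (simp add: infinite_iff_card_of_nat)
  ultimately have "|Field r \<times> (UNIV :: nat set)| \<le>o |UNIV :: real set|"
    using inf by (intro card_of_Sigma_ordLeq_infinite) auto
  then show ?thesis unfolding card_of_ordLeq[symmetric] by blast
qed

text \<open>Well-founded recursion with choice: the embedding at a stage is picked given all earlier
  ones and extends them, which is what lets them be glued at limits.\<close>

lemma chain_BP_embeddings:
  assumes BP0: "BP_group (G zero)" and \<Phi>0: "\<Phi>\<^sub>0 \<in> mon (G zero) series_group"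
  shows "BP_group (G \<delta>) \<and> (\<exists>\<Phi> J. series_embedding (G \<delta>) (\<Phi> :: 'a \<Rightarrow> (real, complex) mpoly fps) J)"
proof -
  obtain k :: "'i \<times> nat \<Rightarrow> real" where k: "inj_on k (Field r \<times> UNIV)" using variable_indices by blast
  \<comment> \<open>The variables of the stages strictly below \<alpha>; those of \<alpha> itself
    stay fresh for the step to its successor.\<close>
  define J where "J \<alpha> = k ` (underS r \<alpha> \<times> UNIV)" for \<alpha>
  have J_mono: "J \<beta> \<subseteq> J \<alpha>" if "\<beta> \<in> underS r \<alpha>" for \<alpha> \<beta>
    using that underS_trans unfolding J_def by (intro image_mono Sigma_mono) auto
  \<comment> \<open>Outside the field of r nothing is asked, because
    \<open>dependent_wf_choice\<close> ranges over the whole type.\<close>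
  define P where "P \<Phi> \<alpha> \<phi> \<longleftrightarrow> (\<alpha> \<in> Field r \<longrightarrow> BP_group (G \<alpha>) \<and> series_embedding (G \<alpha>) \<phi> (J \<alpha>) \<and>
      (\<forall>\<beta>\<in>underS r \<alpha>. \<forall>x\<in>carrier (G \<beta>). \<phi> x = \<Phi> \<beta> x))"
    for \<Phi> :: "'i \<Rightarrow> 'a \<Rightarrow> (real, complex) mpoly fps" and \<alpha> \<phi>
  have "\<exists>\<Phi>. \<forall>\<alpha>. P \<Phi> \<alpha> (\<Phi> \<alpha>)"
  proof (rule dependent_wf_choice)
    show "wf (r - Id)" by (rule wo.WF)
    show "P f \<alpha> \<phi> = P g \<alpha> \<phi>" if "\<And>\<beta>. (\<beta>, \<alpha>) \<in> r - Id \<Longrightarrow> f \<beta> = g \<beta>" for f g \<alpha> \<phi>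
      using that by (auto simp: P_def underS_def)
    fix \<alpha> \<Phi> assume "\<And>\<beta>. (\<beta>, \<alpha>) \<in> r - Id \<Longrightarrow> P \<Phi> \<beta> (\<Phi> \<beta>)"
    then have IH: "BP_group (G \<beta>)" "series_embedding (G \<beta>) (\<Phi> \<beta>) (J \<beta>)"
      "\<And>\<gamma> x. \<gamma> \<in> underS r \<beta> \<Longrightarrow> x \<in> carrier (G \<gamma>) \<Longrightarrow> \<Phi> \<beta> x = \<Phi> \<gamma> x" if "\<beta> \<in> underS r \<alpha>" for \<beta>
      using that FieldI1[of \<beta> \<alpha> r] unfolding P_def underS_def by blast+
    show "\<exists>\<phi>. P \<Phi> \<alpha> \<phi>"
    proof (cases "\<alpha> \<in> Field r")
      case False
      then show ?thesis by (simp add: P_def)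
    next
      case \<alpha>: True
      consider "\<alpha> = zero" | \<beta> where "is_successor r \<beta> \<alpha>" | "is_limit r \<alpha>"
      proof -
        have "underS r \<alpha> \<noteq> {}" if "\<alpha> \<noteq> zero"
          using zero \<alpha> that by (auto simp: underS_def)
        then show thesis using that \<alpha> by (auto simp: is_limit_def)
      qed
      then show ?thesis
      proof cases
        case 1
        have "underS r zero = {}"
          using zero(2) wo.ANTISYM by (auto simp: underS_def dest: antisymD FieldI1)
        \<comment> \<open>At the bottom the coefficients are constants, in keeping with the empty
          set of variables.\<close>
        define h :: "complex \<Rightarrow> (real, complex) mpoly" where "h = mconst"
        have h: "ring_hom1 h" unfolding h_def by (rule ring_hom1_mconst)
        have "inj h"
          unfolding h_def using meval_mconst[OF ring_hom1_ident, of "\<lambda>_ :: real. 0 :: complex"] by (metis injI)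
        have hom0: "\<Phi>\<^sub>0 \<in> hom (G zero) series_mon" and inj0: "inj_on \<Phi>\<^sub>0 (carrier (G zero))"
          using \<Phi>0 by (auto simp: mon_def series_group_eq)
        have hom: "fps_map h \<circ> \<Phi>\<^sub>0 \<in> hom (G zero) series_mon"
          by (rule hom_compose[OF hom0 ring_hom1_fps_map_hom[OF h]])
        have "inj (fps_map h)"
          using \<open>inj h\<close> by (intro injI fps_ext) (metis fps_map_nth injD)
        then have "inj_on (fps_map h \<circ> \<Phi>\<^sub>0) (carrier (G zero))"
          using inj0 by (meson comp_inj_on inj_on_subset subset_UNIV)
        moreover have "(fps_map h \<circ> \<Phi>\<^sub>0) x \<in> series_in (J zero)" if "x \<in> carrier (G zero)" for x
        proof -
          have "tid ((fps_map h \<circ> \<Phi>\<^sub>0) x)" using hom that by (auto simp: hom_def)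
          then show ?thesis by (simp add: series_in_def h_def mpolys.mconst)
        qed
        ultimately have "series_embedding (G zero) (fps_map h \<circ> \<Phi>\<^sub>0) (J zero)"
          using hom by (auto simp: series_embedding_def mon_def)
        then show ?thesis
          using 1 BP0 \<open>underS r zero = {}\<close> unfolding P_def by blast
      next
        case (2 \<beta>)
        then have \<beta>: "\<beta> \<in> underS r \<alpha>" "underS r \<alpha> \<subseteq> under r \<beta>" by (auto simp: is_successor_def)
        then have \<beta>F: "\<beta> \<in> Field r" by (auto simp: underS_def intro: FieldI1)
        define j where "j n = k (\<beta>, n)" for n
        have inj: "inj j" using k \<beta>F by (auto simp: j_def inj_on_def)
        have disj: "range j \<inter> J \<beta> = {}"
          using inj_onD[OF k] \<beta>F by (fastforce simp: j_def J_def underS_def intro: FieldI1)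
        have JU: "J \<beta> \<union> range j \<subseteq> J \<alpha>" using J_mono[OF \<beta>(1)] \<beta>(1) by (auto simp: J_def j_def)
        obtain \<phi> where \<phi>: "BP_group (G \<alpha>)" "series_embedding (G \<alpha>) \<phi> (J \<beta> \<union> range j)"
          "\<And>x. x \<in> carrier (G \<beta>) \<Longrightarrow> \<phi> x = \<Phi> \<beta> x"
          using successor_step[OF underS_ext[OF \<beta>(1)] succ[OF 2] IH(1,2)[OF \<beta>(1)] inj disj] by blast
        have "\<phi> x = \<Phi> \<gamma> x" if \<gamma>: "\<gamma> \<in> underS r \<alpha>" "x \<in> carrier (G \<gamma>)" for \<gamma> x
        proof (cases "\<gamma> = \<beta>")
          case True
          then show ?thesis using \<phi>(3) \<gamma>(2) by simp
        next
          case False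
          then have \<gamma>\<beta>: "\<gamma> \<in> underS r \<beta>" using \<gamma>(1) \<beta>(2) by (auto simp: under_def underS_def)
          then have "x \<in> carrier (G \<beta>)" using group_extD(3)[OF underS_ext] \<gamma>(2) by blast
          then show ?thesis using \<phi>(3) IH(3)[OF \<beta>(1) \<gamma>\<beta> \<gamma>(2)] by simp
        qed
        then show ?thesis
          using \<phi>(1) series_embedding_mono[OF \<phi>(2) JU] unfolding P_def by blast
      next
        case 3
        note carrier = limit[OF 3]
        have ne: "underS r \<alpha> \<noteq> {}" using 3 by (simp add: is_limit_def)
        have F: "\<beta> \<in> Field r" if "\<beta> \<in> underS r \<alpha>" for \<beta> using that by (auto simp: underS_def intro: FieldI1)
        have agree: "\<Phi> \<beta> x = \<Phi> \<gamma> x"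
          if "\<beta> \<in> underS r \<alpha>" "\<gamma> \<in> underS r \<alpha>" "x \<in> carrier (G \<beta>)" "x \<in> carrier (G \<gamma>)" for \<beta> \<gamma> x
          using underS_total[OF F[OF that(1)] F[OF that(2)]] IH(3)[OF that(1)] IH(3)[OF that(2)] that(3,4) by metis
        \<comment> \<open>Any earlier stage that contains x gives the same value, because the
          earlier embeddings extend each other.\<close>
        define \<phi> where "\<phi> x = \<Phi> (SOME \<beta>. \<beta> \<in> underS r \<alpha> \<and> x \<in> carrier (G \<beta>)) x" for x
        have \<phi>: "\<phi> x = \<Phi> \<beta> x" if "\<beta> \<in> underS r \<alpha>" "x \<in> carrier (G \<beta>)" for \<beta> x
        proof -
          have "(SOME \<beta>. \<beta> \<in> underS r \<alpha> \<and> x \<in> carrier (G \<beta>)) \<in> underS r \<alpha> \<and>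
              x \<in> carrier (G (SOME \<beta>. \<beta> \<in> underS r \<alpha> \<and> x \<in> carrier (G \<beta>)))"
            using that by (intro someI) blast
          then show ?thesis unfolding \<phi>_def using agree that by blast
        qed
        have dir: "carrier (G \<beta>) \<subseteq> carrier (G \<gamma>) \<or> carrier (G \<gamma>) \<subseteq> carrier (G \<beta>)"
          if "\<beta> \<in> underS r \<alpha>" "\<gamma> \<in> underS r \<alpha>" for \<beta> \<gamma>
          using underS_total[OF F[OF that(1)] F[OF that(2)]] group_extD(3)[OF underS_ext] by blast
        have two: "\<exists>\<beta>\<in>underS r \<alpha>. x \<in> carrier (G \<beta>) \<and> y \<in> carrier (G \<beta>)"
          if xy: "x \<in> carrier (G \<alpha>)" "y \<in> carrier (G \<alpha>)" for x y
        proof -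
          obtain \<beta> \<gamma> where "\<beta> \<in> underS r \<alpha>" "x \<in> carrier (G \<beta>)" "\<gamma> \<in> underS r \<alpha>" "y \<in> carrier (G \<gamma>)"
            using xy[unfolded carrier] by (elim UN_E)
          then show ?thesis using dir[of \<beta> \<gamma>] by blast
        qed
        have closed: "\<phi> x \<in> series_in (J \<alpha>)" if x: "x \<in> carrier (G \<alpha>)" for x
        proof -
          obtain \<beta> where \<beta>: "\<beta> \<in> underS r \<alpha>" "x \<in> carrier (G \<beta>)" using two[OF x x] by blast
          then show ?thesis
            using series_embeddingD(3)[OF IH(2)[OF \<beta>(1)] \<beta>(2)] series_in_mono[OF J_mono[OF \<beta>(1)]] \<phi> by auto
        qed
        have "\<phi> \<in> hom (G \<alpha>) series_mon"
        proof (rule homI)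
          fix x y assume xy: "x \<in> carrier (G \<alpha>)" "y \<in> carrier (G \<alpha>)"
          then obtain \<beta> where \<beta>: "\<beta> \<in> underS r \<alpha>" "x \<in> carrier (G \<beta>)" "y \<in> carrier (G \<beta>)" using two by blast
          interpret Gb: group "G \<beta>" using group_extD(1)[OF underS_ext[OF \<beta>(1)]] .
          have "x \<otimes>\<^bsub>G \<alpha>\<^esub> y = x \<otimes>\<^bsub>G \<beta>\<^esub> y" using group_extD(5)[OF underS_ext[OF \<beta>(1)] \<beta>(2,3)] .
          then show "\<phi> (x \<otimes>\<^bsub>G \<alpha>\<^esub> y) = \<phi> x \<otimes>\<^bsub>series_mon\<^esub> \<phi> y"
            using hom_mult[OF series_embeddingD(2)[OF IH(2)[OF \<beta>(1)]] \<beta>(2,3)] \<beta> \<phi> by simp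
        qed (use closed series_in_tid in blast)
        moreover have "inj_on \<phi> (carrier (G \<alpha>))"
        proof (rule inj_onI)
          fix x y assume xy: "x \<in> carrier (G \<alpha>)" "y \<in> carrier (G \<alpha>)" "\<phi> x = \<phi> y"
          then obtain \<beta> where \<beta>: "\<beta> \<in> underS r \<alpha>" "x \<in> carrier (G \<beta>)" "y \<in> carrier (G \<beta>)" using two by blast
          then show "x = y"
            using xy(3) \<phi> series_embeddingD(1)[OF IH(2)[OF \<beta>(1)]] by (auto simp: mon_def dest: inj_onD)
        qed
        ultimately have "series_embedding (G \<alpha>) \<phi> (J \<alpha>)"
          using closed by (auto simp: series_embedding_def mon_def)
        moreover have "BP_group (G \<alpha>)"
          by (rule BP_group_directed_union[OF ne underS_ext IH(1) _ dir]) (simp_all add: carrier)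
        ultimately show ?thesis using \<phi> unfolding P_def by blast
      qed
    qed
  qed
  then obtain \<Phi> where "P \<Phi> \<delta> (\<Phi> \<delta>)" by blast
  then show ?thesis using \<delta>(1) unfolding P_def by blast
qed

text \<open>Downwards both properties pass to the subgroup G zero. Upwards the recursion ends with
  polynomial coefficients, which \<open>embed_complex\<close> turns into complex numbers.\<close>

lemma chain_top_iff_bottom:
  "BP_group (G \<delta>) \<and> embeddable (G \<delta>) series_group \<longleftrightarrow> BP_group (G zero) \<and> embeddable (G zero) series_group"
proof
  have ext: "group_ext (G zero) (G \<delta>)" using group_chainD[OF chain] \<delta> zero(1) by blast
  assume top: "BP_group (G \<delta>) \<and> embeddable (G \<delta>) series_group"
  then obtain \<Phi> where \<Phi>: "\<Phi> \<in> hom (G \<delta>) series_group" "inj_on \<Phi> (carrier (G \<delta>))"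
    by (auto simp: embeddable_def mon_def)
  have "\<Phi> \<in> mon (G zero) series_group"
    using hom_compose[OF group_extD(7)[OF ext] \<Phi>(1)] inj_on_subset[OF \<Phi>(2) group_extD(3)[OF ext]]
    by (simp add: mon_def comp_def)
  then show "BP_group (G zero) \<and> embeddable (G zero) series_group"
    using BP_group_ext[OF ext] top by (auto simp: embeddable_def)
next
  assume bottom: "BP_group (G zero) \<and> embeddable (G zero) series_group"
  then obtain \<Phi>0 where "\<Phi>0 \<in> mon (G zero) series_group" by (auto simp: embeddable_def)
  from chain_BP_embeddings[OF _ this] bottom obtain \<Phi> :: "'a \<Rightarrow> (real, complex) mpoly fps" and J where
    BP: "BP_group (G \<delta>)" and \<Phi>: "series_embedding (G \<delta>) \<Phi> J" by blast
  obtain \<theta> :: "(real, complex) mpoly \<Rightarrow> complex" where \<theta>: "ring_hom1 \<theta>" "inj \<theta>"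
    using embed_complex[OF mpoly_complex_card] by blast
  have "inj (fps_map \<theta>)" using \<theta>(2) by (intro injI fps_ext) (metis fps_map_nth injD)
  then have "inj_on (fps_map \<theta> \<circ> \<Phi>) (carrier (G \<delta>))"
    using series_embeddingD(1)[OF \<Phi>] by (auto simp: mon_def intro: comp_inj_on inj_on_subset)
  moreover have "fps_map \<theta> \<circ> \<Phi> \<in> hom (G \<delta>) series_mon"
    by (rule hom_compose[OF series_embeddingD(2)[OF \<Phi>] ring_hom1_fps_map_hom[OF \<theta>(1)]])
  ultimately have "fps_map \<theta> \<circ> \<Phi> \<in> mon (G \<delta>) series_group" by (simp add: mon_def series_group_eq)
  then show "BP_group (G \<delta>) \<and> embeddable (G \<delta>) series_group" using BP by (auto simp: embeddable_def)
qed

end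

theorem theorem1p2:
  fixes r :: "'i rel" and zero \<delta> :: 'i and G :: "'i \<Rightarrow> 'a monoid"
  assumes "Well_order r"
    and "zero \<in> Field r" and "\<forall>\<alpha>\<in>Field r. (zero, \<alpha>) \<in> r"
    and "\<delta> \<in> Field r" and "\<forall>\<alpha>\<in>Field r. (\<alpha>, \<delta>) \<in> r"
    and "|underS r \<delta>| \<le>o |UNIV :: real set|"
    and "group_chain r G"
    and "\<And>l. is_limit r l \<Longrightarrow> carrier (G l) = (\<Union>\<alpha>\<in>underS r l. carrier (G \<alpha>))"
    and "\<And>\<alpha> \<beta>. is_successor r \<alpha> \<beta> \<Longrightarrow>
           amalgam_step (G \<alpha>) (G \<beta>) \<or> centralizer_step (G \<alpha>) (G \<beta>)"
  shows "(BP_group (G \<delta>) \<and> embeddable (G \<delta>) series_group) \<longleftrightarrow>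
         (BP_group (G zero) \<and> embeddable (G zero) series_group)"
  using assms by (rule chain_top_iff_bottom)

end
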